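(* Let $G$ be a finite group and let $p$ be a prime. Then $G$ has only one super-Brauer character theory (with respect to $p$) if and only if $G$ has only one or two $p$-regular conjugacy classes.
   Context: Let $G$ be a finite group and $p$ a prime. $G^\circ$ denotes the set of $p$-regular elements of $G$ (elements of order not divisible by $p$, including the identity); a $p$-regular conjugacy class is a conjugacy class of $G$ contained in $G^\circ$. $\mathrm{IBr}(G)$ denotes the set of irreducible $p$-Brauer characters of $G$ (functions on $G^\circ$). A super-Brauer character theory of $G$ (with respect to $p$) is a pair $(\mathfrak{X},\mathfrak{K})$, where $\mathfrak{X}$ is a partition of $\mathrm{IBr}(G)$ into nonempty sets and $\mathfrak{K}$ is a partition of $G^\circ$ into nonempty sets, such that (1) $|\mathfrak{X}|=|\mathfrak{K}|$; (2) for each $X\in\mathfrak{X}$ there is a nonzero Brauer character $\theta_X$ of $G$, all of whose irreducible constituents lie in $X$, such that $\theta_X$ is constant on every $K\in\mathfrak{K}$; (3) $\{1\}\in\mathfrak{K}$. *)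

theory Defs
  imports
    "HOL-Library.Disjoint_Sets"
    "HOL-Library.FuncSet"
    "HOL-Algebra.Group_Action"
    "HOL-Algebra.Multiplicative_Group"
    "Jordan_Normal_Form.Char_Poly"
    "Jordan_Normal_Form.VS_Connect"
begin

subsection \<open>p-regular elements and classes\<close>

definition p_regular_elements :: "('a, 'b) monoid_scheme \<Rightarrow> nat \<Rightarrow> 'a set" where
  "p_regular_elements G p = {g \<in> carrier G. \<not> p dvd group.ord G g}"

definition conjugacy_classes :: "('a, 'b) monoid_scheme \<Rightarrow> 'a set set" where
  "conjugacy_classes G =
     orbits G (carrier G) (\<lambda>g. \<lambda>h\<in>carrier G. g \<otimes>\<^bsub>G\<^esub> h \<otimes>\<^bsub>G\<^esub> inv\<^bsub>G\<^esub> g)"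

definition p_regular_classes :: "('a, 'b) monoid_scheme \<Rightarrow> nat \<Rightarrow> 'a set set" where
  "p_regular_classes G p = {C \<in> conjugacy_classes G. C \<subseteq> p_regular_elements G p}"

subsection \<open>Reduction modulo a maximal ideal above p\<close>

text \<open>
  Brauer characters depend on the choice of a maximal ideal \<open>M\<close> containing \<open>p\<close> of the ring
  \<open>R\<close> of algebraic integers in \<open>complex\<close>. The choice is represented by the quotient map
  \<open>red\<close> from \<open>R\<close> onto the residue field \<open>F = R/M\<close>, an algebraic closure of the prime field
  of characteristic \<open>p\<close>: the type \<open>'k\<close> plays the role of \<open>F\<close>, and \<open>M\<close> is the kernel, which
  is maximal because \<open>'k\<close> is a field and \<open>red\<close> is onto. Values of \<open>red\<close> outside \<open>R\<close> are
  irrelevant. For every prime \<open>p\<close> and every such \<open>M\<close>, a type copy of \<open>R/M\<close> gives an instance.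
\<close>

locale p_modular_reduction =
  fixes p :: nat and red :: "complex \<Rightarrow> 'k :: field"
  assumes red_one: "red 1 = 1"
    and red_add: "algebraic_int x \<Longrightarrow> algebraic_int y \<Longrightarrow> red (x + y) = red x + red y"
    and red_mult: "algebraic_int x \<Longrightarrow> algebraic_int y \<Longrightarrow> red (x * y) = red x * red y"
    and red_surj: "red ` {x. algebraic_int x} = UNIV"
    and red_p: "red (of_nat p) = 0"

text \<open>The exponent \<open>n\<close> is automatically positive, since \<open>p dvd 0\<close>.\<close>

definition p'_roots_of_unity :: "nat \<Rightarrow> complex set" where
  "p'_roots_of_unity p = {\<xi>. \<exists>n. \<not> p dvd n \<and> \<xi> ^ n = 1}"

text \<open>
  \<open>red\<close> restricts to a bijection from \<open>p'_roots_of_unity p\<close> onto the nonzero elements of \<open>F\<close>,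
  so the description below is unique for every nonzero \<open>x\<close>.
\<close>

definition lift_root :: "nat \<Rightarrow> (complex \<Rightarrow> 'k :: field) \<Rightarrow> 'k \<Rightarrow> complex" where
  "lift_root p red x = (THE \<xi>. \<xi> \<in> p'_roots_of_unity p \<and> red \<xi> = x)"

subsection \<open>Modular representations and Brauer characters\<close>

definition matrix_rep ::
    "('a, 'b) monoid_scheme \<Rightarrow> nat \<Rightarrow> ('a \<Rightarrow> 'k :: field mat) \<Rightarrow> bool" where
  "matrix_rep G n \<rho> \<longleftrightarrow>
     (\<forall>g\<in>carrier G. \<rho> g \<in> carrier_mat n n) \<and>
     \<rho> \<one>\<^bsub>G\<^esub> = 1\<^sub>m n \<and>
     (\<forall>g\<in>carrier G. \<forall>h\<in>carrier G. \<rho> (g \<otimes>\<^bsub>G\<^esub> h) = \<rho> g * \<rho> h)"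

definition irreducible_rep ::
    "('a, 'b) monoid_scheme \<Rightarrow> nat \<Rightarrow> ('a \<Rightarrow> 'k :: field mat) \<Rightarrow> bool" where
  "irreducible_rep G n \<rho> \<longleftrightarrow>
     matrix_rep G n \<rho> \<and> 0 < n \<and>
     (\<forall>W. VectorSpace.subspace class_ring W (module_vec TYPE('k) n) \<longrightarrow>
          (\<forall>g\<in>carrier G. \<forall>w\<in>W. \<rho> g *\<^sub>v w \<in> W) \<longrightarrow>
          W = {0\<^sub>v n} \<or> W = carrier_vec n)"

text \<open>
  The value at \<open>g\<close> is the sum of the lifted eigenvalues of \<open>\<rho> g\<close>, each counted with its
  algebraic multiplicity. Functions on the p-regular elements are extensional, so that
  distinct terms always denote distinct functions on that set.
\<close>

definition brauer_character_of ::
    "('a, 'b) monoid_scheme \<Rightarrow> nat \<Rightarrow> (complex \<Rightarrow> 'k :: field) \<Rightarrow> ('a \<Rightarrow> 'k mat) \<Rightarrow> 'a \<Rightarrow> complex"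
where
  "brauer_character_of G p red \<rho> =
     (\<lambda>g\<in>p_regular_elements G p.
        \<Sum>x | eigenvalue (\<rho> g) x.
          of_nat (Polynomial.order x (char_poly (\<rho> g))) * lift_root p red x)"

text \<open>Degree \<open>n = 0\<close> is allowed here; it affords the zero character.\<close>

definition brauer_characters ::
    "('a, 'b) monoid_scheme \<Rightarrow> nat \<Rightarrow> (complex \<Rightarrow> 'k :: field) \<Rightarrow> ('a \<Rightarrow> complex) set" where
  "brauer_characters G p red =
     {brauer_character_of G p red \<rho> | \<rho> n. matrix_rep G n \<rho>}"

definition IBr ::
    "('a, 'b) monoid_scheme \<Rightarrow> nat \<Rightarrow> (complex \<Rightarrow> 'k :: field) \<Rightarrow> ('a \<Rightarrow> complex) set" where
  "IBr G p red = {brauer_character_of G p red \<rho> | \<rho> n. irreducible_rep G n \<rho>}"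

text \<open>
  \<open>IBr\<close> is finite and linearly independent, and every Brauer character is a combination of
  its elements with coefficients in \<open>nat\<close>. So the multiplicities \<open>m\<close> below exist and are
  unique on \<open>IBr\<close>; the constituents are the elements of positive multiplicity.
\<close>

definition irreducible_constituents ::
    "('a, 'b) monoid_scheme \<Rightarrow> nat \<Rightarrow> (complex \<Rightarrow> 'k :: field) \<Rightarrow> ('a \<Rightarrow> complex)
      \<Rightarrow> ('a \<Rightarrow> complex) set" where
  "irreducible_constituents G p red \<theta> =
     {\<phi> \<in> IBr G p red. \<exists>m :: ('a \<Rightarrow> complex) \<Rightarrow> nat.
        (\<forall>g\<in>p_regular_elements G p. \<theta> g = (\<Sum>\<psi>\<in>IBr G p red. of_nat (m \<psi>) * \<psi> g)) \<and>
        0 < m \<phi>}"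

subsection \<open>Super-Brauer character theories\<close>

definition super_brauer_character_theory ::
    "('a, 'b) monoid_scheme \<Rightarrow> nat \<Rightarrow> (complex \<Rightarrow> 'k :: field)
      \<Rightarrow> ('a \<Rightarrow> complex) set set \<times> 'a set set \<Rightarrow> bool" where
  "super_brauer_character_theory G p red = (\<lambda>(\<XX>, \<KK>).
     partition_on (IBr G p red) \<XX> \<and>
     partition_on (p_regular_elements G p) \<KK> \<and>
     card \<XX> = card \<KK> \<and>
     (\<forall>X\<in>\<XX>. \<exists>\<theta>\<in>brauer_characters G p red.
        (\<exists>g\<in>p_regular_elements G p. \<theta> g \<noteq> 0) \<and>
        irreducible_constituents G p red \<theta> \<subseteq> X \<and>
        (\<forall>K\<in>\<KK>. \<exists>c. \<forall>g\<in>K. \<theta> g = c)) \<and>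
     {\<one>\<^bsub>G\<^esub>} \<in> \<KK>)"

end

theory Submission
  imports Defs
    "HOL-Computational_Algebra.Fundamental_Theorem_Algebra"
    "HOL-Library.Function_Algebras"
    "HOL-Algebra.Sylow"
    "HOL-Number_Theory.Cong"
begin

text \<open>
  There are two extreme theories. The finest one, with singletons on one side and the
  p-regular classes on the other, exists because the number of irreducible Brauer characters equals
  the number of p-regular classes. If the identity is not the only p-regular element, the coarsest
  one, which separates only the trivial character and the identity from the rest, exists because the
  regular Brauer character vanishes off the identity. They differ as soon as there are three
  p-regular classes, and with at most two classes counting leaves no other theory.

  Brauer's count is obtained from the reductions of the irreducible Brauer characters to the residue
  field \<open>F\<close>. They are the irreducible traces restricted to the p-regular elements; these are linearly
  independent over \<open>F\<close>, because \<open>F\<close> is algebraically closed and taking traces commutes with the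
  Frobenius map. They span all class functions, because inducing the linear characters of
  \<open>\<langle>g\<rangle> \<times> P\<close>, for a Sylow p-subgroup \<open>P\<close> of the centralizer of \<open>g\<close>, yields the indicator of the class
  of \<open>g\<close> up to a nonzero factor. Independence over \<open>F\<close> also makes the multiplicities of
  constituents unique, by dividing an integer relation by \<open>p\<close> repeatedly.
\<close>

subsection \<open>Algebraic integers\<close>

text \<open>The count is made over the residue field \<open>F\<close>, where two explicit families
  of functions can be compared by dimension. The obstacle is that independence of irreducible traces
  is naturally a statement about all of \<open>G\<close>, while Brauer characters live on the
  p-regular elements only. Raising to the power \<open>q = p ^ a\<close>, the full power of
  \<open>p\<close> in the group order, moves every element into the p-regular ones and raises its
  trace to the \<open>q\<close>-th power. Taking \<open>q\<close>-th roots of the coefficients,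
  which exist in an algebraically closed field, therefore extends a relation from the p-regular
  elements to the whole group. That \<open>F\<close> is algebraically closed has to be derived: a
  monic polynomial over \<open>F\<close> lifts to one over the algebraic integers, and its complex
  roots are again algebraic integers. This is why the development starts with integrality. The count
  also restricts the theories themselves: a partition of \<open>IBr\<close> with as many blocks as
  there are classes consists of singletons.\<close>

definition zspan :: "complex set \<Rightarrow> complex set" where
  "zspan S = {\<Sum>s\<in>S. of_int (f s) * s | f. True}"

lemma zspan_zero: "0 \<in> zspan S"
  unfolding zspan_def by (auto intro!: exI[of _ "\<lambda>_. 0"])

lemma zspan_add: "x \<in> zspan S \<Longrightarrow> y \<in> zspan S \<Longrightarrow> x + y \<in> zspan S"
proof -
  assume "x \<in> zspan S" "y \<in> zspan S"
  then obtain f g where "x = (\<Sum>s\<in>S. of_int (f s) * s)" "y = (\<Sum>s\<in>S. of_int (g s) * s)"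
    unfolding zspan_def by auto
  then have "x + y = (\<Sum>s\<in>S. of_int (f s + g s) * s)"
    by (simp add: sum.distrib algebra_simps)
  then show ?thesis unfolding zspan_def by (intro CollectI exI[of _ "\<lambda>s. f s + g s"]) simp
qed

lemma zspan_int_mult: "x \<in> zspan S \<Longrightarrow> of_int k * x \<in> zspan S"
proof -
  assume "x \<in> zspan S"
  then obtain f where "x = (\<Sum>s\<in>S. of_int (f s) * s)"
    unfolding zspan_def by auto
  then have "of_int k * x = (\<Sum>s\<in>S. of_int (k * f s) * s)"
    by (simp add: sum_distrib_left algebra_simps)
  then show ?thesis unfolding zspan_def by (intro CollectI exI[of _ "\<lambda>s. k * f s"]) simp
qed

lemma zspan_base:
  assumes "finite S" "s \<in> S" shows "s \<in> zspan S"
proof -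
  have "s = (\<Sum>t\<in>S. if t = s then t else 0)"
    using assms by simp
  also have "\<dots> = (\<Sum>t\<in>S. of_int (if t = s then 1 else 0) * t)"
    by (intro sum.cong) auto
  finally show ?thesis unfolding zspan_def by (intro CollectI exI[of _ "\<lambda>t. if t = s then 1 else 0"]) simp
qed

lemma zspan_sum: "(\<And>i. i \<in> I \<Longrightarrow> h i \<in> zspan S) \<Longrightarrow> (\<Sum>i\<in>I. h i) \<in> zspan S"
  by (induction I rule: infinite_finite_induct) (auto simp: zspan_zero zspan_add)

text \<open>A complex number is integral exactly when it multiplies some nonzero finitely generated
  additive group into itself. In this form closure under sums and products is immediate, whereas a
  monic polynomial for a sum is not at hand.\<close>

definition stabilizer_ring :: "complex set \<Rightarrow> complex set" where
  "stabilizer_ring S = {x. \<forall>m\<in>zspan S. x * m \<in> zspan S}"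

lemma stabilizer_ringI:
  assumes "\<And>s. s \<in> S \<Longrightarrow> x * s \<in> zspan S"
  shows "x \<in> stabilizer_ring S"
  unfolding stabilizer_ring_def
proof (intro CollectI ballI)
  fix m assume "m \<in> zspan S"
  then obtain f where m: "m = (\<Sum>s\<in>S. of_int (f s) * s)"
    unfolding zspan_def by auto
  have "x * m = (\<Sum>s\<in>S. of_int (f s) * (x * s))"
    unfolding m by (simp add: sum_distrib_left algebra_simps)
  also have "\<dots> \<in> zspan S"
    by (intro zspan_sum zspan_int_mult assms)
  finally show "x * m \<in> zspan S" .
qed

lemma stabilizer_ring_add:
  "x \<in> stabilizer_ring S \<Longrightarrow> y \<in> stabilizer_ring S \<Longrightarrow> x + y \<in> stabilizer_ring S"
  unfolding stabilizer_ring_def by (auto simp: algebra_simps zspan_add)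

lemma stabilizer_ring_mult:
  "x \<in> stabilizer_ring S \<Longrightarrow> y \<in> stabilizer_ring S \<Longrightarrow> x * y \<in> stabilizer_ring S"
  unfolding stabilizer_ring_def by (auto simp: mult.assoc)

lemma stabilizer_ring_of_int: "of_int k \<in> stabilizer_ring S"
  unfolding stabilizer_ring_def by (auto simp: zspan_int_mult)

text \<open>Multiplication by \<open>x\<close> on the generators is described by an integer matrix
  that has the vector of generators as an eigenvector for \<open>x\<close>. So \<open>x\<close> is a
  root of a monic integer polynomial. The generator \<open>1\<close> keeps that vector
  nonzero.\<close>

lemma algebraic_int_of_stabilizer_ring:
  assumes "finite S" "1 \<in> S" "x \<in> stabilizer_ring S"
  shows "algebraic_int x"
proof -
  obtain n :: nat and v where v: "bij_betw v {0..<n} S"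
    using ex_bij_betw_nat_finite[OF assms(1)] by blast
  have "\<forall>i. \<exists>f. i < n \<longrightarrow> x * v i = (\<Sum>s\<in>S. of_int (f s) * s)"
  proof
    fix i
    show "\<exists>f. i < n \<longrightarrow> x * v i = (\<Sum>s\<in>S. of_int (f s) * s)"
    proof (cases "i < n")
      case True
      then have "v i \<in> zspan S"
        using v assms(1) by (intro zspan_base) (auto simp: bij_betw_def)
      then have "x * v i \<in> zspan S" using assms(3) by (simp add: stabilizer_ring_def)
      then show ?thesis by (auto simp: zspan_def)
    qed auto
  qed
  then obtain f where f: "\<And>i. i < n \<Longrightarrow> x * v i = (\<Sum>s\<in>S. of_int (f i s) * s)"
    by metis
  define A where "A = mat n n (\<lambda>(i, j). f i (v j))"
  define w where "w = vec n v"
  have A: "A \<in> carrier_mat n n" and w: "w \<in> carrier_vec n" by (auto simp: A_def w_def)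
  let ?A = "map_mat of_int A :: complex mat"
  have "?A *\<^sub>v w = x \<cdot>\<^sub>v w"
  proof (rule eq_vecI)
    show "dim_vec (?A *\<^sub>v w) = dim_vec (x \<cdot>\<^sub>v w)" using A w by auto
    fix i assume "i < dim_vec (x \<cdot>\<^sub>v w)"
    then have i: "i < n" using w by auto
    have "(?A *\<^sub>v w) $ i = (\<Sum>j = 0..<n. of_int (f i (v j)) * v j)"
      using i by (simp add: A_def w_def scalar_prod_def)
    also have "\<dots> = (\<Sum>s\<in>S. of_int (f i s) * s)"
      by (rule sum.reindex_bij_betw[OF v])
    finally show "(?A *\<^sub>v w) $ i = (x \<cdot>\<^sub>v w) $ i"
      using f[OF i] i by (simp add: w_def)
  qed
  moreover have "w \<noteq> 0\<^sub>v n"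
  proof
    assume 0: "w = 0\<^sub>v n"
    obtain i where i: "i < n" "v i = 1" using v assms(2) by (auto simp: bij_betw_def image_iff)
    have "w $ i = 1" using i by (simp add: w_def)
    then show False using 0 i by simp
  qed
  ultimately have "eigenvalue ?A x"
    unfolding eigenvalue_def eigenvector_def using A w by auto
  then have "poly (char_poly ?A) x = 0"
    using A eigenvalue_root_char_poly[of ?A n x] by auto
  then have "poly (of_int_poly (char_poly A)) x = 0"
    using of_int_hom.char_poly_hom[OF A] by metis
  moreover have "lead_coeff (char_poly A) = 1" using degree_monic_char_poly[OF A] by auto
  ultimately show ?thesis unfolding algebraic_int_altdef_ipoly by auto
qed

text \<open>The group is enlarged by the powers of \<open>x\<close> below \<open>d\<close>.
  Multiplication by \<open>x\<close> shifts exponents, and the old stabilizers still act on the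
  factor from \<open>S\<close>, so integral elements can be adjoined one after another.\<close>

lemma stabilizer_ring_root_ext:
  assumes S: "finite S" "1 \<in> S"
    and d: "d > 0" and eq: "x ^ d = (\<Sum>i<d. c i * x ^ i)"
    and c: "\<And>i. i < d \<Longrightarrow> c i \<in> stabilizer_ring S"
  shows "\<exists>S'. finite S' \<and> 1 \<in> S' \<and> x \<in> stabilizer_ring S' \<and> stabilizer_ring S \<subseteq> stabilizer_ring S'"
proof (intro exI conjI)
  define S' where "S' = (\<lambda>(s, e). s * x ^ e) ` (S \<times> {..<d})"
  show fin: "finite S'" using S by (simp add: S'_def)
  show "1 \<in> S'" unfolding S'_def using S d by (force intro!: image_eqI[of _ _ "(1, 0)"])
  have base: "m * x ^ e \<in> zspan S'" if "m \<in> zspan S" "e < d" for m e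
  proof -
    obtain f where m: "m = (\<Sum>s\<in>S. of_int (f s) * s)"
      using \<open>m \<in> zspan S\<close> unfolding zspan_def by auto
    have "m * x ^ e = (\<Sum>s\<in>S. of_int (f s) * (s * x ^ e))"
      unfolding m by (simp add: sum_distrib_right mult.assoc)
    also have "\<dots> \<in> zspan S'"
      using that by (intro zspan_sum zspan_int_mult zspan_base fin) (auto simp: S'_def)
    finally show ?thesis .
  qed
  show "x \<in> stabilizer_ring S'"
  proof (rule stabilizer_ringI)
    fix t assume "t \<in> S'"
    then obtain s e where t: "t = s * x ^ e" "s \<in> S" "e < d" by (auto simp: S'_def)
    have s: "s \<in> zspan S" using t S by (simp add: zspan_base)
    show "x * t \<in> zspan S'"
    proof (cases "Suc e < d")
      case True
      then show ?thesis using base[OF s True] t by (simp add: mult_ac)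
    next
      case False
      \<comment> \<open>The shift leaves the range only at the top exponent. There the relation for
        \<open>x ^ d\<close> brings the product back, with coefficients that stabilize the old
        group.\<close>
      then have e: "d = Suc e" using t by simp
      have "x * t = s * x ^ d" unfolding e t by (simp add: mult_ac)
      also have "\<dots> = (\<Sum>i<d. (c i * s) * x ^ i)"
        unfolding eq by (simp add: sum_distrib_left mult_ac)
      also have "\<dots> \<in> zspan S'"
        using c s by (intro zspan_sum base) (auto simp: stabilizer_ring_def)
      finally show ?thesis .
    qed
  qed
  show "stabilizer_ring S \<subseteq> stabilizer_ring S'"
  proof
    fix y assume y: "y \<in> stabilizer_ring S"
    show "y \<in> stabilizer_ring S'"
    proof (rule stabilizer_ringI)
      fix t assume "t \<in> S'"
      then obtain s e where t: "t = s * x ^ e" "s \<in> S" "e < d" by (auto simp: S'_def)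
      have "y * s \<in> zspan S" using y t S by (auto simp: stabilizer_ring_def zspan_base)
      from base[OF this t(3)] show "y * t \<in> zspan S'" using t by (simp add: mult_ac)
    qed
  qed
qed

lemma monic_root_power_eq:
  fixes x :: "'a :: comm_ring_1"
  assumes "poly f x = 0" "lead_coeff f = 1"
  shows "x ^ degree f = (\<Sum>i<degree f. - coeff f i * x ^ i)"
proof -
  have "0 = (\<Sum>i<Suc (degree f). coeff f i * x ^ i)"
    using assms(1) by (simp add: poly_altdef lessThan_Suc_atMost)
  then show ?thesis using assms(2) by (simp add: sum_negf add_eq_0_iff)
qed

lemma algebraic_ints_stabilize:
  assumes "finite C" "\<forall>c\<in>C. algebraic_int c"
  shows "\<exists>S. finite S \<and> 1 \<in> S \<and> C \<subseteq> stabilizer_ring S"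
  using assms
proof (induction C rule: finite_induct)
  case empty
  then show ?case by (intro exI[of _ "{1}"]) auto
next
  case (insert c C)
  then obtain S where S: "finite S" "1 \<in> S" "C \<subseteq> stabilizer_ring S" by auto
  obtain f :: "int poly" where f: "poly (of_int_poly f) c = 0" "lead_coeff f = 1"
    using insert.prems by (auto simp: algebraic_int_altdef_ipoly)
  let ?f = "of_int_poly f :: complex poly"
  have eq: "c ^ degree ?f = (\<Sum>i<degree ?f. - coeff ?f i * c ^ i)"
    using f by (intro monic_root_power_eq) auto
  \<comment> \<open>In degree \<open>0\<close> the relation \<open>eq\<close> would read
    \<open>1 = 0\<close>.\<close>
  have d: "degree ?f > 0"
  proof (rule ccontr)
    assume "\<not> degree ?f > 0"
    then show False using eq by simp
  qed
  have "- coeff ?f i \<in> stabilizer_ring S" for i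
    using stabilizer_ring_of_int[of "- coeff f i" S] by simp
  from stabilizer_ring_root_ext[OF S(1,2) d eq this]
  show ?case using S(3) by (meson insert_subset order_trans)
qed

section \<open>Closure properties of the algebraic integers\<close>

lemma algebraic_int_add:
  fixes x y :: complex
  assumes "algebraic_int x" "algebraic_int y" shows "algebraic_int (x + y)"
proof -
  obtain S where "finite S" "1 \<in> S" "{x, y} \<subseteq> stabilizer_ring S"
    using algebraic_ints_stabilize[of "{x, y}"] assms by auto
  then show ?thesis
    using algebraic_int_of_stabilizer_ring[of S "x + y"] stabilizer_ring_add by auto
qed

lemma algebraic_int_mult:
  fixes x y :: complex
  assumes "algebraic_int x" "algebraic_int y" shows "algebraic_int (x * y)"
proof -
  obtain S where "finite S" "1 \<in> S" "{x, y} \<subseteq> stabilizer_ring S"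
    using algebraic_ints_stabilize[of "{x, y}"] assms by auto
  then show ?thesis
    using algebraic_int_of_stabilizer_ring[of S "x * y"] stabilizer_ring_mult by auto
qed

lemma algebraic_int_sum:
  fixes f :: "'i \<Rightarrow> complex"
  shows "(\<And>i. i \<in> I \<Longrightarrow> algebraic_int (f i)) \<Longrightarrow> algebraic_int (\<Sum>i\<in>I. f i)"
  by (induction I rule: infinite_finite_induct) (auto simp: algebraic_int_add)

lemma algebraic_int_power:
  fixes x :: complex
  shows "algebraic_int x \<Longrightarrow> algebraic_int (x ^ n)"
  by (induction n) (auto simp: algebraic_int_mult int_imp_algebraic_int)

text \<open>Transitivity of integrality: the finitely many coefficients stabilize one common group,
  to which the powers of \<open>x\<close> are adjoined.\<close>

lemma algebraic_int_monic_root: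
  fixes x :: complex
  assumes "poly f x = 0" "lead_coeff f = 1" "\<And>i. algebraic_int (coeff f i)"
  shows "algebraic_int x"
proof -
  obtain S where S: "finite S" "1 \<in> S" "coeff f ` {..degree f} \<subseteq> stabilizer_ring S"
    using algebraic_ints_stabilize[of "coeff f ` {..degree f}"] assms(3) by auto
  note eq = monic_root_power_eq[OF assms(1,2)]
  have d: "degree f > 0"
  proof (rule ccontr)
    assume "\<not> degree f > 0"
    then show False using eq by simp
  qed
  have "- coeff f i \<in> stabilizer_ring S" if "i < degree f" for i
    using S(3) that stabilizer_ring_mult[OF stabilizer_ring_of_int[of "-1"], of "coeff f i" S]
    by (auto simp: subset_iff)
  from stabilizer_ring_root_ext[OF S(1,2) d eq this]
  obtain S' where "finite S'" "1 \<in> S'" "x \<in> stabilizer_ring S'" by blast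
  then show ?thesis by (rule algebraic_int_of_stabilizer_ring)
qed

subsection \<open>Reduction modulo a maximal ideal\<close>

lemma degree_monom_minus_1:
  assumes "n > 0" shows "degree (monom 1 n - 1 :: 'a :: comm_ring_1 poly) = n"
  using assms by (intro antisym degree_le le_degree) auto

lemma card_unity_roots:
  assumes n: "n > 0"
  shows "finite {x :: 'a :: idom. x ^ n = 1}" "card {x :: 'a. x ^ n = 1} \<le> n"
proof -
  let ?f = "monom 1 n - 1 :: 'a poly"
  have deg: "degree ?f = n" by (rule degree_monom_minus_1[OF n])
  have eq: "{x :: 'a. x ^ n = 1} = {x. poly ?f x = 0}" by (auto simp: poly_monom)
  have 0: "?f \<noteq> 0" using deg n by auto
  show "finite {x :: 'a. x ^ n = 1}" "card {x :: 'a. x ^ n = 1} \<le> n"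
    unfolding eq using poly_roots_finite[OF 0] card_poly_roots_bound[OF 0] deg by auto
qed

lemma unity_root_power_mod:
  fixes z :: "'a :: comm_monoid_mult"
  shows "z ^ n = 1 \<Longrightarrow> z ^ k = z ^ (k mod n)"
  by (metis div_mult_mod_eq mult.commute mult_1 power_add power_mult power_one)

lemma algebraic_int_of_nat: "algebraic_int (of_nat n :: complex)"
  by (simp add: int_imp_algebraic_int)

locale modular = p_modular_reduction p red
  for p and red :: "complex \<Rightarrow> 'k :: field" +
  assumes prime_p: "prime p"
begin

lemma red_0 [simp]: "red 0 = 0"
proof -
  have "red (0 + 0) = red 0 + red 0" by (rule red_add) auto
  then have "red 0 + 0 = red 0 + red 0" by (simp only: add_0_right)
  then show ?thesis by (simp only: add_left_cancel)
qed

lemma red_minus: "algebraic_int x \<Longrightarrow> red (- x) = - red x"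
  using red_add[of x "- x"] by (simp add: add_eq_0_iff)

lemma red_sum: "(\<And>i. i \<in> I \<Longrightarrow> algebraic_int (f i)) \<Longrightarrow> red (\<Sum>i\<in>I. f i) = (\<Sum>i\<in>I. red (f i))"
  by (induction I rule: infinite_finite_induct) (auto simp: red_add algebraic_int_sum)

lemma red_power: "algebraic_int x \<Longrightarrow> red (x ^ n) = red x ^ n"
  by (induction n) (auto simp: red_one red_mult algebraic_int_power)

lemma red_of_nat: "red (of_nat n) = of_nat n"
proof (induction n)
  case (Suc n)
  then show ?case using red_add[of 1 "of_nat n"] algebraic_int_of_nat[of n] algebraic_int_of_nat[of 1]
    by (simp add: red_one)
qed simp

lemma red_of_int: "red (of_int k) = of_int k"
proof (cases k)
  case (nonneg n)
  then show ?thesis using red_of_nat by simp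
next
  case (neg n)
  have "red (- of_nat (Suc n)) = - of_nat (Suc n)"
    using red_minus[OF algebraic_int_of_nat] red_of_nat by metis
  moreover have "of_int k = (- of_nat (Suc n) :: complex)" "of_int k = (- of_nat (Suc n) :: 'k)"
    by (simp_all add: neg)
  ultimately show ?thesis by metis
qed

lemma CHAR_eq: "CHAR('k) = p"
proof -
  have "of_nat p = (0 :: 'k)" using red_p red_of_nat by simp
  then have "CHAR('k) dvd p" by (simp add: of_nat_eq_0_iff_char_dvd)
  then show ?thesis using prime_p CHAR_not_1' by (auto simp: prime_nat_iff)
qed

lemma of_nat_eq_0_iff_dvd: "of_nat n = (0 :: 'k) \<longleftrightarrow> p dvd n"
  by (simp add: of_nat_eq_0_iff_char_dvd CHAR_eq)

text \<open>A polynomial is made monic, lifted coefficientwise to the algebraic integers and solved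
  in the complex numbers. The root is integral by \<open>algebraic_int_monic_root\<close>, so it can
  be reduced again.\<close>

lemma alg_closed:
  fixes f :: "'k poly"
  assumes "degree f > 0"
  shows "\<exists>x. poly f x = 0"
proof -
  define g where "g = smult (inverse (lead_coeff f)) f"
  have f0: "lead_coeff f \<noteq> 0" using assms by auto
  have g: "lead_coeff g = 1" "degree g = degree f"
    using f0 by (simp_all add: g_def)
  have "\<forall>y. \<exists>x. algebraic_int x \<and> red x = y"
    using red_surj by (metis (mono_tags, lifting) UNIV_I image_iff mem_Collect_eq)
  from choice[OF this] obtain l where "\<forall>y. algebraic_int (l y) \<and> red (l y) = y" ..
  then have l: "\<And>y. algebraic_int (l y)" "\<And>y. red (l y) = y" by auto
  \<comment> \<open>The leading coefficient is lifted to \<open>1\<close> itself and not to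
    \<open>l 1\<close>, so that \<open>h\<close> stays monic.\<close>
  define h where "h = monom 1 (degree g) + (\<Sum>i<degree g. monom (l (coeff g i)) i)"
  have coeff_h: "coeff h i = (if i = degree g then 1 else if i < degree g then l (coeff g i) else 0)" for i
    by (simp add: h_def coeff_sum)
  have deg_h: "degree h = degree g"
    by (intro antisym degree_le le_degree) (auto simp: coeff_h)
  have "\<not> constant (poly h)"
    using assms g deg_h by (simp add: constant_degree)
  then obtain x where x: "poly h x = 0"
    using fundamental_theorem_of_algebra by blast
  have hi: "algebraic_int (coeff h i)" for i by (auto simp: coeff_h l)
  have xi: "algebraic_int x"
    using algebraic_int_monic_root[OF x _ hi] deg_h by (simp add: coeff_h)
  have "0 = red (poly h x)" using x by simp
  also have "\<dots> = (\<Sum>i\<le>degree g. red (coeff h i) * red x ^ i)"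
    unfolding poly_altdef deg_h
    by (subst red_sum) (auto simp: hi xi algebraic_int_mult algebraic_int_power red_mult red_power)
  also have "\<dots> = (\<Sum>i\<le>degree g. coeff g i * red x ^ i)"
    using g by (intro sum.cong) (auto simp: coeff_h l red_one)
  also have "\<dots> = poly g (red x)" by (simp add: poly_altdef)
  finally have "poly f (red x) = 0" using f0 by (simp add: g_def)
  then show ?thesis ..
qed

section \<open>Roots of unity of order prime to \<open>p\<close> and their reductions\<close>

lemma p'_root_algebraic_int: "\<xi> \<in> p'_roots_of_unity p \<Longrightarrow> algebraic_int \<xi>"
proof -
  assume "\<xi> \<in> p'_roots_of_unity p"
  then obtain n where n: "\<not> p dvd n" "\<xi> ^ n = 1" by (auto simp: p'_roots_of_unity_def)
  have "n > 0" using n by (cases n) auto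
  then have "lead_coeff (monom 1 n - 1 :: complex poly) = 1"
    unfolding degree_monom_minus_1[OF \<open>n > 0\<close>] by simp
  then show ?thesis using n algebraic_int_monic_root[of "monom 1 n - 1" \<xi>]
    by (simp add: poly_monom int_imp_algebraic_int)
     
qed

lemma p'_root_mult:
  assumes "\<xi> \<in> p'_roots_of_unity p" "\<eta> \<in> p'_roots_of_unity p"
  shows "\<xi> * \<eta> \<in> p'_roots_of_unity p"
proof -
  obtain n m where "\<not> p dvd n" "\<xi> ^ n = 1" "\<not> p dvd m" "\<eta> ^ m = 1"
    using assms by (auto simp: p'_roots_of_unity_def)
  then have "\<not> p dvd n * m" "(\<xi> * \<eta>) ^ (n * m) = 1"
    using prime_p by (auto simp: prime_dvd_mult_iff power_mult power_mult_distrib)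
      (metis mult.commute power_mult power_one)
  then show ?thesis by (auto simp: p'_roots_of_unity_def)
qed

lemma p'_root_inverse:
  "\<xi> \<in> p'_roots_of_unity p \<Longrightarrow> inverse \<xi> \<in> p'_roots_of_unity p"
  by (auto simp: p'_roots_of_unity_def power_inverse)

lemma p'_root_1: "1 \<in> p'_roots_of_unity p"
  using prime_p by (auto simp: p'_roots_of_unity_def intro!: exI[of _ 1])

text \<open>If \<open>\<xi> \<noteq> 1\<close> is an \<open>n\<close>-th root of unity, the geometric sum of its powers vanishes,
  whereas it would reduce to \<open>n \<noteq> 0\<close> if \<open>\<xi>\<close> reduced to \<open>1\<close>.\<close>

lemma red_p'_root_eq_1:
  assumes "\<xi> \<in> p'_roots_of_unity p" "red \<xi> = 1"
  shows "\<xi> = 1"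
proof (rule ccontr)
  assume "\<xi> \<noteq> 1"
  obtain n where n: "\<not> p dvd n" "\<xi> ^ n = 1" using assms by (auto simp: p'_roots_of_unity_def)
  have "(\<Sum>i<n. \<xi> ^ i) = 0" using n \<open>\<xi> \<noteq> 1\<close> by (simp add: geometric_sum)
  then have "0 = red (\<Sum>i<n. \<xi> ^ i)" by simp
  also have "\<dots> = (\<Sum>i<n. red \<xi> ^ i)"
    using p'_root_algebraic_int[OF assms(1)]
    by (subst red_sum) (auto simp: red_power algebraic_int_power)
  also have "\<dots> = of_nat n" by (simp add: assms)
  finally show False using n of_nat_eq_0_iff_dvd[of n] by simp
qed

text \<open>A quotient of two such roots is again one, so injectivity comes down to the kernel,
  which is \<open>red_p'_root_eq_1\<close>.\<close>

lemma inj_on_red: "inj_on red (p'_roots_of_unity p)"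
proof
  fix \<xi> \<eta> assume *: "\<xi> \<in> p'_roots_of_unity p" "\<eta> \<in> p'_roots_of_unity p" "red \<xi> = red \<eta>"
  note i = p'_root_inverse[OF *(2)]
  have \<eta>0: "\<eta> \<noteq> 0" using *(2) by (auto simp: p'_roots_of_unity_def power_0_left split: if_splits)
  have "red (\<xi> * inverse \<eta>) = red (\<eta> * inverse \<eta>)"
    using * p'_root_algebraic_int i by (simp add: red_mult)
  then have "red (\<xi> * inverse \<eta>) = 1" using \<eta>0 by (simp add: red_one)
  from red_p'_root_eq_1[OF p'_root_mult[OF *(1) i] this]
  show "\<xi> = \<eta>" using \<eta>0 by (simp add: field_simps)
qed

text \<open>By counting: the \<open>n\<close> complex roots have distinct reductions, and a field
  contains at most \<open>n\<close> solutions of \<open>x ^ n = 1\<close>.\<close>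

lemma red_image_roots:
  assumes "\<not> p dvd n"
  shows "red ` {\<xi>. \<xi> ^ n = 1} = {x. x ^ n = 1}" "card {x :: 'k. x ^ n = 1} = n"
proof -
  have n: "n > 0" using assms by (cases n) auto
  have sub: "{\<xi>. \<xi> ^ n = 1} \<subseteq> p'_roots_of_unity p"
    using assms by (auto simp: p'_roots_of_unity_def)
  note fin = card_unity_roots[OF n, where 'a = 'k]
  have img: "red ` {\<xi>. \<xi> ^ n = 1} \<subseteq> {x. x ^ n = 1}"
    using sub p'_root_algebraic_int by (auto simp flip: red_power simp: red_one subset_iff)
  have card: "card (red ` {\<xi>. \<xi> ^ n = 1}) = n"
    using card_image[OF inj_on_subset[OF inj_on_red sub]] card_roots_unity_eq[OF n] by simp
  show eq: "red ` {\<xi>. \<xi> ^ n = 1} = {x. x ^ n = 1}"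
    using card fin card_mono[OF fin(1) img] by (intro card_subset_eq img) auto
  show "card {x :: 'k. x ^ n = 1} = n" using card eq by simp
qed

lemma lift_root_eq: "\<xi> \<in> p'_roots_of_unity p \<Longrightarrow> lift_root p red (red \<xi>) = \<xi>"
  unfolding lift_root_def using inj_on_red by (intro the_equality) (auto dest: inj_onD)

lemma lift_root:
  assumes "x ^ n = 1" "\<not> p dvd n"
  shows "lift_root p red x \<in> p'_roots_of_unity p" "red (lift_root p red x) = x"
proof -
  obtain \<xi> where \<xi>: "\<xi> ^ n = 1" "x = red \<xi>"
    using red_image_roots(1)[OF assms(2)] assms(1) by blast
  then have "\<xi> \<in> p'_roots_of_unity p" using assms by (auto simp: p'_roots_of_unity_def)
  then show "lift_root p red x \<in> p'_roots_of_unity p" "red (lift_root p red x) = x"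
    using lift_root_eq \<xi> by auto
qed

lemma lift_root_1 [simp]: "lift_root p red 1 = 1"
  using lift_root_eq[OF p'_root_1] red_one by simp

lemma lift_root_mult:
  assumes "x ^ n = 1" "y ^ n = 1" "\<not> p dvd n"
  shows "lift_root p red (x * y) = lift_root p red x * lift_root p red y"
proof -
  let ?l = "lift_root p red"
  have "red (?l x * ?l y) = x * y"
    using assms lift_root p'_root_algebraic_int by (simp add: red_mult)
  then show ?thesis
    using lift_root_eq[OF p'_root_mult[OF lift_root(1) lift_root(1)]] assms by metis
qed

text \<open>There are exactly \<open>n\<close> of the \<open>n\<close>-th roots of unity, but at
  most \<open>r\<close> solutions of \<open>x ^ r = 1\<close>.\<close>

lemma ex_nontrivial_root:
  assumes "\<not> p dvd n" "0 < r" "r < n"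
  shows "\<exists>x :: 'k. x ^ n = 1 \<and> x ^ r \<noteq> 1"
proof (rule ccontr)
  assume "\<not> ?thesis"
  then have sub: "{x :: 'k. x ^ n = 1} \<subseteq> {x. x ^ r = 1}" by auto
  have "finite {x :: 'k. x ^ r = 1}" "card {x :: 'k. x ^ r = 1} \<le> r"
    using card_unity_roots[OF assms(2)] by blast+
  then have "n \<le> r" using card_mono[OF _ sub] red_image_roots(2)[OF assms(1)] by linarith
  then show False using assms by simp
qed

text \<open>Character orthogonality on the cyclic group of \<open>n\<close>-th roots of unity. If
  \<open>n\<close> does not divide \<open>m\<close>, scaling by a root \<open>y\<close> with
  \<open>y ^ m \<noteq> 1\<close> permutes the index set and multiplies the sum by
  \<open>y ^ m\<close>.\<close>

lemma sum_roots_of_unity_powi: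
  assumes "\<not> p dvd n"
  shows "(\<Sum>x | x ^ n = (1 :: 'k). x ^ m) = (if n dvd m then of_nat n else 0)"
proof (cases "n dvd m")
  case True
  then obtain k where "m = n * k" by auto
  then have "(\<Sum>x | x ^ n = (1 :: 'k). x ^ m) = (\<Sum>x | x ^ n = (1 :: 'k). 1)"
    by (intro sum.cong) (auto simp: power_mult)
  then show ?thesis using True red_image_roots(2)[OF assms] by simp
next
  case False
  let ?S = "\<Sum>x | x ^ n = (1 :: 'k). x ^ m"
  have n: "n > 0" using assms by (cases n) auto
  have "0 < m mod n" "m mod n < n" using False n by (auto simp: dvd_eq_mod_eq_0)
  from ex_nontrivial_root[OF assms this] obtain y :: 'k where y: "y ^ n = 1" "y ^ (m mod n) \<noteq> 1" by auto
  have ym: "y ^ m = y ^ (m mod n)" by (rule unity_root_power_mod[OF y(1)])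
  have y0: "y \<noteq> 0" using y n by (auto simp: power_0_left)
  have bij: "bij_betw (\<lambda>x. y * x) {x. x ^ n = 1} {x. x ^ n = (1 :: 'k)}"
    using y y0 by (intro bij_betw_byWitness[of _ "\<lambda>x. x / y"]) (auto simp: power_mult_distrib power_divide)
  have "?S = (\<Sum>x | x ^ n = (1 :: 'k). (y * x) ^ m)"
    by (rule sum.reindex_bij_betw[OF bij, symmetric])
  also have "\<dots> = y ^ m * ?S" by (simp add: power_mult_distrib sum_distrib_left)
  finally have "(y ^ m - 1) * ?S = 0" by (simp add: algebra_simps)
  then show ?thesis using False y ym by simp
qed

end

subsection \<open>Invariant subspaces and block matrices\<close>

text \<open>An elementary form of \<open>VectorSpace.subspace\<close> over
  \<open>module_vec\<close>, whose closure conditions can be checked directly. The next two lemmas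
  translate between the forms.\<close>

definition vec_subspace :: "nat \<Rightarrow> 'k :: field vec set \<Rightarrow> bool" where
  "vec_subspace n W \<longleftrightarrow> W \<subseteq> carrier_vec n \<and> 0\<^sub>v n \<in> W \<and>
     (\<forall>v\<in>W. \<forall>w\<in>W. v + w \<in> W) \<and> (\<forall>c. \<forall>v\<in>W. c \<cdot>\<^sub>v v \<in> W)"

lemma subspace_if_vec_subspace:
  fixes W :: "'k :: field vec set"
  assumes "vec_subspace n W"
  shows "VectorSpace.subspace class_ring W (module_vec TYPE('k) n)"
proof -
  interpret vec_space "TYPE('k)" n .
  have "submodule class_ring W (module_vec TYPE('k) n)"
    using assms vec_module by (intro submodule.intro)
      (auto simp: vec_subspace_def module_vec_def class_ring_simps)
  then show ?thesis by (rule VectorSpace.subspace.intro[OF vec_vs])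
qed

lemma vec_subspace_if_subspace:
  fixes W :: "'k :: field vec set"
  assumes "VectorSpace.subspace class_ring W (module_vec TYPE('k) n)"
  shows "vec_subspace n W"
  using assms unfolding VectorSpace.subspace_def submodule_def vec_subspace_def
  by (auto simp: module_vec_def class_ring_simps)

lemma injective_mat_inverse:
  fixes A :: "'k :: field mat"
  assumes A: "A \<in> carrier_mat n n"
    and inj: "\<And>v. v \<in> carrier_vec n \<Longrightarrow> A *\<^sub>v v = 0\<^sub>v n \<Longrightarrow> v = 0\<^sub>v n"
  obtains B where "B \<in> carrier_mat n n" "A * B = 1\<^sub>m n" "B * A = 1\<^sub>m n"
proof -
  have "det A \<noteq> 0" using det_0_iff_vec_prod_zero[OF A] inj by blast
  from det_non_zero_imp_unit[OF A this] show ?thesis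
    using that by (force simp: Units_def ring_mat_def)
qed

text \<open>This replaces the extension of a basis. Among the invertible matrices \<open>P\<close>
  whose first \<open>d\<close> columns lie in \<open>W\<close>, one with maximal \<open>d\<close> is
  taken. A vector of \<open>W\<close> outside the span of these columns could be exchanged in as a
  further column.\<close>

lemma subspace_coordinates:
  fixes W :: "'k :: field vec set"
  assumes W: "vec_subspace n W"
  obtains d P Q where "d \<le> n" "P \<in> carrier_mat n n" "Q \<in> carrier_mat n n"
    "P * Q = 1\<^sub>m n" "Q * P = 1\<^sub>m n"
    "W = {v \<in> carrier_vec n. \<forall>i. d \<le> i \<longrightarrow> i < n \<longrightarrow> (Q *\<^sub>v v) $ i = 0}"
proof -
  define good where "good d P Q \<longleftrightarrow> d \<le> n \<and> P \<in> carrier_mat n n \<and> Q \<in> carrier_mat n n \<and>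
      P * Q = 1\<^sub>m n \<and> Q * P = 1\<^sub>m n \<and>
      (\<forall>v\<in>carrier_vec n. (\<forall>i. d \<le> i \<longrightarrow> i < n \<longrightarrow> v $ i = 0) \<longrightarrow> P *\<^sub>v v \<in> W)" for d P and Q :: "'k mat"
  have "good 0 (1\<^sub>m n) (1\<^sub>m n)"
  proof -
    have "v = 0\<^sub>v n" if "v \<in> carrier_vec n" "\<forall>i. i < n \<longrightarrow> v $ i = 0" for v :: "'k vec"
      using that by (intro eq_vecI) auto
    then show ?thesis using W by (auto simp: good_def vec_subspace_def)
  qed
  then have ex: "\<exists>d. \<exists>P Q. good d P Q" by blast
  have bound: "\<forall>d. (\<exists>P Q. good d P Q) \<longrightarrow> d \<le> n" by (auto simp: good_def)
  define d where "d = (GREATEST d. \<exists>P Q. good d P Q)"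
  have "\<exists>P Q. good d P Q"
    unfolding d_def using GreatestI_ex_nat[OF ex] bound by blast
  then obtain P Q where PQ: "good d P Q" by blast
  have max: "d' \<le> d" if "good d' P' Q'" for d' P' Q'
    unfolding d_def using Greatest_le_nat[of "\<lambda>d. \<exists>P Q. good d P Q"] bound that by blast
  have P: "P \<in> carrier_mat n n" and Q: "Q \<in> carrier_mat n n" and PQ1: "P * Q = 1\<^sub>m n" and QP1: "Q * P = 1\<^sub>m n"
    and d: "d \<le> n" and sub: "\<And>v. v \<in> carrier_vec n \<Longrightarrow> (\<forall>i. d \<le> i \<longrightarrow> i < n \<longrightarrow> v $ i = 0) \<Longrightarrow> P *\<^sub>v v \<in> W"
    using PQ by (auto simp: good_def)
  have PQv: "P *\<^sub>v (Q *\<^sub>v v) = v" if "v \<in> carrier_vec n" for v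
    using that P Q PQ1 assoc_mult_mat_vec[OF P Q that] by simp
  have "(Q *\<^sub>v w) $ i = 0" if w: "w \<in> W" and i: "d \<le> i" "i < n" for w i
  proof (rule ccontr)
    assume nz: "(Q *\<^sub>v w) $ i \<noteq> 0"
    define u where "u = Q *\<^sub>v w"
    have wn: "w \<in> carrier_vec n" using w W by (auto simp: vec_subspace_def)
    have u: "u \<in> carrier_vec n" using Q wn by (simp add: u_def)
    have Pu: "P *\<^sub>v u = w" unfolding u_def using PQv[OF wn] .
    have ui: "u $ i \<noteq> 0" using nz by (simp add: u_def)
    \<comment> \<open>Column \<open>d\<close> of \<open>E\<close> is \<open>u\<close>. If
      \<open>i \<noteq> d\<close>, column \<open>i\<close> is the unit vector displaced from place
      \<open>d\<close>; the remaining columns are those of the identity. So column \<open>d\<close>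
      of \<open>P * E\<close> is \<open>w\<close>, its earlier columns are those of
      \<open>P\<close>, and invertibility comes from \<open>u $ i \<noteq> 0\<close>.\<close>
    define E where "E = mat n n (\<lambda>(r, c). if c = d then u $ r
        else if c = i then (if r = d then 1 else 0) else if r = c then 1 else (0 :: 'k))"
    have E: "E \<in> carrier_mat n n" by (simp add: E_def)
    have Ev: "(E *\<^sub>v v) $ r = u $ r * v $ d + (if r = d then (if i \<noteq> d then v $ i else 0) else if r = i then 0 else v $ r)"
      if v: "v \<in> carrier_vec n" and r: "r < n" for v r
    proof -
      have "(E *\<^sub>v v) $ r = (\<Sum>c = 0..<n. (if c = d then u $ r * v $ d else 0)
        + (if c = i then (if i \<noteq> d \<and> r = d then v $ i else 0) else 0)
        + (if c = r then (if r \<noteq> d \<and> r \<noteq> i then v $ r else 0) else 0))"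
      proof -
        have "(E *\<^sub>v v) $ r = (\<Sum>c = 0..<n. E $$ (r, c) * v $ c)"
          using r v E by (simp add: scalar_prod_def)
        also have "\<dots> = (\<Sum>c = 0..<n. (if c = d then u $ r * v $ d else 0)
          + (if c = i then (if i \<noteq> d \<and> r = d then v $ i else 0) else 0)
          + (if c = r then (if r \<noteq> d \<and> r \<noteq> i then v $ r else 0) else 0))"
          using r by (intro sum.cong) (auto simp: E_def)
        finally show ?thesis .
      qed
      also have "\<dots> = u $ r * v $ d + (if i \<noteq> d \<and> r = d then v $ i else 0)
        + (if r \<noteq> d \<and> r \<noteq> i then v $ r else 0)"
        using i r by (simp add: sum.distrib)
      finally show ?thesis by auto
    qed
    have Einj: "v = 0\<^sub>v n" if v: "v \<in> carrier_vec n" and 0: "E *\<^sub>v v = 0\<^sub>v n" for v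
    proof -
      have *: "u $ r * v $ d + (if r = d then (if i \<noteq> d then v $ i else 0) else if r = i then 0 else v $ r) = 0"
        if "r < n" for r using Ev[OF v that] 0 that by simp
      have vd: "v $ d = 0" using *[of i] i ui by (auto split: if_splits)
      have "v $ r = 0" if "r < n" for r
        using *[of r] *[of d] vd that i by (auto split: if_splits)
      then show ?thesis using v by (intro eq_vecI) auto
    qed
    obtain F where F: "F \<in> carrier_mat n n" "E * F = 1\<^sub>m n" "F * E = 1\<^sub>m n"
      using injective_mat_inverse[OF E Einj] by blast
    have "E * (F * Q) = Q" "Q * (P * E) = E"
      using P Q E F QP1 by (simp_all flip: assoc_mult_mat[of _ n n _ n _ n])
    then have inv1: "P * E * (F * Q) = 1\<^sub>m n" and inv2: "F * Q * (P * E) = 1\<^sub>m n"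
      using P Q E F PQ1 by (simp_all add: assoc_mult_mat[of _ n n _ n _ n])
    have "P * E *\<^sub>v v \<in> W" if v: "v \<in> carrier_vec n" "\<forall>j. Suc d \<le> j \<longrightarrow> j < n \<longrightarrow> v $ j = 0" for v
    proof -
      define v' where "v' = vec n (\<lambda>j. if j < d then v $ j else 0)"
      have v': "v' \<in> carrier_vec n" by (simp add: v'_def)
      have "E *\<^sub>v v = v' + v $ d \<cdot>\<^sub>v u"
      proof (rule eq_vecI)
        fix r assume "r < dim_vec (v' + v $ d \<cdot>\<^sub>v u)"
        then have r: "r < n" using u by simp
        show "(E *\<^sub>v v) $ r = (v' + v $ d \<cdot>\<^sub>v u) $ r"
          using Ev[OF v(1) r] v r u i by (auto simp: v'_def)
      qed (use E u in auto)
      then have "P * E *\<^sub>v v = P *\<^sub>v v' + v $ d \<cdot>\<^sub>v w"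
        using P E v v' u Pu by (simp add: assoc_mult_mat_vec[OF P E] mult_add_distrib_mat_vec[OF P] mult_mat_vec[OF P])
      moreover have "P *\<^sub>v v' \<in> W" by (intro sub v') (auto simp: v'_def)
      ultimately show ?thesis using w W by (auto simp: vec_subspace_def)
    qed
    then have "good (Suc d) (P * E) (F * Q)"
      using inv1 inv2 P Q E F i by (auto simp: good_def)
    then show False using max by fastforce
  qed
  moreover have "v \<in> W" if "v \<in> carrier_vec n" "\<forall>i. d \<le> i \<longrightarrow> i < n \<longrightarrow> (Q *\<^sub>v v) $ i = 0" for v
    using sub[of "Q *\<^sub>v v"] Q that PQv by auto
  ultimately have "W = {v \<in> carrier_vec n. \<forall>i. d \<le> i \<longrightarrow> i < n \<longrightarrow> (Q *\<^sub>v v) $ i = 0}"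
    using W by (auto simp: vec_subspace_def)
  then show ?thesis using that d P Q PQ1 QP1 by blast
qed

section \<open>Block triangular matrices, their characteristic polynomials and traces\<close>

definition upper_block :: "nat \<Rightarrow> nat \<Rightarrow> 'k :: zero mat \<Rightarrow> bool" where
  "upper_block n d M \<longleftrightarrow> M \<in> carrier_mat n n \<and> d \<le> n \<and> (\<forall>i j. d \<le> i \<longrightarrow> i < n \<longrightarrow> j < d \<longrightarrow> M $$ (i, j) = 0)"

definition ul_block :: "nat \<Rightarrow> 'k mat \<Rightarrow> 'k mat" where
  "ul_block d M = mat d d (\<lambda>(i, j). M $$ (i, j))"

definition lr_block :: "nat \<Rightarrow> nat \<Rightarrow> 'k mat \<Rightarrow> 'k mat" where
  "lr_block n d M = mat (n - d) (n - d) (\<lambda>(i, j). M $$ (i + d, j + d))"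

lemma block_carrier [simp]: "ul_block d M \<in> carrier_mat d d" "lr_block n d M \<in> carrier_mat (n - d) (n - d)"
  by (simp_all add: ul_block_def lr_block_def)

lemma upper_block_mult:
  fixes M N :: "'k :: comm_ring_1 mat"
  assumes M: "upper_block n d M" and N: "upper_block n d N"
  shows "ul_block d (M * N) = ul_block d M * ul_block d N"
    "lr_block n d (M * N) = lr_block n d M * lr_block n d N" "upper_block n d (M * N)"
proof -
  have d: "d \<le> n" and c: "M \<in> carrier_mat n n" "N \<in> carrier_mat n n" using M N by (auto simp: upper_block_def)
  have split: "{0..<n} = {0..<d} \<union> {d..<n}" "{0..<d} \<inter> {d..<n} = {}" using d by auto
  have prod: "(M * N) $$ (i, j) = (\<Sum>c = 0..<d. M $$ (i, c) * N $$ (c, j)) + (\<Sum>c = d..<n. M $$ (i, c) * N $$ (c, j))"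
    if "i < n" "j < n" for i j
  proof -
    have "(M * N) $$ (i, j) = (\<Sum>c = 0..<n. M $$ (i, c) * N $$ (c, j))"
      using c that by (simp add: scalar_prod_def)
    then show ?thesis unfolding split(1) by (simp add: sum.union_disjoint split(2))
  qed
  have zero1: "(\<Sum>c = d..<n. M $$ (i, c) * N $$ (c, j)) = 0" if "j < d" for i j
    using N that by (intro sum.neutral) (auto simp: upper_block_def)
  have zero2: "(\<Sum>c = 0..<d. M $$ (i, c) * N $$ (c, j)) = 0" if "d \<le> i" "i < n" for i j
    using M that by (intro sum.neutral) (auto simp: upper_block_def)
  show "ul_block d (M * N) = ul_block d M * ul_block d N"
  proof (rule eq_matI)
    fix i j assume "i < dim_row (ul_block d M * ul_block d N)" "j < dim_col (ul_block d M * ul_block d N)"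
    then have ij: "i < d" "j < d" by (simp_all add: ul_block_def)
    then show "ul_block d (M * N) $$ (i, j) = (ul_block d M * ul_block d N) $$ (i, j)"
      using d by (simp add: ul_block_def scalar_prod_def prod zero1 del: index_mult_mat(1))
        (simp add: scalar_prod_def)
  qed (auto simp: ul_block_def)
  show "lr_block n d (M * N) = lr_block n d M * lr_block n d N"
  proof (rule eq_matI)
    fix i j assume "i < dim_row (lr_block n d M * lr_block n d N)" "j < dim_col (lr_block n d M * lr_block n d N)"
    then have ij: "i < n - d" "j < n - d" by (simp_all add: lr_block_def)
    have "lr_block n d (M * N) $$ (i, j) = (M * N) $$ (i + d, j + d)"
      using ij by (simp add: lr_block_def)
    also have "\<dots> = (\<Sum>c = d..<n. M $$ (i + d, c) * N $$ (c, j + d))"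
      using ij by (subst prod) (auto simp: zero2)
    also have "\<dots> = (\<Sum>c = 0..<n - d. M $$ (i + d, c + d) * N $$ (c + d, j + d))"
      using d by (intro sum.reindex_bij_witness[of _ "\<lambda>c. c + d" "\<lambda>c. c - d"]) auto
    also have "\<dots> = (lr_block n d M * lr_block n d N) $$ (i, j)"
      using ij by (simp add: lr_block_def scalar_prod_def)
    finally show "lr_block n d (M * N) $$ (i, j) = (lr_block n d M * lr_block n d N) $$ (i, j)" .
  qed (auto simp: lr_block_def)
  show "upper_block n d (M * N)"
    unfolding upper_block_def using c d prod zero1 zero2 by auto
qed

lemma ul_block_one: "d \<le> n \<Longrightarrow> ul_block d (1\<^sub>m n) = 1\<^sub>m d"
  by (intro eq_matI) (auto simp: ul_block_def)

lemma lr_block_one: "lr_block n d (1\<^sub>m n) = 1\<^sub>m (n - d)"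
  by (intro eq_matI) (auto simp: lr_block_def)

lemma char_poly_upper_block:
  fixes M :: "'k :: idom mat"
  assumes M: "upper_block n d M"
  shows "char_poly M = char_poly (ul_block d M) * char_poly (lr_block n d M)"
proof -
  have d: "d \<le> n" and c: "M \<in> carrier_mat n n" using M by (auto simp: upper_block_def)
  let ?cm = "\<lambda>A :: 'k mat. [:0, 1:] \<cdot>\<^sub>m 1\<^sub>m (dim_row A) + map_mat (\<lambda>a. [:- a:]) A"
  let ?B = "mat d (n - d) (\<lambda>(i, j). [:- (M $$ (i, j + d)):])"
  have "?cm M = four_block_mat (?cm (ul_block d M)) ?B (0\<^sub>m (n - d) d) (?cm (lr_block n d M))"
    using M by (intro eq_matI) (auto simp: upper_block_def ul_block_def lr_block_def)
  then have "det (?cm M) = det (?cm (ul_block d M)) * det (?cm (lr_block n d M))"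
    using det_four_block_mat_lower_left_zero[of "?cm (ul_block d M)" d ?B "n - d" "0\<^sub>m (n - d) d" "?cm (lr_block n d M)"]
    by (simp add: ul_block_def lr_block_def)
  then show ?thesis by (simp add: char_poly_defs)
qed

definition mtrace :: "'k :: comm_ring_1 mat \<Rightarrow> 'k" where
  "mtrace M = (\<Sum>i<dim_row M. M $$ (i, i))"

lemma mtrace_mult_comm:
  fixes A B :: "'k :: comm_ring_1 mat"
  assumes A: "A \<in> carrier_mat n m" and B: "B \<in> carrier_mat m n"
  shows "mtrace (A * B) = mtrace (B * A)"
proof -
  have "mtrace (A * B) = (\<Sum>i<n. \<Sum>j<m. A $$ (i, j) * B $$ (j, i))"
    using A B by (auto simp: mtrace_def scalar_prod_def atLeast0LessThan intro!: sum.cong)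
  also have "\<dots> = (\<Sum>j<m. \<Sum>i<n. B $$ (j, i) * A $$ (i, j))"
    by (subst sum.swap) (simp add: mult.commute)
  also have "\<dots> = mtrace (B * A)"
    using A B by (auto simp: mtrace_def scalar_prod_def atLeast0LessThan intro!: sum.cong)
  finally show ?thesis .
qed

lemma mtrace_upper_block:
  fixes M :: "'k :: comm_ring_1 mat"
  assumes "upper_block n d M"
  shows "mtrace M = mtrace (ul_block d M) + mtrace (lr_block n d M)"
proof -
  have d: "d \<le> n" and c: "M \<in> carrier_mat n n" using assms by (auto simp: upper_block_def)
  have split: "{..<n} = {..<d} \<union> {d..<n}" "{..<d} \<inter> {d..<n} = {}" using d by auto
  have "mtrace M = (\<Sum>i<d. M $$ (i, i)) + (\<Sum>i = d..<n. M $$ (i, i))"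
    using c by (simp add: mtrace_def split(1) sum.union_disjoint split(2))
  also have "(\<Sum>i = d..<n. M $$ (i, i)) = (\<Sum>i<n - d. M $$ (i + d, i + d))"
    using d by (intro sum.reindex_bij_witness[of _ "\<lambda>c. c + d" "\<lambda>c. c - d"]) auto
  finally show ?thesis by (simp add: mtrace_def ul_block_def lr_block_def)
qed

text \<open>Column \<open>j\<close> of the conjugated matrix holds the coordinates of the image of
  \<open>P *\<^sub>v unit_vec n j\<close>, which stays in \<open>W\<close> for
  \<open>j < d\<close>.\<close>

lemma invariant_subspace_upper_block:
  fixes A :: "'k :: field mat"
  assumes "A \<in> carrier_mat n n" "P \<in> carrier_mat n n" "Q \<in> carrier_mat n n" "d \<le> n"
    "P * Q = 1\<^sub>m n" "Q * P = 1\<^sub>m n"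
    "W = {v \<in> carrier_vec n. \<forall>i. d \<le> i \<longrightarrow> i < n \<longrightarrow> (Q *\<^sub>v v) $ i = 0}"
    and inv: "\<And>w. w \<in> W \<Longrightarrow> A *\<^sub>v w \<in> W"
  shows "upper_block n d (Q * A * P)"
  unfolding upper_block_def
proof (intro conjI allI impI)
  show "Q * A * P \<in> carrier_mat n n" "d \<le> n" using assms by auto
  fix i j assume ij: "d \<le> i" "i < n" "j < d"
  let ?e = "unit_vec n j :: 'k vec"
  have QP: "Q *\<^sub>v (P *\<^sub>v ?e) = ?e"
    using assms by (simp flip: assoc_mult_mat_vec[of Q n n P n])
  have "P *\<^sub>v ?e \<in> W"
    unfolding assms(7)
  proof (intro CollectI conjI allI impI)
    show "P *\<^sub>v ?e \<in> carrier_vec n" using assms by auto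
    fix k assume "d \<le> k" "k < n"
    then show "(Q *\<^sub>v (P *\<^sub>v ?e)) $ k = 0" unfolding QP using ij by simp
  qed
  then have "A *\<^sub>v (P *\<^sub>v ?e) \<in> W" by (rule inv)
  then have 0: "(Q *\<^sub>v (A *\<^sub>v (P *\<^sub>v ?e))) $ i = 0" using assms ij by auto
  have "Q *\<^sub>v (A *\<^sub>v (P *\<^sub>v ?e)) = (Q * A * P) *\<^sub>v ?e"
    using assms by (simp add: assoc_mult_mat_vec[of _ n n _ n])
  also have "\<dots> $ i = (Q * A * P) $$ (i, j)"
    using assms ij by (simp add: scalar_prod_right_unit)
  finally show "(Q * A * P) $$ (i, j) = 0" using 0 by simp
qed

subsection \<open>Characteristic polynomials and composition factors\<close>

text \<open>With \<open>h\<close> the lift of roots, this is a Brauer character value read off from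
  the characteristic polynomial alone. Products of characteristic polynomials then become sums of
  Brauer characters.\<close>

definition root_sum :: "('k :: field \<Rightarrow> 'c :: semiring_1) \<Rightarrow> 'k poly \<Rightarrow> 'c" where
  "root_sum h f = (\<Sum>x | poly f x = 0. of_nat (Polynomial.order x f) * h x)"

lemma root_sum_superset:
  assumes "f \<noteq> 0" "finite S" "{x. poly f x = 0} \<subseteq> S"
  shows "root_sum h f = (\<Sum>x\<in>S. of_nat (Polynomial.order x f) * h x)"
  unfolding root_sum_def using assms
  by (intro sum.mono_neutral_left) (auto simp: order_root)

lemma root_sum_mult:
  assumes "f \<noteq> 0" "g \<noteq> 0"
  shows "root_sum h (f * g) = root_sum h f + root_sum h g"
proof -
  let ?S = "{x. poly (f * g) x = 0}"
  have fin: "finite ?S" using assms by (intro poly_roots_finite) auto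
  have "root_sum h (f * g) = (\<Sum>x\<in>?S. of_nat (Polynomial.order x f) * h x + of_nat (Polynomial.order x g) * h x)"
    unfolding root_sum_def using assms by (simp add: order_mult distrib_right)
  also have "\<dots> = root_sum h f + root_sum h g"
    using assms fin by (subst (1 2) root_sum_superset[of _ ?S]) (auto simp: sum.distrib)
  finally show ?thesis .
qed

lemma root_sum_1 [simp]: "root_sum h 1 = 0"
  by (simp add: root_sum_def)

lemma root_sum_linear: "root_sum h [:- a, 1:] = h a"
proof -
  have "{x. poly [:- a, 1:] x = 0} = {a}" by auto
  moreover have "Polynomial.order a [:- a, 1:] = 1"
    using order_power_n_n[of a 1] by simp
  ultimately show ?thesis by (simp add: root_sum_def)
qed

lemma root_sum_prod_list:
  "0 \<notin> set fs \<Longrightarrow> root_sum h (prod_list fs) = (\<Sum>f\<leftarrow>fs. root_sum h f)"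
  by (induction fs) (auto simp: root_sum_mult prod_list_zero_iff)

lemma root_sum_split:
  "root_sum h (\<Prod>a\<leftarrow>as. [:- a, 1:]) = (\<Sum>a\<leftarrow>as. h a)"
  by (subst root_sum_prod_list) (auto simp: root_sum_linear o_def)

lemma conj_pow_mat:
  fixes A :: "'k :: comm_ring_1 mat"
  assumes "A \<in> carrier_mat n n" "P \<in> carrier_mat n n" "Q \<in> carrier_mat n n" "P * Q = 1\<^sub>m n" "Q * P = 1\<^sub>m n"
  shows "(Q * A * P) ^\<^sub>m k = Q * A ^\<^sub>m k * P"
proof (induction k)
  case 0
  then show ?case using assms by simp
next
  case (Suc k)
  have "P * (Q * (A * P)) = A * P"
    using assms by (simp flip: assoc_mult_mat[of P n n Q n _ n])
  then have "(Q * B * P) * (Q * A * P) = Q * (B * A) * P" if "B \<in> carrier_mat n n" for B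
    using assms that by (simp add: assoc_mult_mat[of _ n n _ n _ n])
  from this[of "A ^\<^sub>m k"] show ?case using Suc assms by simp
qed

lemma mtrace_conj:
  fixes A :: "'k :: comm_ring_1 mat"
  assumes "A \<in> carrier_mat n n" "P \<in> carrier_mat n n" "Q \<in> carrier_mat n n" "P * Q = 1\<^sub>m n"
  shows "mtrace (Q * A * P) = mtrace A"
proof -
  have "mtrace (Q * A * P) = mtrace (P * (Q * A))"
    using assms by (intro mtrace_mult_comm) auto
  also have "P * (Q * A) = A" using assms by (simp flip: assoc_mult_mat[of P n n Q n A n])
  finally show ?thesis .
qed

lemma char_poly_conj:
  fixes A :: "'k :: comm_ring_1 mat"
  assumes "A \<in> carrier_mat n n" "P \<in> carrier_mat n n" "Q \<in> carrier_mat n n" "P * Q = 1\<^sub>m n" "Q * P = 1\<^sub>m n"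
  shows "char_poly (Q * A * P) = char_poly A"
proof (rule char_poly_similar)
  have "similar_mat_wit (Q * A * P) A Q P"
    using assms by (intro similar_mat_witI[of _ _ n]) auto
  then show "similar_mat (Q * A * P) A" by (auto simp: similar_mat_def)
qed

lemma upper_block_pow:
  fixes M :: "'k :: comm_ring_1 mat"
  assumes "upper_block n d M"
  shows "upper_block n d (M ^\<^sub>m k) \<and> ul_block d (M ^\<^sub>m k) = ul_block d M ^\<^sub>m k \<and>
    lr_block n d (M ^\<^sub>m k) = lr_block n d M ^\<^sub>m k"
proof (induction k)
  case 0
  then show ?case using assms
    by (auto simp: upper_block_def ul_block_one lr_block_one ul_block_def[of d M] lr_block_def[of n d M])
next
  case (Suc k)
  then show ?case using upper_block_mult[OF _ assms] by simp
qed

lemma char_poly_0_dim: "A \<in> carrier_mat 0 0 \<Longrightarrow> char_poly A = 1"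
  using degree_monic_char_poly[of A 0] by (metis degree_eq_zeroE coeff_pCons_0 one_pCons)

lemma char_poly_nonzero: "(A :: 'k :: field mat) \<in> carrier_mat n n \<Longrightarrow> char_poly A \<noteq> 0"
  using degree_monic_char_poly[of A n] by auto

text \<open>One list has to serve both conclusions: its entries are the roots with multiplicity, and
  their powers give the traces of the powers of \<open>A\<close>, as the Frobenius argument
  requires. Splitting off an eigenline provides the induction.\<close>

lemma char_poly_splits:
  fixes A :: "'k :: field mat"
  assumes closed: "\<And>f :: 'k poly. degree f > 0 \<Longrightarrow> \<exists>x. poly f x = 0"
    and A: "A \<in> carrier_mat n n"
  shows "\<exists>as. char_poly A = (\<Prod>a\<leftarrow>as. [:- a, 1:]) \<and> (\<forall>k. mtrace (A ^\<^sub>m k) = (\<Sum>a\<leftarrow>as. a ^ k))"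
  using A
proof (induction n arbitrary: A)
  case 0
  then show ?case by (intro exI[of _ "[]"]) (auto simp: char_poly_0_dim mtrace_def)
next
  case (Suc n)
  let ?n = "Suc n"
  note A = Suc.prems
  obtain l where "poly (char_poly A) l = 0"
    using closed[of "char_poly A"] degree_monic_char_poly[OF A] by auto
  then have "eigenvalue A l" using eigenvalue_root_char_poly[OF A] by simp
  then obtain v where v: "v \<in> carrier_vec ?n" "v \<noteq> 0\<^sub>v ?n" "A *\<^sub>v v = l \<cdot>\<^sub>v v"
    using A by (auto simp: eigenvalue_def eigenvector_def)
  define W where "W = {c \<cdot>\<^sub>v v | c. True}"
  have "0\<^sub>v ?n = 0 \<cdot>\<^sub>v v" using v by auto
  moreover have "c \<cdot>\<^sub>v v + d \<cdot>\<^sub>v v = (c + d) \<cdot>\<^sub>v v" for c d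
    using v by (simp add: add_smult_distrib_vec)
  moreover have "c \<cdot>\<^sub>v (d \<cdot>\<^sub>v v) = (c * d) \<cdot>\<^sub>v v" for c d
    using v by (simp add: smult_smult_assoc)
  ultimately have "vec_subspace ?n W"
    unfolding vec_subspace_def W_def using v(1) by auto
  then obtain d P Q where d: "d \<le> ?n" and P: "P \<in> carrier_mat ?n ?n" and Q: "Q \<in> carrier_mat ?n ?n"
    and inv: "P * Q = 1\<^sub>m ?n" "Q * P = 1\<^sub>m ?n"
    and W: "W = {v \<in> carrier_vec ?n. \<forall>i. d \<le> i \<longrightarrow> i < ?n \<longrightarrow> (Q *\<^sub>v v) $ i = 0}"
    by (rule subspace_coordinates)
  have "d \<noteq> 0"
  proof
    assume "d = 0"
    moreover have "1 \<cdot>\<^sub>v v \<in> W" unfolding W_def by blast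
    ultimately have "Q *\<^sub>v v = 0\<^sub>v ?n" using W v Q by (intro eq_vecI) auto
    then have "P *\<^sub>v (Q *\<^sub>v v) = 0\<^sub>v ?n" using P by auto
    then show False using P Q v inv by (simp flip: assoc_mult_mat_vec)
  qed
  \<comment> \<open>As \<open>d\<close> is positive, the first vector of the new basis lies in
    \<open>W\<close> and is a multiple of the eigenvector. Hence column \<open>0\<close> of
    \<open>B\<close> is \<open>l\<close> times a unit vector.\<close>
  let ?e = "unit_vec ?n 0 :: 'k vec"
  have QPe: "Q *\<^sub>v (P *\<^sub>v ?e) = ?e"
    using P Q inv by (simp flip: assoc_mult_mat_vec[of Q ?n ?n P ?n])
  have "P *\<^sub>v ?e \<in> W"
    unfolding W
  proof (intro CollectI conjI allI impI)
    show "P *\<^sub>v ?e \<in> carrier_vec ?n" using P by auto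
    fix k assume "d \<le> k" "k < ?n"
    then show "(Q *\<^sub>v (P *\<^sub>v ?e)) $ k = 0" unfolding QPe using \<open>d \<noteq> 0\<close> by simp
  qed
  then obtain c where c: "P *\<^sub>v ?e = c \<cdot>\<^sub>v v" by (auto simp: W_def)
  define B where "B = Q * A * P"
  have B: "B \<in> carrier_mat ?n ?n" using A P Q by (simp add: B_def)
  have "B *\<^sub>v ?e = Q *\<^sub>v (A *\<^sub>v (P *\<^sub>v ?e))"
    unfolding B_def using P Q A by (simp add: assoc_mult_mat_vec[of _ ?n ?n _ ?n])
  also have "A *\<^sub>v (P *\<^sub>v ?e) = l \<cdot>\<^sub>v (P *\<^sub>v ?e)"
    unfolding c using A v by (simp add: mult_mat_vec[OF A] smult_smult_assoc mult.commute)
  also have "Q *\<^sub>v (l \<cdot>\<^sub>v (P *\<^sub>v ?e)) = l \<cdot>\<^sub>v ?e"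
    using P Q QPe by (simp add: mult_mat_vec[of Q ?n ?n])
  finally have Be: "B *\<^sub>v ?e = l \<cdot>\<^sub>v ?e" .
  have Bi: "B $$ (i, 0) = (if i = 0 then l else 0)" if "i < ?n" for i
  proof -
    have "(B *\<^sub>v ?e) $ i = B $$ (i, 0)" using B that by (simp add: scalar_prod_right_unit)
    then show ?thesis unfolding Be using that by (cases "i = 0") auto
  qed
  have blk: "upper_block ?n 1 B" using B Bi by (auto simp: upper_block_def)
  have lr: "lr_block ?n 1 B \<in> carrier_mat n n" using block_carrier(2)[of ?n 1 B] by simp
  from Suc.IH[OF this] obtain as where as: "char_poly (lr_block ?n 1 B) = (\<Prod>a\<leftarrow>as. [:- a, 1:])"
    "\<And>k. mtrace (lr_block ?n 1 B ^\<^sub>m k) = (\<Sum>a\<leftarrow>as. a ^ k)" by blast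
  have ul: "char_poly (ul_block 1 B) = [:- l, 1:]"
    using char_poly_upper_triangular[of "ul_block 1 B" 1] Bi
    by (auto simp: ul_block_def diag_mat_def upper_triangular_def)
  have ulk: "(ul_block 1 B ^\<^sub>m k) $$ (0, 0) = l ^ k" for k
  proof (induction k)
    case 0
    then show ?case by (simp add: ul_block_def)
  next
    case (Suc k)
    have "(X * ul_block 1 B) $$ (0, 0) = X $$ (0, 0) * l" if "X \<in> carrier_mat 1 1" for X
      using that Bi by (simp add: scalar_prod_def ul_block_def)
    from this[of "ul_block 1 B ^\<^sub>m k"] show ?case
      using Suc by (simp add: mult.commute del: index_mult_mat)
  qed
  show ?case
  proof (intro exI conjI allI)
    have "char_poly A = char_poly B" unfolding B_def by (rule char_poly_conj[OF A P Q inv, symmetric])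
    then show "char_poly A = (\<Prod>a\<leftarrow>l # as. [:- a, 1:])"
      using char_poly_upper_block[OF blk] as ul by simp
    fix k
    have Ak: "A ^\<^sub>m k \<in> carrier_mat ?n ?n" using A by simp
    have "mtrace (A ^\<^sub>m k) = mtrace (Q * A ^\<^sub>m k * P)" using mtrace_conj[OF Ak P Q inv(1)] by simp
    also have "\<dots> = mtrace (B ^\<^sub>m k)"
      unfolding B_def using conj_pow_mat[OF A P Q inv] by simp
    also have "\<dots> = mtrace (ul_block 1 B ^\<^sub>m k) + mtrace (lr_block ?n 1 B ^\<^sub>m k)"
      using mtrace_upper_block[of ?n 1 "B ^\<^sub>m k"] upper_block_pow[OF blk, of k] by simp
    also have "mtrace (ul_block 1 B ^\<^sub>m k) = l ^ k"
      using ulk[of k] by (simp add: mtrace_def ul_block_def)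
    finally show "mtrace (A ^\<^sub>m k) = (\<Sum>a\<leftarrow>l # as. a ^ k)" using as by simp
  qed
qed

section \<open>Composition factors and direct sums of matrix representations\<close>

lemma irreducible_rep_iff:
  fixes \<rho> :: "'a \<Rightarrow> 'k :: field mat"
  shows "irreducible_rep G n \<rho> \<longleftrightarrow> matrix_rep G n \<rho> \<and> 0 < n \<and>
     (\<forall>W. vec_subspace n W \<longrightarrow> (\<forall>g\<in>carrier G. \<forall>w\<in>W. \<rho> g *\<^sub>v w \<in> W) \<longrightarrow>
          W = {0\<^sub>v n} \<or> W = carrier_vec n)"
  unfolding irreducible_rep_def using subspace_if_vec_subspace vec_subspace_if_subspace by blast

lemma matrix_rep_conj:
  fixes \<rho> :: "'a \<Rightarrow> 'k :: field mat"
  assumes \<rho>: "matrix_rep G n \<rho>"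
    and PQ: "P \<in> carrier_mat n n" "Q \<in> carrier_mat n n" "P * Q = 1\<^sub>m n" "Q * P = 1\<^sub>m n"
  shows "matrix_rep G n (\<lambda>g. Q * \<rho> g * P)"
  unfolding matrix_rep_def
proof (intro conjI ballI)
  fix g h assume "g \<in> carrier G" "h \<in> carrier G"
  then have c: "\<rho> g \<in> carrier_mat n n" "\<rho> h \<in> carrier_mat n n" and m: "\<rho> (g \<otimes>\<^bsub>G\<^esub> h) = \<rho> g * \<rho> h"
    using \<rho> by (auto simp: matrix_rep_def)
  have "P * (Q * (\<rho> h * P)) = \<rho> h * P"
    using PQ c by (simp flip: assoc_mult_mat[of P n n Q n _ n])
  then show "Q * \<rho> (g \<otimes>\<^bsub>G\<^esub> h) * P = Q * \<rho> g * P * (Q * \<rho> h * P)"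
    unfolding m using PQ c by (simp add: assoc_mult_mat[of _ n n _ n _ n])
qed (use assms in \<open>auto simp: matrix_rep_def\<close>)

lemma matrix_rep_blocks:
  fixes \<rho> :: "'a \<Rightarrow> 'k :: field mat"
  assumes \<rho>: "matrix_rep G n \<rho>" and d: "d \<le> n" and blk: "\<And>g. g \<in> carrier G \<Longrightarrow> upper_block n d (\<rho> g)"
  shows "matrix_rep G d (\<lambda>g. ul_block d (\<rho> g))" "matrix_rep G (n - d) (\<lambda>g. lr_block n d (\<rho> g))"
  using assms upper_block_mult[OF blk blk]
  by (auto simp: matrix_rep_def ul_block_one lr_block_one)

text \<open>A composition series, reduced to what Brauer characters can see. A proper nonzero
  invariant subspace puts all matrices into block triangular form at once, and both diagonal blocks
  are representations of smaller degree. A list keeps repeated factors.\<close>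

lemma matrix_rep_irreducible_factors:
  fixes \<rho> :: "'a \<Rightarrow> 'k :: field mat"
  assumes "matrix_rep G n \<rho>"
  shows "\<exists>L. (\<forall>(m, \<sigma>)\<in>set L. irreducible_rep G m \<sigma>) \<and>
    (\<forall>g\<in>carrier G. char_poly (\<rho> g) = (\<Prod>(m, \<sigma>)\<leftarrow>L. char_poly (\<sigma> g)))"
  using assms
proof (induction n arbitrary: \<rho> rule: less_induct)
  case (less n)
  consider "n = 0" | "irreducible_rep G n \<rho>" | "n > 0" "\<not> irreducible_rep G n \<rho>" by auto
  then show ?case
  proof cases
    case 1
    then show ?thesis using less.prems
      by (intro exI[of _ "[]"]) (auto simp: matrix_rep_def char_poly_0_dim)
  next
    case 2
    then show ?thesis by (intro exI[of _ "[(n, \<rho>)]"]) auto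
  next
    case 3
    then obtain W where W: "vec_subspace n W" "\<And>g w. g \<in> carrier G \<Longrightarrow> w \<in> W \<Longrightarrow> \<rho> g *\<^sub>v w \<in> W"
      "W \<noteq> {0\<^sub>v n}" "W \<noteq> carrier_vec n"
      using less.prems by (auto simp: irreducible_rep_iff)
    obtain d P Q where d: "d \<le> n" and P: "P \<in> carrier_mat n n" and Q: "Q \<in> carrier_mat n n"
      and inv: "P * Q = 1\<^sub>m n" "Q * P = 1\<^sub>m n"
      and Weq: "W = {v \<in> carrier_vec n. \<forall>i. d \<le> i \<longrightarrow> i < n \<longrightarrow> (Q *\<^sub>v v) $ i = 0}"
      using subspace_coordinates[OF W(1)] by blast
    have "d \<noteq> n" using W(4) Weq by auto
    have "d \<noteq> 0"
    proof
      assume "d = 0"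
      have "v = 0\<^sub>v n" if "v \<in> W" for v
      proof -
        have v: "v \<in> carrier_vec n" using that Weq by auto
        have "Q *\<^sub>v v = 0\<^sub>v n" using that v Q \<open>d = 0\<close> by (intro eq_vecI) (auto simp: Weq)
        then have "P *\<^sub>v (Q *\<^sub>v v) = 0\<^sub>v n" using P by auto
        then show ?thesis using P Q v inv by (simp flip: assoc_mult_mat_vec)
      qed
      then show False using W(1,3) by (auto simp: vec_subspace_def)
    qed
    let ?\<rho> = "\<lambda>g. Q * \<rho> g * P"
    have \<rho>c: "\<rho> g \<in> carrier_mat n n" if "g \<in> carrier G" for g
      using less.prems that by (auto simp: matrix_rep_def)
    have blk: "upper_block n d (?\<rho> g)" if "g \<in> carrier G" for g
      using invariant_subspace_upper_block[OF \<rho>c[OF that] P Q d inv Weq] W(2) that by blast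
    note reps = matrix_rep_blocks[OF matrix_rep_conj[OF less.prems P Q inv] d blk]
    obtain L1 where L1: "\<forall>(m, \<sigma>)\<in>set L1. irreducible_rep G m \<sigma>"
      "\<forall>g\<in>carrier G. char_poly (ul_block d (?\<rho> g)) = (\<Prod>(m, \<sigma>)\<leftarrow>L1. char_poly (\<sigma> g))"
      using less.IH[OF _ reps(1)] d \<open>d \<noteq> n\<close> by auto
    obtain L2 where L2: "\<forall>(m, \<sigma>)\<in>set L2. irreducible_rep G m \<sigma>"
      "\<forall>g\<in>carrier G. char_poly (lr_block n d (?\<rho> g)) = (\<Prod>(m, \<sigma>)\<leftarrow>L2. char_poly (\<sigma> g))"
      using less.IH[OF _ reps(2)] d \<open>d \<noteq> 0\<close> by auto
    show ?thesis
    proof (intro exI[of _ "L1 @ L2"] conjI ballI)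
      fix g assume g: "g \<in> carrier G"
      have "char_poly (\<rho> g) = char_poly (?\<rho> g)" using char_poly_conj[OF \<rho>c[OF g] P Q inv] by simp
      then show "char_poly (\<rho> g) = (\<Prod>(m, \<sigma>)\<leftarrow>L1 @ L2. char_poly (\<sigma> g))"
        using char_poly_upper_block[OF blk[OF g]] L1 L2 g by simp
    qed (use L1 L2 in auto)
  qed
qed

lemma matrix_rep_direct_sum:
  fixes \<rho> \<sigma> :: "'a \<Rightarrow> 'k :: field mat"
  assumes \<rho>: "matrix_rep G n \<rho>" and \<sigma>: "matrix_rep G m \<sigma>"
  shows "\<exists>\<tau>. matrix_rep G (n + m) \<tau> \<and> (\<forall>g\<in>carrier G. char_poly (\<tau> g) = char_poly (\<rho> g) * char_poly (\<sigma> g))"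
proof (intro exI conjI ballI)
  let ?\<tau> = "\<lambda>g. four_block_mat (\<rho> g) (0\<^sub>m n m) (0\<^sub>m m n) (\<sigma> g)"
  show "matrix_rep G (n + m) ?\<tau>"
    unfolding matrix_rep_def
  proof (intro conjI ballI)
    fix g h assume "g \<in> carrier G" "h \<in> carrier G"
    then have "\<rho> g \<in> carrier_mat n n" "\<rho> h \<in> carrier_mat n n" "\<sigma> g \<in> carrier_mat m m" "\<sigma> h \<in> carrier_mat m m"
      "\<rho> (g \<otimes>\<^bsub>G\<^esub> h) = \<rho> g * \<rho> h" "\<sigma> (g \<otimes>\<^bsub>G\<^esub> h) = \<sigma> g * \<sigma> h"
      using assms by (auto simp: matrix_rep_def)
    then show "?\<tau> (g \<otimes>\<^bsub>G\<^esub> h) = ?\<tau> g * ?\<tau> h"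
      by (subst mult_four_block_mat[of _ n n _ m _ m _ _ n _ m]) auto
  qed (use assms in \<open>auto simp: matrix_rep_def\<close>)
  fix g assume g: "g \<in> carrier G"
  then have c: "\<rho> g \<in> carrier_mat n n" "\<sigma> g \<in> carrier_mat m m" using assms by (auto simp: matrix_rep_def)
  have blk: "upper_block (n + m) n (?\<tau> g)" using c by (auto simp: upper_block_def)
  have "ul_block n (?\<tau> g) = \<rho> g" using c by (intro eq_matI) (auto simp: ul_block_def)
  moreover have "lr_block (n + m) n (?\<tau> g) = \<sigma> g" using c by (intro eq_matI) (auto simp: lr_block_def)
  ultimately show "char_poly (?\<tau> g) = char_poly (\<rho> g) * char_poly (\<sigma> g)"
    using char_poly_upper_block[OF blk] by simp
qed

subsection \<open>Schur's lemma and independence of irreducible traces\<close>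

text \<open>Linear maps are functions on vectors here and not matrices, because those needed below
  arise by choosing preimages. \<open>linear_on_mat\<close> recovers a matrix afterwards.\<close>

definition linear_on :: "nat \<Rightarrow> nat \<Rightarrow> ('k :: field vec \<Rightarrow> 'k vec) \<Rightarrow> bool" where
  "linear_on n m f \<longleftrightarrow> (\<forall>v\<in>carrier_vec n. f v \<in> carrier_vec m) \<and>
     (\<forall>v\<in>carrier_vec n. \<forall>w\<in>carrier_vec n. f (v + w) = f v + f w) \<and>
     (\<forall>c. \<forall>v\<in>carrier_vec n. f (c \<cdot>\<^sub>v v) = c \<cdot>\<^sub>v f v)"

lemma linear_on_zero: "linear_on n m f \<Longrightarrow> f (0\<^sub>v n) = 0\<^sub>v m"
proof -
  assume f: "linear_on n m f"
  have "f (0 \<cdot>\<^sub>v 0\<^sub>v n) = 0 \<cdot>\<^sub>v f (0\<^sub>v n)" using f by (auto simp: linear_on_def)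
  moreover have "0 \<cdot>\<^sub>v 0\<^sub>v n = (0\<^sub>v n :: 'a vec)" by auto
  moreover have "f (0\<^sub>v n) \<in> carrier_vec m" using f by (auto simp: linear_on_def)
  then have "0 \<cdot>\<^sub>v f (0\<^sub>v n) = 0\<^sub>v m" by auto
  ultimately show ?thesis by metis
qed

lemma mat_vec_unit:
  fixes A :: "'k :: semiring_1 mat"
  shows "A \<in> carrier_mat r n \<Longrightarrow> j < n \<Longrightarrow> A *\<^sub>v unit_vec n j = col A j"
  by (intro eq_vecI) (auto simp: scalar_prod_right_unit)

lemma linear_on_mat:
  assumes f: "linear_on n m f"
  obtains F where "F \<in> carrier_mat m n" "\<And>v. v \<in> carrier_vec n \<Longrightarrow> f v = F *\<^sub>v v"
proof -
  define F where "F = mat m n (\<lambda>(i, j). f (unit_vec n j) $ i)"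
  have F: "F \<in> carrier_mat m n" by (simp add: F_def)
  have fc: "f v \<in> carrier_vec m" if "v \<in> carrier_vec n" for v using f that by (auto simp: linear_on_def)
  have Fe: "F *\<^sub>v unit_vec n j = f (unit_vec n j)" if "j < n" for j
    using fc[of "unit_vec n j"] that by (subst mat_vec_unit[OF F that]) (auto simp: F_def)
  \<comment> \<open>Induction on the length \<open>k\<close> of an initial segment that supports
    \<open>v\<close>, peeling off its last coordinate.\<close>
  have "f v = F *\<^sub>v v" if "k \<le> n" "v \<in> carrier_vec n" "\<forall>i. k \<le> i \<longrightarrow> i < n \<longrightarrow> v $ i = 0" for k v
    using that
  proof (induction k arbitrary: v)
    case 0
    then have "v = 0\<^sub>v n" by (intro eq_vecI) auto
    then show ?case using linear_on_zero[OF f] F by auto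
  next
    case (Suc k)
    define w where "w = vec n (\<lambda>i. if i < k then v $ i else 0)"
    have w: "w \<in> carrier_vec n" "\<forall>i. k \<le> i \<longrightarrow> i < n \<longrightarrow> w $ i = 0" by (auto simp: w_def)
    have kn: "k < n" using Suc.prems by simp
    have v: "v = w + v $ k \<cdot>\<^sub>v unit_vec n k"
    proof (rule eq_vecI)
      fix i assume "i < dim_vec (w + v $ k \<cdot>\<^sub>v unit_vec n k)"
      then have "i < n" by simp
      then show "v $ i = (w + v $ k \<cdot>\<^sub>v unit_vec n k) $ i"
        using Suc.prems kn by (cases i k rule: linorder_cases) (auto simp: w_def)
    qed (use Suc.prems in auto)
    have "f v = f w + v $ k \<cdot>\<^sub>v f (unit_vec n k)"
      using f w by (subst v) (auto simp: linear_on_def)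
    also have "f w = F *\<^sub>v w" using Suc.IH w kn by simp
    also have "f (unit_vec n k) = F *\<^sub>v unit_vec n k" using Fe kn by simp
    also have "F *\<^sub>v w + v $ k \<cdot>\<^sub>v (F *\<^sub>v unit_vec n k) = F *\<^sub>v (w + v $ k \<cdot>\<^sub>v unit_vec n k)"
      using F w by (simp add: mult_add_distrib_mat_vec[OF F] mult_mat_vec[OF F])
    finally show ?case using v by simp
  qed
  from this[of n] that[OF F] show ?thesis by auto
qed

lemma mat_eqI_vec:
  fixes A B :: "'k :: semiring_1 mat"
  assumes "A \<in> carrier_mat r n" "B \<in> carrier_mat r n"
    "\<And>v. v \<in> carrier_vec n \<Longrightarrow> A *\<^sub>v v = B *\<^sub>v v"
  shows "A = B"
proof (rule mat_col_eqI)
  fix i assume "i < dim_col B"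
  then have "i < n" using assms by simp
  then show "col A i = col B i"
    using assms(3)[of "unit_vec n i"] mat_vec_unit[OF assms(1)] mat_vec_unit[OF assms(2)] by simp
qed (use assms in auto)

text \<open>Padding to square matrices with zero rows and columns turns a one-sided inverse into a
  two-sided one.\<close>

lemma left_inverse_dim_le:
  fixes F H :: "'k :: field mat"
  assumes F: "F \<in> carrier_mat m n" and H: "H \<in> carrier_mat n m" and HF: "H * F = 1\<^sub>m n"
  shows "n \<le> m"
proof (rule ccontr)
  assume "\<not> n \<le> m"
  then have mn: "m < n" by simp
  define F' where "F' = mat n n (\<lambda>(i, j). if i < m then F $$ (i, j) else 0)"
  define H' where "H' = mat n n (\<lambda>(i, j). if j < m then H $$ (i, j) else 0)"
  have c: "F' \<in> carrier_mat n n" "H' \<in> carrier_mat n n" by (auto simp: F'_def H'_def)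
  have split: "{0..<n} = {0..<m} \<union> {m..<n}" "{0..<m} \<inter> {m..<n} = {}" using mn by auto
  have "H' * F' = H * F"
  proof (rule eq_matI)
    fix i j assume "i < dim_row (H * F)" "j < dim_col (H * F)"
    then have ij: "i < n" "j < n" using F H by auto
    have "(H' * F') $$ (i, j) = (\<Sum>c = 0..<n. H' $$ (i, c) * F' $$ (c, j))"
      using c ij by (simp add: scalar_prod_def)
    also have "\<dots> = (\<Sum>c = 0..<m. H $$ (i, c) * F $$ (c, j))"
      unfolding split(1) using ij mn by (subst sum.union_disjoint) (auto simp: F'_def H'_def)
    also have "\<dots> = (H * F) $$ (i, j)" using F H ij by (simp add: scalar_prod_def)
    finally show "(H' * F') $$ (i, j) = (H * F) $$ (i, j)" .
  qed (use c F H in auto)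
  then have "F' * H' = 1\<^sub>m n" using mat_mult_left_right_inverse[OF c(2,1)] HF by simp
  \<comment> \<open>Row \<open>m\<close> of the padded matrix \<open>F'\<close> is zero, which
    contradicts a diagonal entry \<open>1\<close> of the product.\<close>
  then have "(F' * H') $$ (m, m) = 1" using mn by simp
  moreover have "(F' * H') $$ (m, m) = 0" using c mn by (simp add: scalar_prod_def) (simp add: F'_def)
  ultimately show False by simp
qed

section \<open>Intertwiners and the two forms of Schur's lemma\<close>

definition intertwiner :: "('a, 'b) monoid_scheme \<Rightarrow> nat \<Rightarrow> ('a \<Rightarrow> 'k :: field mat) \<Rightarrow>
    nat \<Rightarrow> ('a \<Rightarrow> 'k mat) \<Rightarrow> ('k vec \<Rightarrow> 'k vec) \<Rightarrow> bool" where
  "intertwiner G n \<rho> m \<sigma> f \<longleftrightarrow> linear_on n m f \<and>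
     (\<forall>g\<in>carrier G. \<forall>v\<in>carrier_vec n. f (\<rho> g *\<^sub>v v) = \<sigma> g *\<^sub>v f v)"

text \<open>Kernel and image are invariant, so a nonzero intertwiner is bijective and conjugates one
  representation into the other. Only the characteristic polynomials are recorded, since Brauer
  characters depend on nothing else.\<close>

lemma schur_iso:
  fixes \<rho> \<sigma> :: "'a \<Rightarrow> 'k :: field mat"
  assumes \<rho>: "irreducible_rep G n \<rho>" and \<sigma>: "irreducible_rep G m \<sigma>"
    and f: "intertwiner G n \<rho> m \<sigma> f"
    and nz: "v0 \<in> carrier_vec n" "f v0 \<noteq> 0\<^sub>v m"
  shows "\<forall>g\<in>carrier G. char_poly (\<rho> g) = char_poly (\<sigma> g)"
proof
  fix g assume g: "g \<in> carrier G"
  have lin: "linear_on n m f" using f by (simp add: intertwiner_def)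
  have eqv: "f (\<rho> g *\<^sub>v v) = \<sigma> g *\<^sub>v f v" if "g \<in> carrier G" "v \<in> carrier_vec n" for g v
    using f that by (simp add: intertwiner_def)
  have \<rho>c: "\<rho> g \<in> carrier_mat n n" and \<sigma>c: "\<sigma> g \<in> carrier_mat m m" if "g \<in> carrier G" for g
    using \<rho> \<sigma> that by (auto simp: irreducible_rep_def matrix_rep_def)
  have add: "f (v + w) = f v + f w" if "v \<in> carrier_vec n" "w \<in> carrier_vec n" for v w
    using lin that by (auto simp: linear_on_def)
  have smult: "f (c \<cdot>\<^sub>v v) = c \<cdot>\<^sub>v f v" and fc: "f v \<in> carrier_vec m" if "v \<in> carrier_vec n" for v c
    using lin that by (auto simp: linear_on_def)
  have \<sigma>0: "\<sigma> g *\<^sub>v 0\<^sub>v m = 0\<^sub>v m" if "g \<in> carrier G" for g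
    using \<sigma>c[OF that] by auto
  let ?K = "{v \<in> carrier_vec n. f v = 0\<^sub>v m}"
  have "vec_subspace n ?K"
    using linear_on_zero[OF lin] by (auto simp: vec_subspace_def add smult)
  moreover have "\<rho> g *\<^sub>v v \<in> ?K" if "g \<in> carrier G" "v \<in> ?K" for g v
    using that \<sigma>0 eqv mult_mat_vec_carrier[OF \<rho>c] by auto
  ultimately have ker: "?K = {0\<^sub>v n}"
    using \<rho> nz unfolding irreducible_rep_iff by blast
  have inj: "v = w" if "v \<in> carrier_vec n" "w \<in> carrier_vec n" "f v = f w" for v w
  proof -
    have "f (v + (-1) \<cdot>\<^sub>v w) = f v + (-1) \<cdot>\<^sub>v f w"
      using that add[of v "(-1) \<cdot>\<^sub>v w"] smult[of w "-1"] by simp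
    also have "\<dots> = 0\<^sub>v m" unfolding that(3) using fc[OF that(2)] by (intro eq_vecI) auto
    finally have "v + (-1) \<cdot>\<^sub>v w \<in> ?K" using that by auto
    then have 0: "v + (-1) \<cdot>\<^sub>v w = 0\<^sub>v n" using ker by auto
    show ?thesis
    proof (rule eq_vecI)
      fix i assume "i < dim_vec w"
      then have i: "i < n" using that by auto
      have "(v + (-1) \<cdot>\<^sub>v w) $ i = 0" unfolding 0 using i by simp
      then show "v $ i = w $ i" using i that by auto
    qed (use that in auto)
  qed
  let ?I = "f ` carrier_vec n"
  have "vec_subspace m ?I"
    unfolding vec_subspace_def
  proof (intro conjI ballI allI)
    show "?I \<subseteq> carrier_vec m" using fc by auto
    show "0\<^sub>v m \<in> ?I" using linear_on_zero[OF lin] by (metis image_eqI zero_carrier_vec)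
    fix x y assume "x \<in> ?I" "y \<in> ?I"
    then show "x + y \<in> ?I" by (auto simp flip: add)
  next
    fix c x assume "x \<in> ?I"
    then show "c \<cdot>\<^sub>v x \<in> ?I" by (auto simp flip: smult)
  qed
  moreover have "\<sigma> g *\<^sub>v x \<in> ?I" if "g \<in> carrier G" "x \<in> ?I" for g x
    using that mult_mat_vec_carrier[OF \<rho>c] by (auto simp flip: eqv)
  moreover have "?I \<noteq> {0\<^sub>v m}" using nz by blast
  ultimately have surj: "?I = carrier_vec m"
    using \<sigma> unfolding irreducible_rep_iff by blast
  define h where "h x = (SOME v. v \<in> carrier_vec n \<and> f v = x)" for x
  have h: "h x \<in> carrier_vec n" "f (h x) = x" if "x \<in> carrier_vec m" for x
  proof -
    have "x \<in> ?I" using surj that by simp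
    then have "\<exists>v. v \<in> carrier_vec n \<and> f v = x" by blast
    then have "h x \<in> carrier_vec n \<and> f (h x) = x" unfolding h_def by (rule someI_ex)
    then show "h x \<in> carrier_vec n" "f (h x) = x" by auto
  qed
  have "linear_on m n h"
    unfolding linear_on_def
  proof (intro conjI ballI allI)
    fix x y :: "'k vec" assume "x \<in> carrier_vec m" "y \<in> carrier_vec m"
    then show "h (x + y) = h x + h y" using h by - (rule inj, auto simp: add)
  next
    fix c :: 'k and x :: "'k vec" assume "x \<in> carrier_vec m"
    then show "h (c \<cdot>\<^sub>v x) = c \<cdot>\<^sub>v h x" using h by - (rule inj, auto simp: smult)
  qed (use h in auto)
  then obtain H where H: "H \<in> carrier_mat n m" "\<And>x. x \<in> carrier_vec m \<Longrightarrow> h x = H *\<^sub>v x"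
    using linear_on_mat by blast
  obtain F where F: "F \<in> carrier_mat m n" "\<And>v. v \<in> carrier_vec n \<Longrightarrow> f v = F *\<^sub>v v"
    using linear_on_mat[OF lin] by blast
  have FH: "F * H = 1\<^sub>m m"
  proof (rule mat_eqI_vec[of _ m m])
    fix v :: "'k vec" assume v: "v \<in> carrier_vec m"
    have "(F * H) *\<^sub>v v = F *\<^sub>v (H *\<^sub>v v)" using F H v by (simp add: assoc_mult_mat_vec)
    then show "(F * H) *\<^sub>v v = 1\<^sub>m m *\<^sub>v v" using F(2)[of "H *\<^sub>v v"] H(1) H(2)[OF v] h[OF v] v by simp
  qed (use F H in auto)
  have HF: "H * F = 1\<^sub>m n"
  proof (rule mat_eqI_vec[of _ n n])
    fix v :: "'k vec" assume v: "v \<in> carrier_vec n"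
    have "(H * F) *\<^sub>v v = h (f v)" using F H v fc[OF v] by (simp add: assoc_mult_mat_vec)
    also have "\<dots> = v" using h[OF fc[OF v]] v by - (rule inj, auto)
    finally show "(H * F) *\<^sub>v v = 1\<^sub>m n *\<^sub>v v" using v by simp
  qed (use F H in auto)
  have nm: "n = m"
    using left_inverse_dim_le[OF F(1) H(1) HF] left_inverse_dim_le[OF H(1) F(1) FH] by simp
  note cm = F(1)[unfolded nm] H(1)[unfolded nm]
  have "\<rho> g = H * \<sigma> g * F"
  proof (rule mat_eqI_vec[of _ n n])
    fix v :: "'k vec" assume v: "v \<in> carrier_vec n"
    have "H * \<sigma> g * F *\<^sub>v v = H *\<^sub>v (\<sigma> g *\<^sub>v (F *\<^sub>v v))"
      using cm \<sigma>c[OF g] v nm by (simp add: assoc_mult_mat_vec[of _ m m _ m])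
    also have "\<sigma> g *\<^sub>v (F *\<^sub>v v) = F *\<^sub>v (\<rho> g *\<^sub>v v)"
      using eqv[OF g v] F(2)[OF v] F(2)[of "\<rho> g *\<^sub>v v"] \<rho>c[OF g] v by simp
    also have "H *\<^sub>v \<dots> = \<rho> g *\<^sub>v v"
      using F(1) H(1) HF \<rho>c[OF g] v by (simp flip: assoc_mult_mat_vec[of H n m F n])
    finally show "\<rho> g *\<^sub>v v = H * \<sigma> g * F *\<^sub>v v" ..
  qed (use cm \<rho>c[OF g] \<sigma>c[OF g] nm in auto)
  then show "char_poly (\<rho> g) = char_poly (\<sigma> g)"
    using char_poly_conj[OF \<sigma>c[OF g] cm] FH HF nm by simp
qed

text \<open>An algebraically closed field supplies an eigenvalue of \<open>f\<close>. Its eigenspace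
  is invariant and nonzero, hence the whole space.\<close>

lemma schur_scalar:
  fixes \<rho> :: "'a \<Rightarrow> 'k :: field mat"
  assumes closed: "\<And>f :: 'k poly. degree f > 0 \<Longrightarrow> \<exists>x. poly f x = 0"
    and \<rho>: "irreducible_rep G n \<rho>" and f: "intertwiner G n \<rho> n \<rho> f"
  shows "\<exists>c. \<forall>v\<in>carrier_vec n. f v = c \<cdot>\<^sub>v v"
proof -
  have lin: "linear_on n n f" using f by (simp add: intertwiner_def)
  obtain F where F: "F \<in> carrier_mat n n" "\<And>v. v \<in> carrier_vec n \<Longrightarrow> f v = F *\<^sub>v v"
    using linear_on_mat[OF lin] by blast
  have "n > 0" using \<rho> by (simp add: irreducible_rep_def)
  then obtain l where "poly (char_poly F) l = 0"
    using closed[of "char_poly F"] degree_monic_char_poly[OF F(1)] by auto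
  then have "eigenvalue F l" using eigenvalue_root_char_poly[OF F(1)] by simp
  then obtain v where v: "v \<in> carrier_vec n" "v \<noteq> 0\<^sub>v n" "f v = l \<cdot>\<^sub>v v"
    using F by (auto simp: eigenvalue_def eigenvector_def)
  let ?W = "{v \<in> carrier_vec n. f v = l \<cdot>\<^sub>v v}"
  have "vec_subspace n ?W"
    using lin linear_on_zero[OF lin]
    by (auto simp: vec_subspace_def linear_on_def smult_add_distrib_vec smult_smult_assoc mult.commute)
  moreover have "\<rho> g *\<^sub>v w \<in> ?W" if g: "g \<in> carrier G" and w: "w \<in> ?W" for g w
  proof -
    have c: "\<rho> g \<in> carrier_mat n n" using \<rho> g by (auto simp: irreducible_rep_def matrix_rep_def)
    have "f (\<rho> g *\<^sub>v w) = \<rho> g *\<^sub>v (l \<cdot>\<^sub>v w)" using f g w by (auto simp: intertwiner_def)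
    then show ?thesis using c w by (auto simp: mult_mat_vec[OF c])
  qed
  moreover have "?W \<noteq> {0\<^sub>v n}" using v by auto
  ultimately have "?W = carrier_vec n" using \<rho> unfolding irreducible_rep_iff by blast
  then show ?thesis by blast
qed

text \<open>A nonzero tuple of minimal support generates a submodule on which the projection to any
  coordinate of the support is injective, and it is onto by irreducibility.\<close>

lemma submodule_contains_graph:
  fixes \<rho> :: "'s \<Rightarrow> 'a \<Rightarrow> 'k :: field mat" and R :: "('s \<Rightarrow> 'k vec) set"
  assumes S: "finite S"
    and irr: "\<And>s. s \<in> S \<Longrightarrow> irreducible_rep G (n s) (\<rho> s)"
    and carrier: "\<And>y s. y \<in> R \<Longrightarrow> s \<in> S \<Longrightarrow> y s \<in> carrier_vec (n s)"
    and add: "\<And>y z. y \<in> R \<Longrightarrow> z \<in> R \<Longrightarrow> (\<lambda>s. y s + z s) \<in> R"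
    and smult: "\<And>c y. y \<in> R \<Longrightarrow> (\<lambda>s. c \<cdot>\<^sub>v y s) \<in> R"
    and act: "\<And>g y. g \<in> carrier G \<Longrightarrow> y \<in> R \<Longrightarrow> (\<lambda>s. \<rho> s g *\<^sub>v y s) \<in> R"
    and nz: "y0 \<in> R" "s0 \<in> S" "y0 s0 \<noteq> 0\<^sub>v (n s0)"
  shows "\<exists>t\<in>S. \<exists>F. (\<forall>v\<in>carrier_vec (n t). F v \<in> R \<and> F v t = v) \<and>
    (\<forall>s\<in>S. intertwiner G (n t) (\<rho> t) (n s) (\<rho> s) (\<lambda>v. F v s))"
proof -
  define supp where "supp y = {s \<in> S. y s \<noteq> 0\<^sub>v (n s)}" for y :: "'s \<Rightarrow> 'k vec"
  have fin: "finite (supp y)" for y using S by (simp add: supp_def)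
  define y where "y = arg_min (\<lambda>y. card (supp y)) (\<lambda>y. y \<in> R \<and> supp y \<noteq> {})"
  have "y0 \<in> R \<and> supp y0 \<noteq> {}" using nz by (auto simp: supp_def)
  then have y: "y \<in> R" "supp y \<noteq> {}" and min: "\<And>z. z \<in> R \<Longrightarrow> supp z \<noteq> {} \<Longrightarrow> card (supp y) \<le> card (supp z)"
    unfolding y_def using arg_min_nat_lemma[of "\<lambda>y. y \<in> R \<and> supp y \<noteq> {}" y0 "\<lambda>y. card (supp y)"] by blast+
  obtain t where t: "t \<in> S" "y t \<noteq> 0\<^sub>v (n t)" using y by (auto simp: supp_def)
  define R' where "R' = {z \<in> R. supp z \<subseteq> supp y}"
  have R'_add: "(\<lambda>s. w s + z s) \<in> R'" if "w \<in> R'" "z \<in> R'" for w z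
    using that add carrier by (fastforce simp: R'_def supp_def)
  have R'_smult: "(\<lambda>s. c \<cdot>\<^sub>v z s) \<in> R'" if "z \<in> R'" for c z
    using that smult by (fastforce simp: R'_def supp_def)
  have \<rho>c: "\<rho> s g \<in> carrier_mat (n s) (n s)" if "s \<in> S" "g \<in> carrier G" for s g
    using irr that by (auto simp: irreducible_rep_def matrix_rep_def)
  have \<rho>0: "\<rho> s g *\<^sub>v 0\<^sub>v (n s) = 0\<^sub>v (n s)" if "s \<in> S" "g \<in> carrier G" for s g
    using \<rho>c[OF that] by auto
  have R'_act: "(\<lambda>s. \<rho> s g *\<^sub>v z s) \<in> R'" if "g \<in> carrier G" "z \<in> R'" for g z
  proof -
    have "supp (\<lambda>s. \<rho> s g *\<^sub>v z s) \<subseteq> supp z" using \<rho>0 that(1) by (auto simp: supp_def)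
    then show ?thesis using that act by (auto simp: R'_def)
  qed
  \<comment> \<open>A tuple in \<open>R'\<close> that vanishes at \<open>t\<close> has strictly
    smaller support than \<open>y\<close>, so minimality leaves it no support at all.\<close>
  have zero: "z s = 0\<^sub>v (n s)" if "z \<in> R'" "z t = 0\<^sub>v (n t)" "s \<in> S" for z s
  proof (rule ccontr)
    assume "z s \<noteq> 0\<^sub>v (n s)"
    then have "supp z \<noteq> {}" using that by (auto simp: supp_def)
    moreover have "supp z \<subset> supp y" using that t by (auto simp: R'_def supp_def)
    ultimately show False
      using min[of z] psubset_card_mono[OF fin, of "supp z" y] that by (auto simp: R'_def)
  qed
  have uniq: "w s = z s" if wz: "w \<in> R'" "z \<in> R'" "w t = z t" and s: "s \<in> S" for w z s
  proof -
    have c: "w s \<in> carrier_vec (n s)" "z s \<in> carrier_vec (n s)" "z t \<in> carrier_vec (n t)"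
      using wz s t carrier by (auto simp: R'_def)
    have "(\<lambda>s. w s + (-1) \<cdot>\<^sub>v z s) \<in> R'" using wz R'_add R'_smult by blast
    moreover have "w t + (-1) \<cdot>\<^sub>v z t = 0\<^sub>v (n t)" using wz c by (intro eq_vecI) auto
    ultimately have 0: "w s + (-1) \<cdot>\<^sub>v z s = 0\<^sub>v (n s)" using zero s by blast
    show ?thesis
    proof (rule eq_vecI)
      fix i assume "i < dim_vec (z s)"
      then have i: "i < n s" using c by auto
      have "(w s + (-1) \<cdot>\<^sub>v z s) $ i = 0" unfolding 0 using i by simp
      then show "w s $ i = z s $ i" using i c by auto
    qed (use c in auto)
  qed
  let ?W = "(\<lambda>z. z t) ` R'"
  have yR': "y \<in> R'" using y by (simp add: R'_def)
  have "vec_subspace (n t) ?W"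
    unfolding vec_subspace_def
  proof (intro conjI ballI allI)
    show "?W \<subseteq> carrier_vec (n t)" using carrier t by (auto simp: R'_def)
    have "(\<lambda>s. 0 \<cdot>\<^sub>v y s) \<in> R'" using yR' R'_smult by blast
    moreover have "0 \<cdot>\<^sub>v y t = 0\<^sub>v (n t)" using carrier[OF y(1) t(1)] by auto
    ultimately show "0\<^sub>v (n t) \<in> ?W" by (metis (mono_tags, lifting) image_eqI)
    fix x z assume "x \<in> ?W" "z \<in> ?W"
    then show "x + z \<in> ?W" using R'_add by fastforce
  next
    fix c x assume "x \<in> ?W"
    then show "c \<cdot>\<^sub>v x \<in> ?W" using R'_smult by fastforce
  qed
  moreover have "\<rho> t g *\<^sub>v x \<in> ?W" if "g \<in> carrier G" "x \<in> ?W" for g x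
    using that R'_act by fastforce
  moreover have "?W \<noteq> {0\<^sub>v (n t)}" using yR' t by blast
  ultimately have onto: "?W = carrier_vec (n t)"
    using irr[OF t(1)] unfolding irreducible_rep_iff by blast
  define F where "F v = (SOME z. z \<in> R' \<and> z t = v)" for v
  have F: "F v \<in> R'" "F v t = v" if "v \<in> carrier_vec (n t)" for v
  proof -
    have "v \<in> ?W" using onto that by simp
    then have "\<exists>z. z \<in> R' \<and> z t = v" by blast
    then have "F v \<in> R' \<and> F v t = v" unfolding F_def by (rule someI_ex)
    then show "F v \<in> R'" "F v t = v" by auto
  qed
  show ?thesis
  proof (intro bexI[of _ t] exI[of _ F] conjI ballI)
    show "t \<in> S" by fact
    show "F v \<in> R" "F v t = v" if "v \<in> carrier_vec (n t)" for v using F[OF that] by (auto simp: R'_def)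
    fix s assume s: "s \<in> S"
    \<comment> \<open>The values of \<open>F\<close> are chosen arbitrarily, but \<open>uniq\<close>
      makes \<open>F\<close> linear and equivariant: both sides lie in \<open>R'\<close> and agree
      at \<open>t\<close>.\<close>
    have "F (v + w) s = F v s + F w s" if "v \<in> carrier_vec (n t)" "w \<in> carrier_vec (n t)" for v w
      using uniq[OF F(1) R'_add[OF F(1) F(1)] _ s, of "v + w" v w] F(2) that by auto
    moreover have "F (c \<cdot>\<^sub>v v) s = c \<cdot>\<^sub>v F v s" if "v \<in> carrier_vec (n t)" for c v
      using uniq[OF F(1) R'_smult[OF F(1)] _ s, of "c \<cdot>\<^sub>v v" v c] F(2) that by auto
    moreover have "F (\<rho> t g *\<^sub>v v) s = \<rho> s g *\<^sub>v F v s" if "g \<in> carrier G" "v \<in> carrier_vec (n t)" for g v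
      using uniq[OF F(1) R'_act[OF that(1) F(1)] _ s, of "\<rho> t g *\<^sub>v v" v] F(2) \<rho>c[OF t(1) that(1)] that by auto
    moreover have "F v s \<in> carrier_vec (n s)" if "v \<in> carrier_vec (n t)" for v
      using F(1)[OF that] carrier s by (auto simp: R'_def)
    ultimately show "intertwiner G (n t) (\<rho> t) (n s) (\<rho> s) (\<lambda>v. F v s)"
      unfolding intertwiner_def linear_on_def by blast
  qed
qed

lemma mult_mat_vec_index_add:
  assumes "A \<in> carrier_mat n n" "v \<in> carrier_vec n" "w \<in> carrier_vec n" "b < n"
  shows "(A *\<^sub>v (v + w)) $ b = (A *\<^sub>v v) $ b + (A *\<^sub>v w) $ b"
  using assms by (subst mult_add_distrib_mat_vec[of A n n]) auto

lemma mult_mat_vec_index_smult: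
  fixes A :: "'k :: field mat"
  assumes "A \<in> carrier_mat n n" "v \<in> carrier_vec n" "b < n"
  shows "(A *\<^sub>v (c \<cdot>\<^sub>v v)) $ b = c * (A *\<^sub>v v) $ b"
  using assms by (subst mult_mat_vec[of A n n]) auto

text \<open>The relation is read as membership of a tuple in a submodule of a direct sum that has
  one copy of representation \<open>i\<close> for each diagonal position \<open>b\<close>. By
  \<open>submodule_contains_graph\<close>, this submodule contains an embedded irreducible
  representation. Schur's lemma makes every component of the embedding zero or a scalar, and that
  violates the equation defining the submodule.\<close>

lemma irreducible_traces_independent:
  fixes \<sigma> :: "'i \<Rightarrow> 'a \<Rightarrow> 'k :: field mat"
  assumes closed: "\<And>f :: 'k poly. degree f > 0 \<Longrightarrow> \<exists>x. poly f x = 0"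
    and G: "group G" and I: "finite I"
    and irr: "\<And>i. i \<in> I \<Longrightarrow> irreducible_rep G (d i) (\<sigma> i)"
    and noniso: "\<And>i j. i \<in> I \<Longrightarrow> j \<in> I \<Longrightarrow> i \<noteq> j \<Longrightarrow> \<exists>g\<in>carrier G. char_poly (\<sigma> i g) \<noteq> char_poly (\<sigma> j g)"
    and rel: "\<And>g. g \<in> carrier G \<Longrightarrow> (\<Sum>i\<in>I. c i * mtrace (\<sigma> i g)) = 0"
    and i: "i \<in> I"
  shows "c i = 0"
proof (rule ccontr)
  assume ci: "c i \<noteq> 0"
  interpret group G by fact
  have \<sigma>c: "\<sigma> i g \<in> carrier_mat (d i) (d i)" if "i \<in> I" "g \<in> carrier G" for i g
    using irr that by (auto simp: irreducible_rep_def matrix_rep_def)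
  have \<sigma>m: "\<sigma> i (g \<otimes>\<^bsub>G\<^esub> h) = \<sigma> i g * \<sigma> i h" if "i \<in> I" "g \<in> carrier G" "h \<in> carrier G" for i g h
    using irr that by (auto simp: irreducible_rep_def matrix_rep_def)
  have \<sigma>1: "\<sigma> i \<one>\<^bsub>G\<^esub> = 1\<^sub>m (d i)" if "i \<in> I" for i
    using irr that by (auto simp: irreducible_rep_def matrix_rep_def)
  define S where "S = Sigma I (\<lambda>i. {..<d i})"
  \<comment> \<open>\<open>R\<close> collects the tuples whose diagonal functional vanishes for
    every \<open>g\<close>. It is closed under the action of \<open>h\<close>, which only replaces
    \<open>g\<close> by \<open>g \<otimes> h\<close>. On \<open>?y0\<close> the functional is the
    given combination of traces.\<close>
  define R where "R = {y. (\<forall>(i, b)\<in>S. y (i, b) \<in> carrier_vec (d i)) \<and>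
      (\<forall>g\<in>carrier G. (\<Sum>(i, b)\<in>S. (\<sigma> i g *\<^sub>v y (i, b)) $ b) = 0)}"
  have S: "finite S" using I by (simp add: S_def)
  let ?y0 = "\<lambda>(i, b). c i \<cdot>\<^sub>v unit_vec (d i) b :: 'k vec"
  have y0: "?y0 \<in> R"
    unfolding R_def
  proof (intro CollectI conjI ballI)
    fix g assume g: "g \<in> carrier G"
    have "(\<Sum>(i, b)\<in>S. (\<sigma> i g *\<^sub>v ?y0 (i, b)) $ b) = (\<Sum>i\<in>I. \<Sum>b<d i. (\<sigma> i g *\<^sub>v (c i \<cdot>\<^sub>v unit_vec (d i) b)) $ b)"
      unfolding S_def using I by (subst sum.Sigma) auto
    also have "\<dots> = (\<Sum>i\<in>I. c i * mtrace (\<sigma> i g))"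
    proof (rule sum.cong[OF refl])
      fix i assume i: "i \<in> I"
      have "(\<sigma> i g *\<^sub>v (c i \<cdot>\<^sub>v unit_vec (d i) b)) $ b = c i * \<sigma> i g $$ (b, b)" if "b < d i" for b
        using \<sigma>c[OF i g] that
        by (subst mult_mat_vec_index_smult[of _ "d i"]) (auto simp: scalar_prod_right_unit)
      then show "(\<Sum>b<d i. (\<sigma> i g *\<^sub>v (c i \<cdot>\<^sub>v unit_vec (d i) b)) $ b) = c i * mtrace (\<sigma> i g)"
        using \<sigma>c[OF i g] by (simp add: mtrace_def sum_distrib_left)
    qed
    finally show "(\<Sum>(i, b)\<in>S. (\<sigma> i g *\<^sub>v ?y0 (i, b)) $ b) = 0" using rel[OF g] by simp
  qed auto
  have di: "0 < d i" using irr[OF i] by (simp add: irreducible_rep_def)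
  have s0: "(i, 0) \<in> S" using i di by (auto simp: S_def)
  have "?y0 (i, 0) \<noteq> 0\<^sub>v (d i)"
  proof
    assume "?y0 (i, 0) = 0\<^sub>v (d i)"
    then have "?y0 (i, 0) $ 0 = 0" using di by simp
    then show False using ci di by simp
  qed
  then have nz: "?y0 (i, 0) \<noteq> 0\<^sub>v (d (fst (i, 0 :: nat)))" by simp
  have "\<exists>t\<in>S. \<exists>F. (\<forall>v\<in>carrier_vec (d (fst t)). F v \<in> R \<and> F v t = v) \<and>
    (\<forall>s\<in>S. intertwiner G (d (fst t)) (\<sigma> (fst t)) (d (fst s)) (\<sigma> (fst s)) (\<lambda>v. F v s))"
  proof (rule submodule_contains_graph[where G = G and S = S and n = "\<lambda>s. d (fst s)" and
        \<rho> = "\<lambda>s. \<sigma> (fst s)" and R = R, OF S _ _ _ _ _ y0 s0 nz])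
    show "irreducible_rep G (d (fst s)) (\<sigma> (fst s))" if "s \<in> S" for s
      using that irr by (auto simp: S_def)
    show "y s \<in> carrier_vec (d (fst s))" if "y \<in> R" "s \<in> S" for y s
      using that by (auto simp: R_def)
    show "(\<lambda>s. y s + z s) \<in> R" if yz: "y \<in> R" "z \<in> R" for y z
    proof -
      have "(\<sigma> i g *\<^sub>v (y (i, b) + z (i, b))) $ b = (\<sigma> i g *\<^sub>v y (i, b)) $ b + (\<sigma> i g *\<^sub>v z (i, b)) $ b"
        if "(i, b) \<in> S" "g \<in> carrier G" for i b g
        using that yz \<sigma>c by (intro mult_mat_vec_index_add[of _ "d i"]) (auto simp: R_def S_def)
      then have "(\<Sum>(i, b)\<in>S. (\<sigma> i g *\<^sub>v (y (i, b) + z (i, b))) $ b) =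
          (\<Sum>(i, b)\<in>S. (\<sigma> i g *\<^sub>v y (i, b)) $ b) + (\<Sum>(i, b)\<in>S. (\<sigma> i g *\<^sub>v z (i, b)) $ b)"
        if "g \<in> carrier G" for g
        unfolding sum.distrib[symmetric] using that by (intro sum.cong) auto
      then show ?thesis using yz by (fastforce simp: R_def)
    qed
    show "(\<lambda>s. e \<cdot>\<^sub>v y s) \<in> R" if y: "y \<in> R" for e y
    proof -
      have "(\<sigma> i g *\<^sub>v (e \<cdot>\<^sub>v y (i, b))) $ b = e * (\<sigma> i g *\<^sub>v y (i, b)) $ b"
        if "(i, b) \<in> S" "g \<in> carrier G" for i b g
        using that y \<sigma>c by (intro mult_mat_vec_index_smult[of _ "d i"]) (auto simp: R_def S_def)
      then have "(\<Sum>(i, b)\<in>S. (\<sigma> i g *\<^sub>v (e \<cdot>\<^sub>v y (i, b))) $ b) =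
          e * (\<Sum>(i, b)\<in>S. (\<sigma> i g *\<^sub>v y (i, b)) $ b)" if "g \<in> carrier G" for g
        unfolding sum_distrib_left using that by (intro sum.cong) auto
      then show ?thesis using y by (fastforce simp: R_def)
    qed
    show "(\<lambda>s. \<sigma> (fst s) h *\<^sub>v y s) \<in> R" if h: "h \<in> carrier G" and y: "y \<in> R" for h y
    proof -
      have "\<sigma> i g *\<^sub>v (\<sigma> i h *\<^sub>v y (i, b)) = \<sigma> i (g \<otimes>\<^bsub>G\<^esub> h) *\<^sub>v y (i, b)"
        if "(i, b) \<in> S" "g \<in> carrier G" for i b g
      proof -
        have "i \<in> I" "y (i, b) \<in> carrier_vec (d i)" using that y by (auto simp: R_def S_def)
        then show ?thesis using \<sigma>c[of i g] \<sigma>c[of i h] h that(2) by (simp add: \<sigma>m)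
      qed
      then have "(\<Sum>(i, b)\<in>S. (\<sigma> i g *\<^sub>v (\<sigma> i h *\<^sub>v y (i, b))) $ b) =
          (\<Sum>(i, b)\<in>S. (\<sigma> i (g \<otimes>\<^bsub>G\<^esub> h) *\<^sub>v y (i, b)) $ b)" if "g \<in> carrier G" for g
        using that by (intro sum.cong) auto
      moreover have "\<sigma> i h *\<^sub>v y (i, b) \<in> carrier_vec (d i)" if "(i, b) \<in> S" for i b
        using mult_mat_vec_carrier[OF \<sigma>c[of i h]] y h that by (fastforce simp: S_def R_def)
      ultimately show ?thesis using y h by (fastforce simp: R_def)
    qed
  qed
  then obtain t F where tF: "t \<in> S" "\<And>v. v \<in> carrier_vec (d (fst t)) \<Longrightarrow> F v \<in> R"
    "\<And>v. v \<in> carrier_vec (d (fst t)) \<Longrightarrow> F v t = v"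
    "\<And>s. s \<in> S \<Longrightarrow> intertwiner G (d (fst t)) (\<sigma> (fst t)) (d (fst s)) (\<sigma> (fst s)) (\<lambda>v. F v s)"
    by blast
  obtain i0 b0 where t: "t = (i0, b0)" by (cases t)
  have i0: "i0 \<in> I" "b0 < d i0" using tF(1) t by (auto simp: S_def)
  have "\<forall>b. \<exists>a. b < d i0 \<longrightarrow> (\<forall>v\<in>carrier_vec (d i0). F v (i0, b) = a \<cdot>\<^sub>v v)"
    using schur_scalar[OF closed irr[OF i0(1)]] tF(4)[of "(i0, _)"] i0 t by (fastforce simp: S_def)
  from choice[OF this] obtain a where
    a: "\<And>b v. b < d i0 \<Longrightarrow> v \<in> carrier_vec (d i0) \<Longrightarrow> F v (i0, b) = a b \<cdot>\<^sub>v v" by blast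
  have other: "F v (j, b) = 0\<^sub>v (d j)" if "j \<in> I" "j \<noteq> i0" "b < d j" "v \<in> carrier_vec (d i0)" for j b v
  proof (rule ccontr)
    assume "F v (j, b) \<noteq> 0\<^sub>v (d j)"
    moreover have "intertwiner G (d i0) (\<sigma> i0) (d j) (\<sigma> j) (\<lambda>v. F v (j, b))"
      using tF(4)[of "(j, b)"] that t by (auto simp: S_def)
    ultimately have "\<forall>g\<in>carrier G. char_poly (\<sigma> i0 g) = char_poly (\<sigma> j g)"
      using schur_iso[OF irr[OF i0(1)] irr[OF that(1)]] that by blast
    then show False using noniso[of i0 j] i0 that by auto
  qed
  \<comment> \<open>At \<open>g = \<one>\<close> only the entry of \<open>F ?e\<close> at
    \<open>t = (i0, b0)\<close> contributes. Elsewhere in the block of \<open>i0\<close> the entry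
    is a multiple of \<open>?e\<close> read at a position other than \<open>b0\<close>. So the
    functional has the value \<open>1\<close> instead of \<open>0\<close>.\<close>
  let ?e = "unit_vec (d i0) b0 :: 'k vec"
  have "F ?e \<in> R" using tF(2) t by simp
  then have "(\<Sum>(i, b)\<in>S. (\<sigma> i \<one>\<^bsub>G\<^esub> *\<^sub>v F ?e (i, b)) $ b) = 0" by (auto simp: R_def)
  moreover have val: "(\<sigma> j \<one>\<^bsub>G\<^esub> *\<^sub>v F ?e (j, b)) $ b = (if (j, b) = (i0, b0) then 1 else 0)" if "(j, b) \<in> S" for j b
  proof -
    have jb: "j \<in> I" "b < d j" using that by (auto simp: S_def)
    have "F ?e (j, b) \<in> carrier_vec (d j)" using \<open>F ?e \<in> R\<close> that by (auto simp: R_def)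
    then have 1: "\<sigma> j \<one>\<^bsub>G\<^esub> *\<^sub>v F ?e (j, b) = F ?e (j, b)" using \<sigma>1[OF jb(1)] by simp
    consider "j \<noteq> i0" | "j = i0" "b \<noteq> b0" | "j = i0" "b = b0" by auto
    then show ?thesis
    proof cases
      case 1
      then show ?thesis using other[OF jb(1) _ jb(2), of ?e] \<open>\<sigma> j \<one>\<^bsub>G\<^esub> *\<^sub>v _ = _\<close> jb by simp
    next
      case 2
      then show ?thesis using a[of b ?e] \<open>\<sigma> j \<one>\<^bsub>G\<^esub> *\<^sub>v _ = _\<close> jb i0 by simp
    next
      case 3
      then show ?thesis using tF(3)[of ?e] t \<open>\<sigma> j \<one>\<^bsub>G\<^esub> *\<^sub>v _ = _\<close> jb i0 by simp
    qed
  qed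
  have "(\<Sum>(j, b)\<in>S. (\<sigma> j \<one>\<^bsub>G\<^esub> *\<^sub>v F ?e (j, b)) $ b) = (\<Sum>s\<in>S. if s = (i0, b0) then 1 else 0)"
  proof (rule sum.cong[OF refl])
    fix s assume s: "s \<in> S"
    obtain j b where jb: "s = (j, b)" by (cases s)
    show "(case s of (j, b) \<Rightarrow> (\<sigma> j \<one>\<^bsub>G\<^esub> *\<^sub>v F ?e (j, b)) $ b) = (if s = (i0, b0) then 1 else 0)"
      unfolding jb prod.case by (rule val[OF s[unfolded jb]])
  qed
  moreover have "\<dots> = (1 :: 'k)" using S tF(1) t by simp
  ultimately show False by simp
qed

subsection \<open>Brauer characters and their reductions\<close>

context group
begin

lemma matrix_rep_pow:
  fixes \<rho> :: "'a \<Rightarrow> 'k :: field mat"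
  assumes "matrix_rep G n \<rho>" "g \<in> carrier G"
  shows "\<rho> (g [^] k) = \<rho> g ^\<^sub>m (k :: nat)"
proof (induction k)
  case 0
  then show ?case using assms by (auto simp: matrix_rep_def)
next
  case (Suc k)
  then show ?case using assms by (auto simp: matrix_rep_def)
qed

lemma matrix_rep_conjugate:
  fixes \<rho> :: "'a \<Rightarrow> 'k :: field mat"
  assumes \<rho>: "matrix_rep G n \<rho>" and "y \<in> carrier G" "g \<in> carrier G"
  shows "char_poly (\<rho> (y \<otimes> g \<otimes> inv y)) = char_poly (\<rho> g)"
    "mtrace (\<rho> (y \<otimes> g \<otimes> inv y)) = mtrace (\<rho> g)"
proof -
  have c: "\<rho> x \<in> carrier_mat n n" if "x \<in> carrier G" for x
    using \<rho> that by (auto simp: matrix_rep_def)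
  have m: "\<rho> (x \<otimes> z) = \<rho> x * \<rho> z" if "x \<in> carrier G" "z \<in> carrier G" for x z
    using \<rho> that by (auto simp: matrix_rep_def)
  have 1: "\<rho> \<one> = 1\<^sub>m n" using \<rho> by (auto simp: matrix_rep_def)
  have inv: "\<rho> (inv y) * \<rho> y = 1\<^sub>m n" "\<rho> y * \<rho> (inv y) = 1\<^sub>m n"
    using assms 1 by (simp_all flip: m)
  have eq: "\<rho> (y \<otimes> g \<otimes> inv y) = \<rho> y * \<rho> g * \<rho> (inv y)" using assms by (simp add: m)
  show "char_poly (\<rho> (y \<otimes> g \<otimes> inv y)) = char_poly (\<rho> g)"
    unfolding eq using assms by (intro char_poly_conj[OF c c c inv]) auto
  show "mtrace (\<rho> (y \<otimes> g \<otimes> inv y)) = mtrace (\<rho> g)"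
    unfolding eq using assms by (intro mtrace_conj[OF c c c inv(1)]) auto
qed

lemma conj_nat_pow:
  assumes "x \<in> carrier G" "t \<in> carrier G"
  shows "(inv t \<otimes> x \<otimes> t) [^] (r :: nat) = inv t \<otimes> x [^] r \<otimes> t"
proof (induction r)
  case 0
  then show ?case using assms by simp
next
  case (Suc r)
  have "inv t \<otimes> x [^] r \<otimes> t \<otimes> (inv t \<otimes> x \<otimes> t) = inv t \<otimes> x [^] r \<otimes> ((t \<otimes> inv t) \<otimes> (x \<otimes> t))"
    using assms by (simp only: m_assoc m_closed inv_closed nat_pow_closed)
  then show ?case using Suc assms by (simp add: m_assoc)
qed

section \<open>Conjugacy classes\<close>

definition conj_class :: "'a \<Rightarrow> 'a set" where
  "conj_class g = {y \<otimes> g \<otimes> inv y | y. y \<in> carrier G}"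

lemma conjugacy_classes_eq: "conjugacy_classes G = conj_class ` carrier G"
  by (auto simp: conjugacy_classes_def orbits_def orbit_def conj_class_def)

lemma conj_class_self: "g \<in> carrier G \<Longrightarrow> g \<in> conj_class g"
  unfolding conj_class_def by (intro CollectI exI[of _ \<one>]) auto

lemma conj_class_carrier: "g \<in> carrier G \<Longrightarrow> conj_class g \<subseteq> carrier G"
  by (auto simp: conj_class_def)

lemma conj_class_subset:
  assumes g: "g \<in> carrier G" and x: "x \<in> conj_class g"
  shows "conj_class x \<subseteq> conj_class g"
proof
  fix z assume "z \<in> conj_class x"
  then obtain y where y: "y \<in> carrier G" "z = y \<otimes> x \<otimes> inv y" by (auto simp: conj_class_def)
  obtain w where w: "w \<in> carrier G" "x = w \<otimes> g \<otimes> inv w" using x by (auto simp: conj_class_def)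
  have "z = (y \<otimes> w) \<otimes> g \<otimes> inv (y \<otimes> w)"
    unfolding y(2) w(2) using y(1) w(1) g by (simp add: m_assoc inv_mult_group)
  then show "z \<in> conj_class g" unfolding conj_class_def using y(1) w(1) by blast
qed

lemma conj_class_sym:
  assumes "g \<in> carrier G" "x \<in> conj_class g"
  shows "g \<in> conj_class x"
proof -
  obtain w where w: "w \<in> carrier G" "x = w \<otimes> g \<otimes> inv w" using assms by (auto simp: conj_class_def)
  have "inv w \<otimes> x \<otimes> inv (inv w) = (inv w \<otimes> w) \<otimes> g \<otimes> (inv w \<otimes> w)"
    unfolding w(2) using w(1) assms(1) by (simp only: m_assoc m_closed inv_closed inv_inv)
  then have "g = inv w \<otimes> x \<otimes> inv (inv w)" using w(1) assms(1) by simp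
  then show ?thesis unfolding conj_class_def using w(1) by blast
qed

lemma conj_class_eq: "g \<in> carrier G \<Longrightarrow> x \<in> conj_class g \<Longrightarrow> conj_class x = conj_class g"
  using conj_class_subset[of g x] conj_class_subset[of x g] conj_class_sym[of g x] conj_class_carrier[of g] by blast

lemma conj_class_one: "conj_class \<one> = {\<one>}"
  using conj_class_self[of \<one>] by (auto simp: conj_class_def)

end

locale modular_group = modular p red + group G
  for p and red :: "complex \<Rightarrow> 'k :: field" and G :: "('a, 'b) monoid_scheme" (structure) +
  assumes finite_carrier: "finite (carrier G)"
begin

abbreviation "Greg \<equiv> p_regular_elements G p"

lemma Greg_carrier: "g \<in> Greg \<Longrightarrow> g \<in> carrier G"
  by (simp add: p_regular_elements_def)

lemma one_Greg: "\<one> \<in> Greg"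
  using prime_p pow_eq_id[of \<one> 1] by (auto simp: p_regular_elements_def)

lemma finite_Greg: "finite Greg"
  using finite_carrier by (simp add: p_regular_elements_def)

text \<open>With \<open>p ^ a\<close> the full power of \<open>p\<close> in the group order, the
  order of \<open>g [^] (p ^ a)\<close> divides the cofactor \<open>m\<close>, which is prime to
  \<open>p\<close>.\<close>

lemma ex_regular_power: "\<exists>a. \<forall>g\<in>carrier G. g [^] (p ^ a :: nat) \<in> Greg"
proof -
  have "Coset.order G \<noteq> 0" using finite_carrier one_closed by (auto simp: Coset.order_def)
  then obtain a m where am: "Coset.order G = p ^ a * m" "\<not> p dvd m"
    using multiplicity_decompose'[of "Coset.order G" p] prime_p
    by (metis not_prime_unit)
  have "g [^] (p ^ a :: nat) \<in> Greg" if g: "g \<in> carrier G" for g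
  proof -
    have "(g [^] (p ^ a :: nat)) [^] m = \<one>"
      using g am pow_order_eq_1[OF g] by (simp add: nat_pow_pow)
    then have "ord (g [^] (p ^ a :: nat)) dvd m" using g by (simp add: pow_eq_id)
    then show ?thesis using g am(2) by (auto simp: p_regular_elements_def dest: dvd_trans)
  qed
  then show ?thesis by blast
qed

text \<open>The eigenvalues of the power of \<open>A\<close> are the powers of the eigenvalues of
  \<open>A\<close>, and raising to a power of \<open>p\<close> is additive in characteristic
  \<open>p\<close>.\<close>

lemma mtrace_frobenius:
  fixes A :: "'k mat"
  assumes A: "A \<in> carrier_mat n n"
  shows "mtrace (A ^\<^sub>m (p ^ a)) = mtrace A ^ (p ^ a)"
proof -
  obtain as where as: "\<And>k. mtrace (A ^\<^sub>m k) = (\<Sum>a\<leftarrow>as. a ^ k)"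
    using char_poly_splits[OF alg_closed A] by blast
  have "A ^\<^sub>m 1 = A" using A by simp
  then have "mtrace A = (\<Sum>a\<leftarrow>as. a)" using as[of 1] by simp
  moreover have "(\<Sum>b\<leftarrow>bs. b) ^ (p ^ a) = (\<Sum>b\<leftarrow>bs. b ^ (p ^ a))" for bs :: "'k list"
  proof (induction bs)
    case Nil
    then show ?case using prime_p by (simp add: prime_gt_0_nat)
  next
    case (Cons b bs)
    then show ?case
      using freshmans_dream'[of "p ^ a" a b "\<Sum>b\<leftarrow>bs. b"] prime_p CHAR_eq by simp
  qed
  ultimately show ?thesis using as by simp
qed

text \<open>Replacing each \<open>c i\<close> by its root \<open>r (c i)\<close> gives a combination
  of traces on the whole group. Its \<open>p ^ a\<close>-th power at \<open>g\<close> is the given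
  relation at the p-regular element \<open>g [^] (p ^ a)\<close>, so the combination vanishes on all
  of \<open>G\<close>.\<close>

lemma irreducible_traces_independent_regular:
  fixes \<sigma> :: "'i \<Rightarrow> 'a \<Rightarrow> 'k mat"
  assumes I: "finite I"
    and irr: "\<And>i. i \<in> I \<Longrightarrow> irreducible_rep G (d i) (\<sigma> i)"
    and noniso: "\<And>i j. i \<in> I \<Longrightarrow> j \<in> I \<Longrightarrow> i \<noteq> j \<Longrightarrow> \<exists>g\<in>carrier G. char_poly (\<sigma> i g) \<noteq> char_poly (\<sigma> j g)"
    and rel: "\<And>g. g \<in> Greg \<Longrightarrow> (\<Sum>i\<in>I. c i * mtrace (\<sigma> i g)) = 0"
    and i: "i \<in> I"
  shows "c i = 0"
proof -
  obtain a where a: "\<And>g. g \<in> carrier G \<Longrightarrow> g [^] (p ^ a :: nat) \<in> Greg"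
    using ex_regular_power by blast
  have q: "p ^ a > 0" using prime_p by (simp add: prime_gt_0_nat)
  have "\<forall>x :: 'k. \<exists>y. y ^ (p ^ a) = x"
  proof
    fix x :: 'k
    have "degree (monom 1 (p ^ a) - [:x:]) = p ^ a"
      using q by (intro antisym degree_le le_degree) (auto simp: coeff_pCons split: nat.splits)
    then show "\<exists>y. y ^ (p ^ a) = x"
      using alg_closed[of "monom 1 (p ^ a) - [:x:]"] q by (auto simp: poly_monom)
  qed
  from choice[OF this] obtain r :: "'k \<Rightarrow> 'k" where r: "\<And>x. r x ^ (p ^ a) = x" by blast
  have "(\<Sum>i\<in>I. r (c i) * mtrace (\<sigma> i g)) = 0" if g: "g \<in> carrier G" for g
  proof -
    have "(\<Sum>i\<in>I. r (c i) * mtrace (\<sigma> i g)) ^ (p ^ a) = (\<Sum>i\<in>I. (r (c i) * mtrace (\<sigma> i g)) ^ (p ^ a))"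
      using prime_p CHAR_eq by (intro freshmans_dream_sum') auto
    also have "\<dots> = (\<Sum>i\<in>I. c i * mtrace (\<sigma> i (g [^] (p ^ a))))"
    proof (rule sum.cong[OF refl])
      fix i assume "i \<in> I"
      then have rep: "matrix_rep G (d i) (\<sigma> i)" using irr by (auto simp: irreducible_rep_def)
      then have "\<sigma> i g \<in> carrier_mat (d i) (d i)" using g by (auto simp: matrix_rep_def)
      then show "(r (c i) * mtrace (\<sigma> i g)) ^ (p ^ a) = c i * mtrace (\<sigma> i (g [^] (p ^ a)))"
        by (simp add: power_mult_distrib r matrix_rep_pow[OF rep g] mtrace_frobenius)
    qed
    also have "\<dots> = 0" by (rule rel[OF a[OF g]])
    finally show ?thesis by simp
  qed
  from irreducible_traces_independent[OF alg_closed is_group I irr noniso this i]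
  have "r (c i) = 0" by blast
  then have "c i = 0 ^ (p ^ a)" using r[of "c i"] by simp
  then show ?thesis using q by (simp only: zero_power)
qed

section \<open>Brauer character values as sums of lifted eigenvalues\<close>

lemma brauer_character_root_sum:
  assumes "matrix_rep G n \<rho>" "g \<in> Greg"
  shows "brauer_character_of G p red \<rho> g = root_sum (lift_root p red) (char_poly (\<rho> g))"
proof -
  have "\<rho> g \<in> carrier_mat n n" using assms by (auto simp: matrix_rep_def Greg_carrier)
  then have "{x. eigenvalue (\<rho> g) x} = {x. poly (char_poly (\<rho> g)) x = 0}"
    using eigenvalue_root_char_poly by auto
  then show ?thesis
    using assms(2) by (simp add: brauer_character_of_def root_sum_def)
qed

text \<open>The order of \<open>g\<close> is prime to \<open>p\<close> and \<open>\<rho> g\<close>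
  is annihilated by the corresponding power relation, so \<open>lift_root\<close> is well behaved on
  every eigenvalue. The list keeps multiplicities, which lets values and traces be compared term by
  term.\<close>

lemma brauer_character_eigenvalues:
  assumes \<rho>: "matrix_rep G n \<rho>" and g: "g \<in> Greg"
  obtains as where "\<And>a. a \<in> set as \<Longrightarrow> a ^ ord g = 1"
    "char_poly (\<rho> g) = (\<Prod>a\<leftarrow>as. [:- a, 1:])"
    "brauer_character_of G p red \<rho> g = (\<Sum>a\<leftarrow>as. lift_root p red a)"
    "mtrace (\<rho> g) = (\<Sum>a\<leftarrow>as. a)"
proof -
  have gc: "g \<in> carrier G" using g Greg_carrier by simp
  have c: "\<rho> g \<in> carrier_mat n n" using \<rho> gc by (auto simp: matrix_rep_def)
  obtain as where as: "char_poly (\<rho> g) = (\<Prod>a\<leftarrow>as. [:- a, 1:])" "\<And>k. mtrace (\<rho> g ^\<^sub>m k) = (\<Sum>a\<leftarrow>as. a ^ k)"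
    using char_poly_splits[OF alg_closed c] by blast
  show ?thesis
  proof (rule that)
    show "char_poly (\<rho> g) = (\<Prod>a\<leftarrow>as. [:- a, 1:])" by fact
    show "brauer_character_of G p red \<rho> g = (\<Sum>a\<leftarrow>as. lift_root p red a)"
      by (simp add: brauer_character_root_sum[OF \<rho> g] as root_sum_split)
    have "\<rho> g ^\<^sub>m 1 = \<rho> g" using c by simp
    then show "mtrace (\<rho> g) = (\<Sum>a\<leftarrow>as. a)" using as(2)[of 1] by simp
    fix a assume "a \<in> set as"
    then have "poly (char_poly (\<rho> g)) a = 0"
      unfolding as by (induction as) auto
    then have "eigenvalue (\<rho> g) a" using eigenvalue_root_char_poly[OF c] by simp
    then obtain v where v: "eigenvector (\<rho> g) v a" by (auto simp: eigenvalue_def)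
    then have vc: "v \<in> carrier_vec n" "v \<noteq> 0\<^sub>v n" using c by (auto simp: eigenvector_def)
    have "\<rho> g ^\<^sub>m ord g = 1\<^sub>m n"
      using matrix_rep_pow[OF \<rho> gc, of "ord g"] \<rho> gc by (simp add: matrix_rep_def pow_ord_eq_1)
    then have eq: "v = a ^ ord g \<cdot>\<^sub>v v" using eigenvector_pow[OF c v, of "ord g"] vc by simp
    obtain i where i: "i < n" "v $ i \<noteq> 0" using vc by (metis eq_vecI carrier_vecD index_zero_vec)
    have "v $ i = a ^ ord g * v $ i" using arg_cong[OF eq, of "\<lambda>v. v $ i"] i vc by simp
    then show "a ^ ord g = 1" using i by simp
  qed
qed

lemma red_brauer_character:
  assumes \<rho>: "matrix_rep G n \<rho>" and g: "g \<in> Greg"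
  shows "algebraic_int (brauer_character_of G p red \<rho> g)"
    "red (brauer_character_of G p red \<rho> g) = mtrace (\<rho> g)"
proof -
  obtain as where as: "\<And>a. a \<in> set as \<Longrightarrow> a ^ ord g = 1"
    "brauer_character_of G p red \<rho> g = (\<Sum>a\<leftarrow>as. lift_root p red a)" "mtrace (\<rho> g) = (\<Sum>a\<leftarrow>as. a)"
    using brauer_character_eigenvalues[OF assms] by metis
  have "\<not> p dvd ord g" using g by (simp add: p_regular_elements_def)
  then have l: "algebraic_int (lift_root p red a)" "red (lift_root p red a) = a" if "a \<in> set as" for a
    using lift_root[OF as(1)[OF that]] p'_root_algebraic_int by auto
  then have "algebraic_int (\<Sum>a\<leftarrow>as. lift_root p red a) \<and>
    red (\<Sum>a\<leftarrow>as. lift_root p red a) = (\<Sum>a\<leftarrow>as. a)"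
    by (induction as) (auto simp: algebraic_int_add red_add)
  then show "algebraic_int (brauer_character_of G p red \<rho> g)"
    "red (brauer_character_of G p red \<rho> g) = mtrace (\<rho> g)" using as by auto
qed

lemma brauer_character_cong:
  assumes "matrix_rep G n \<rho>" "matrix_rep G m \<sigma>" "\<And>g. g \<in> Greg \<Longrightarrow> char_poly (\<rho> g) = char_poly (\<sigma> g)"
  shows "brauer_character_of G p red \<rho> = brauer_character_of G p red \<sigma>"
proof
  fix g
  show "brauer_character_of G p red \<rho> g = brauer_character_of G p red \<sigma> g"
  proof (cases "g \<in> Greg")
    case True
    then show ?thesis using assms by (simp add: brauer_character_root_sum)
  next
    case False
    then show ?thesis by (simp add: brauer_character_of_def)
  qed
qed

text \<open>Stated for finite subsets because finiteness of \<open>IBr\<close> is itself derived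
  from this independence. Distinct Brauer characters come from representations whose characteristic
  polynomials differ somewhere, as independence of traces requires.\<close>

lemma IBr_reduction_independent:
  assumes \<Phi>: "finite \<Phi>" "\<Phi> \<subseteq> IBr G p red"
    and rel: "\<And>g. g \<in> Greg \<Longrightarrow> (\<Sum>\<phi>\<in>\<Phi>. c \<phi> * red (\<phi> g)) = 0"
    and \<phi>: "\<phi> \<in> \<Phi>"
  shows "c \<phi> = 0"
proof -
  have "\<forall>\<phi>. \<exists>d \<sigma>. \<phi> \<in> \<Phi> \<longrightarrow> irreducible_rep G d \<sigma> \<and> \<phi> = brauer_character_of G p red \<sigma>"
    using \<Phi> unfolding IBr_def by blast
  then obtain d \<sigma> where \<sigma>: "\<And>\<phi>. \<phi> \<in> \<Phi> \<Longrightarrow> irreducible_rep G (d \<phi>) (\<sigma> \<phi>)"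
    "\<And>\<phi>. \<phi> \<in> \<Phi> \<Longrightarrow> \<phi> = brauer_character_of G p red (\<sigma> \<phi>)" by metis
  have rep: "matrix_rep G (d \<phi>) (\<sigma> \<phi>)" if "\<phi> \<in> \<Phi>" for \<phi>
    using \<sigma>(1)[OF that] by (simp add: irreducible_rep_def)
  show ?thesis
  proof (rule irreducible_traces_independent_regular[OF \<Phi>(1) \<sigma>(1) _ _ \<phi>])
    fix \<phi> \<psi> assume *: "\<phi> \<in> \<Phi>" "\<psi> \<in> \<Phi>" "\<phi> \<noteq> \<psi>"
    show "\<exists>g\<in>carrier G. char_poly (\<sigma> \<phi> g) \<noteq> char_poly (\<sigma> \<psi> g)"
    proof (rule ccontr)
      assume "\<not> ?thesis"
      then have "brauer_character_of G p red (\<sigma> \<phi>) = brauer_character_of G p red (\<sigma> \<psi>)"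
        using * Greg_carrier by (intro brauer_character_cong[OF rep rep]) auto
      then show False using \<sigma>(2)[OF *(1)] \<sigma>(2)[OF *(2)] *(3) by simp
    qed
  next
    fix g assume g: "g \<in> Greg"
    have "(\<Sum>\<phi>\<in>\<Phi>. c \<phi> * mtrace (\<sigma> \<phi> g)) = (\<Sum>\<phi>\<in>\<Phi>. c \<phi> * red (\<phi> g))"
    proof (rule sum.cong[OF refl])
      fix \<phi> assume \<phi>: "\<phi> \<in> \<Phi>"
      have "red (brauer_character_of G p red (\<sigma> \<phi>) g) = mtrace (\<sigma> \<phi> g)"
        by (rule red_brauer_character(2)[OF rep[OF \<phi>] g])
      then show "c \<phi> * mtrace (\<sigma> \<phi> g) = c \<phi> * red (\<phi> g)" using \<sigma>(2)[OF \<phi>] by simp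
    qed
    then show "(\<Sum>\<phi>\<in>\<Phi>. c \<phi> * mtrace (\<sigma> \<phi> g)) = 0" using rel[OF g] by simp
  qed
qed

end

subsection \<open>Induced representations\<close>

context group
begin

text \<open>In the proof \<open>c x\<close> is the left coset of \<open>x\<close>. The
  representatives are numbered because they index rows and columns of matrices.\<close>

lemma left_transversal:
  assumes H: "subgroup H G" and fin: "finite (carrier G)"
  obtains m :: nat and t where "\<And>i. i < m \<Longrightarrow> t i \<in> carrier G"
    "\<And>x. x \<in> carrier G \<Longrightarrow> \<exists>!i. i < m \<and> inv (t i) \<otimes> x \<in> H"
proof -
  define c where "c x = {y \<in> carrier G. inv y \<otimes> x \<in> H}" for x
  have sub: "H \<subseteq> carrier G" using H by (rule subgroup.subset)
  have c_iff: "inv y \<otimes> x \<in> H \<longleftrightarrow> c y = c x" if xy: "x \<in> carrier G" "y \<in> carrier G" for x y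
  proof
    assume yx: "inv y \<otimes> x \<in> H"
    have "inv z \<otimes> y \<in> H \<longleftrightarrow> inv z \<otimes> x \<in> H" if z: "z \<in> carrier G" for z
    proof
      assume "inv z \<otimes> y \<in> H"
      then have "(inv z \<otimes> y) \<otimes> (inv y \<otimes> x) \<in> H" using yx H by (rule_tac subgroup.m_closed)
      then show "inv z \<otimes> x \<in> H" using xy z by (simp add: m_assoc) (simp flip: m_assoc)
    next
      assume "inv z \<otimes> x \<in> H"
      then have "(inv z \<otimes> x) \<otimes> inv (inv y \<otimes> x) \<in> H"
        by (rule subgroup.m_closed[OF H _ subgroup.m_inv_closed[OF H yx]])
      then show "inv z \<otimes> y \<in> H" using xy z by (simp add: inv_mult_group m_assoc) (simp flip: m_assoc)
    qed
    then show "c y = c x" by (auto simp: c_def)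
  next
    assume "c y = c x"
    moreover have "y \<in> c y" using xy H by (simp add: c_def subgroup.one_closed)
    ultimately show "inv y \<otimes> x \<in> H" by (auto simp: c_def)
  qed
  obtain b :: "nat \<Rightarrow> 'a set" and m :: nat where b: "bij_betw b {0..<m} (c ` carrier G)"
    using ex_bij_betw_nat_finite[of "c ` carrier G"] fin by blast
  define t where "t i = (SOME y. y \<in> carrier G \<and> c y = b i)" for i
  have t: "t i \<in> carrier G \<and> c (t i) = b i" if "i < m" for i
    unfolding t_def
  proof (rule someI_ex)
    have "b i \<in> c ` carrier G" using bij_betwE[OF b] that by simp
    then show "\<exists>y. y \<in> carrier G \<and> c y = b i" by auto
  qed
  show ?thesis
  proof (rule that[of m t])
    show "t i \<in> carrier G" if "i < m" for i using t that by simp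
    fix x assume x: "x \<in> carrier G"
    then have "c x \<in> b ` {0..<m}" using b by (auto simp: bij_betw_def)
    then obtain i where i: "i < m" "c x = b i" by auto
    show "\<exists>!i. i < m \<and> inv (t i) \<otimes> x \<in> H"
    proof (rule ex1I[of _ i])
      show "i < m \<and> inv (t i) \<otimes> x \<in> H" using i t c_iff x by simp
      fix j assume "j < m \<and> inv (t j) \<otimes> x \<in> H"
      then have "j < m" "b j = b i" using t c_iff x i by auto
      then show "j = i" using b i by (auto simp: bij_betw_def dest: inj_onD)
    qed
  qed
qed

text \<open>\<open>K\<close> is a union of left cosets of \<open>H\<close>, each containing one
  representative. The count serves for the index of \<open>H\<close> in a centralizer and for the
  divisibility of \<open>card H\<close> by the order of a subgroup.\<close>

lemma card_transversal:
  assumes H: "subgroup H G" "finite H"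
    and t: "\<And>i. i < m \<Longrightarrow> t i \<in> carrier G"
      "\<And>x. x \<in> carrier G \<Longrightarrow> \<exists>!i. i < m \<and> inv (t i) \<otimes> x \<in> H"
    and K: "K \<subseteq> carrier G" "\<And>x h. x \<in> carrier G \<Longrightarrow> h \<in> H \<Longrightarrow> x \<otimes> h \<in> K \<longleftrightarrow> x \<in> K"
  shows "card K = card {i. i < (m :: nat) \<and> t i \<in> K} * card H"
proof -
  let ?I = "{i. i < m \<and> t i \<in> K}"
  have Hc: "h \<in> carrier G" if "h \<in> H" for h using subgroup.mem_carrier[OF H(1) that] .
  have "bij_betw (\<lambda>(i, h). t i \<otimes> h) (?I \<times> H) K"
    unfolding bij_betw_def
  proof
    show "inj_on (\<lambda>(i, h). t i \<otimes> h) (?I \<times> H)"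
    proof (rule inj_onI, clarify)
      fix i h j k assume *: "i < m" "t i \<in> K" "h \<in> H" "j < m" "t j \<in> K" "k \<in> H" "t i \<otimes> h = t j \<otimes> k"
      have e1: "inv (t i) \<otimes> (t i \<otimes> h) = h" using *(1,3) t(1) Hc by (simp flip: m_assoc)
      have e2: "inv (t j) \<otimes> (t i \<otimes> h) = k" unfolding *(7) using *(4,6) t(1) Hc by (simp flip: m_assoc)
      have "i = j" using t(2)[of "t i \<otimes> h"] * t(1) Hc e1 e2 by (metis m_closed)
      then show "i = j \<and> h = k" using e1 e2 by simp
    qed
    show "(\<lambda>(i, h). t i \<otimes> h) ` (?I \<times> H) = K"
    proof (intro equalityI subsetI)
      fix x assume "x \<in> (\<lambda>(i, h). t i \<otimes> h) ` (?I \<times> H)"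
      then show "x \<in> K" using K(2) t(1) by auto
    next
      fix x assume x: "x \<in> K"
      then have xc: "x \<in> carrier G" using K(1) by auto
      then obtain i where i: "i < m" "inv (t i) \<otimes> x \<in> H" using t(2) by blast
      have eq: "t i \<otimes> (inv (t i) \<otimes> x) = x" using t(1)[OF i(1)] xc by (simp flip: m_assoc)
      then have "t i \<in> K" using K(2)[OF t(1)[OF i(1)] i(2)] x by simp
      then show "x \<in> (\<lambda>(i, h). t i \<otimes> h) ` (?I \<times> H)"
        using i eq by (intro image_eqI[of _ _ "(i, inv (t i) \<otimes> x)"]) auto
    qed
  qed
  then have "card K = card (?I \<times> H)" by (simp add: bij_betw_same_card)
  then show ?thesis by (simp add: card_cartesian_product)
qed

text \<open>The monomial matrix of the representation induced from the linear character
  \<open>l\<close> of \<open>H\<close>, in the basis given by the coset representatives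
  \<open>t\<close>.\<close>

definition induced_rep :: "'a set \<Rightarrow> ('a \<Rightarrow> 'k :: field) \<Rightarrow> nat \<Rightarrow> (nat \<Rightarrow> 'a) \<Rightarrow> 'a \<Rightarrow> 'k mat" where
  "induced_rep H l m t g = mat m m (\<lambda>(i, j).
     if inv (t i) \<otimes> g \<otimes> t j \<in> H then l (inv (t i) \<otimes> g \<otimes> t j) else 0)"

lemma matrix_rep_induced:
  fixes l :: "'a \<Rightarrow> 'k :: field"
  assumes H: "subgroup H G"
    and l: "\<And>x y. x \<in> H \<Longrightarrow> y \<in> H \<Longrightarrow> l (x \<otimes> y) = l x * l y" "l \<one> = 1"
    and t: "\<And>i. i < m \<Longrightarrow> t i \<in> carrier G"
      "\<And>x. x \<in> carrier G \<Longrightarrow> \<exists>!i. i < m \<and> inv (t i) \<otimes> x \<in> H"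
  shows "matrix_rep G m (induced_rep H l m t)"
  unfolding matrix_rep_def
proof (intro conjI ballI)
  show "induced_rep H l m t g \<in> carrier_mat m m" for g by (simp add: induced_rep_def)
  show "induced_rep H l m t \<one> = 1\<^sub>m m"
  proof (rule eq_matI)
    fix i j assume "i < dim_row (1\<^sub>m m :: 'k mat)" "j < dim_col (1\<^sub>m m :: 'k mat)"
    then have ij: "i < m" "j < m" by auto
    have "inv (t j) \<otimes> t j \<in> H" using ij t(1) H by (simp add: subgroup.one_closed)
    then have "inv (t i) \<otimes> t j \<in> H \<longleftrightarrow> i = j" using t(2)[OF t(1)[OF ij(2)]] ij by auto
    then show "induced_rep H l m t \<one> $$ (i, j) = 1\<^sub>m m $$ (i, j)"
      using ij t(1) l(2) by (auto simp: induced_rep_def)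
  qed (auto simp: induced_rep_def)
  fix g h assume gh: "g \<in> carrier G" "h \<in> carrier G"
  show "induced_rep H l m t (g \<otimes> h) = induced_rep H l m t g * induced_rep H l m t h"
  proof (rule eq_matI)
    fix i j assume "i < dim_row (induced_rep H l m t g * induced_rep H l m t h)"
      "j < dim_col (induced_rep H l m t g * induced_rep H l m t h)"
    then have ij: "i < m" "j < m" by (auto simp: induced_rep_def)
    let ?l = "\<lambda>x. if x \<in> H then l x else 0"
    \<comment> \<open>Column \<open>j\<close> of the matrix of \<open>h\<close> can be nonzero only
      in the row of the coset of \<open>h \<otimes> t j\<close>, so the sum in the matrix product
      has one term.\<close>
    obtain c where c: "c < m" "inv (t c) \<otimes> (h \<otimes> t j) \<in> H"
      and uniq: "\<And>d. d < m \<Longrightarrow> inv (t d) \<otimes> (h \<otimes> t j) \<in> H \<Longrightarrow> d = c"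
      using t(2)[of "h \<otimes> t j"] gh t(1)[OF ij(2)] by auto
    define x where "x = inv (t c) \<otimes> h \<otimes> t j"
    define y where "y = inv (t i) \<otimes> g \<otimes> t c"
    have tc: "t c \<in> carrier G" "t i \<in> carrier G" "t j \<in> carrier G" using t(1) c ij by auto
    have x: "x \<in> H" using c gh tc by (simp add: x_def m_assoc)
    have xc: "x \<in> carrier G" and yc: "y \<in> carrier G" using gh tc by (auto simp: x_def y_def)
    have "y \<otimes> x = inv (t i) \<otimes> g \<otimes> ((t c \<otimes> inv (t c)) \<otimes> (h \<otimes> t j))"
      unfolding x_def y_def using gh tc by (simp only: m_assoc m_closed inv_closed)
    then have yx: "inv (t i) \<otimes> (g \<otimes> h) \<otimes> t j = y \<otimes> x" using gh tc by (simp add: m_assoc)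
    have "y \<otimes> x \<in> H \<longleftrightarrow> y \<in> H"
    proof
      assume "y \<otimes> x \<in> H"
      then have "y \<otimes> x \<otimes> inv x \<in> H" by (rule subgroup.m_closed[OF H _ subgroup.m_inv_closed[OF H x]])
      then show "y \<in> H" using xc yc by (simp add: m_assoc)
    qed (use x H in \<open>auto intro: subgroup.m_closed\<close>)
    then have "?l (y \<otimes> x) = ?l y * ?l x" using x l(1) by auto
    moreover have "(\<Sum>d = 0..<m. ?l (inv (t i) \<otimes> g \<otimes> t d) * ?l (inv (t d) \<otimes> h \<otimes> t j)) = ?l y * ?l x"
    proof -
      have "?l (inv (t d) \<otimes> h \<otimes> t j) = 0" if "d < m" "d \<noteq> c" for d
        using uniq[OF that(1)] that gh tc t(1)[OF that(1)] by (auto simp: m_assoc)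
      then have "(\<Sum>d = 0..<m. ?l (inv (t i) \<otimes> g \<otimes> t d) * ?l (inv (t d) \<otimes> h \<otimes> t j)) =
          (\<Sum>d\<in>{c}. ?l (inv (t i) \<otimes> g \<otimes> t d) * ?l (inv (t d) \<otimes> h \<otimes> t j))"
        using c by (intro sum.mono_neutral_right) auto
      then show ?thesis by (simp add: x_def y_def)
    qed
    moreover have "induced_rep H l m t (g \<otimes> h) $$ (i, j) = ?l (y \<otimes> x)"
      using ij yx by (simp add: induced_rep_def)
    moreover have "(induced_rep H l m t g * induced_rep H l m t h) $$ (i, j) =
        (\<Sum>d = 0..<m. ?l (inv (t i) \<otimes> g \<otimes> t d) * ?l (inv (t d) \<otimes> h \<otimes> t j))"
      using ij by (simp add: induced_rep_def scalar_prod_def)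
    ultimately show "induced_rep H l m t (g \<otimes> h) $$ (i, j) =
        (induced_rep H l m t g * induced_rep H l m t h) $$ (i, j)" by (simp only:)
  qed (auto simp: induced_rep_def)
qed

lemma mtrace_induced:
  "mtrace (induced_rep H l m t g) =
     (\<Sum>i<m. if inv (t i) \<otimes> g \<otimes> t i \<in> H then l (inv (t i) \<otimes> g \<otimes> t i) else 0)"
  by (simp add: mtrace_def induced_rep_def)

lemma nat_pow_eq_cong:
  "x \<in> carrier G \<Longrightarrow> x [^] (i :: nat) = x [^] (j :: nat) \<longleftrightarrow> [i = j] (mod ord x)"
  using int_pow_eq[of x "int i" "int j"]
  by (simp add: int_pow_int cong_int_iff[symmetric] cong_iff_dvd_diff dvd_diff_commute)

lemma conj_eq_iff:
  "x \<in> carrier G \<Longrightarrow> y \<in> carrier G \<Longrightarrow> z \<in> carrier G \<Longrightarrow> inv y \<otimes> x \<otimes> y = z \<longleftrightarrow> x = y \<otimes> z \<otimes> inv y"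
  by (metis inv_solve_left inv_solve_right m_assoc m_closed inv_closed)

end

subsection \<open>Traces span the class functions on p-regular elements\<close>

context modular_group
begin

text \<open>Induce the linear characters of \<open>\<langle>g\<rangle> \<times> P\<close>, where \<open>P\<close> is a Sylow \<open>p\<close>-subgroup of the
  centralizer of \<open>g\<close>. Combining them by Fourier inversion on \<open>\<langle>g\<rangle>\<close> gives a function on the
  p-regular elements that is supported on the class of \<open>g\<close>, and its value there is nonzero in
  characteristic \<open>p\<close> because the index in the centralizer is prime to \<open>p\<close>.\<close>

lemma class_indicator_in_trace_span:
  assumes g: "g \<in> Greg"
  obtains Z :: "'k set" and c \<rho> m \<kappa> where "finite Z" "\<And>z. z \<in> Z \<Longrightarrow> matrix_rep G m (\<rho> z :: 'a \<Rightarrow> 'k mat)"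
    "\<kappa> \<noteq> 0"
    "\<And>x. x \<in> Greg \<Longrightarrow> (\<Sum>z\<in>Z. c z * mtrace (\<rho> z x)) =
       (if \<exists>y\<in>carrier G. x = y \<otimes> g \<otimes> inv y then \<kappa> else 0)"
proof -
  have gc: "g \<in> carrier G" using g Greg_carrier by simp
  define n where "n = ord g"
  have pn: "\<not> p dvd n" using g by (simp add: n_def p_regular_elements_def)
  have n0: "n > 0" using ord_ge_1[OF finite_carrier gc] by (simp add: n_def)
  define C where "C = {x \<in> carrier G. x \<otimes> g = g \<otimes> x}"
  have C: "subgroup C G"
  proof (rule subgroupI)
    show "C \<noteq> {}" using gc by (auto simp: C_def)
    fix x assume x: "x \<in> C"
    then have xc: "x \<in> carrier G" "x \<otimes> g = g \<otimes> x" by (auto simp: C_def)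
    have "g \<otimes> inv x = inv x \<otimes> (x \<otimes> g) \<otimes> inv x" using xc(1) gc by (simp flip: m_assoc)
    also have "\<dots> = inv x \<otimes> g" unfolding xc(2) using xc(1) gc by (simp add: m_assoc)
    finally have "inv x \<otimes> g = g \<otimes> inv x" ..
    then show "inv x \<in> C" using xc by (simp add: C_def)
    fix y assume y: "y \<in> C"
    then have yc: "y \<in> carrier G" "y \<otimes> g = g \<otimes> y" by (auto simp: C_def)
    have "x \<otimes> y \<otimes> g = x \<otimes> g \<otimes> y" using xc(1) yc gc by (simp add: m_assoc)
    also have "\<dots> = g \<otimes> (x \<otimes> y)" unfolding xc(2) using xc(1) yc(1) gc by (simp add: m_assoc)
    finally show "x \<otimes> y \<in> C" using xc yc by (simp add: C_def)
  qed (auto simp: C_def)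
  have finC: "finite C" using finite_carrier by (auto simp: C_def)
  have "card C \<noteq> 0" using finC subgroup.one_closed[OF C] by auto
  then obtain a m' where am: "card C = p ^ a * m'" "\<not> p dvd m'"
    using multiplicity_decompose'[of "card C" p] prime_p by (metis not_prime_unit)
  have "\<exists>P. subgroup P (G\<lparr>carrier := C\<rparr>) \<and> card P = p ^ a"
    using am finC subgroup.subgroup_is_group[OF C is_group] prime_p
    by (intro sylow_thm[of p _ a m']) (auto simp: Coset.order_def)
  then obtain P where P': "subgroup P (G\<lparr>carrier := C\<rparr>)" and cardP: "card P = p ^ a" by blast
  have P: "subgroup P G" using incl_subgroup[OF C P'] .
  have PC: "P \<subseteq> C" using subgroup.subset[OF P'] by simp
  have Pc: "u \<in> carrier G" "u \<otimes> g = g \<otimes> u" if "u \<in> P" for u using PC that by (auto simp: C_def)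
  define q where "q = p ^ a"
  have q0: "q > 0" using prime_p by (simp add: q_def prime_gt_0_nat)
  have cop: "coprime n q"
    using prime_imp_coprime[OF prime_p pn] by (simp add: q_def coprime_commute)
  have Pq: "u [^] q = \<one>" if "u \<in> P" for u
  proof -
    interpret P: group "G\<lparr>carrier := P\<rparr>" using subgroup.subgroup_is_group[OF P is_group] .
    have "u [^]\<^bsub>G\<lparr>carrier := P\<rparr>\<^esub> q = \<one>"
      using P.pow_order_eq_1[of u] that cardP by (simp add: Coset.order_def q_def)
    then show ?thesis by (simp add: nat_pow_consistent[symmetric])
  qed
  have comm: "g [^] (j :: nat) \<otimes> u = u \<otimes> g [^] j" if "u \<in> P" for j u
    using group_commutes_pow[of g u j] Pc[OF that] gc by simp
  \<comment> \<open>Raising to the power \<open>q\<close> removes the factor from \<open>P\<close>.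
    As \<open>q\<close> is invertible modulo \<open>n\<close>, the exponent of \<open>g\<close> can
    be recovered modulo \<open>n\<close>.\<close>
  have pow_q: "(g [^] (j :: nat) \<otimes> u) [^] q = g [^] (j * q)" if "u \<in> P" for j u
    using pow_mult_distrib[OF comm[OF that]] Pc(1)[OF that] gc Pq[OF that] by (simp add: nat_pow_pow)
  have uniq: "[i = j] (mod n)" if "g [^] (i :: nat) \<otimes> u = g [^] (j :: nat) \<otimes> v" "u \<in> P" "v \<in> P" for i j u v
  proof -
    have "g [^] (i * q) = g [^] (j * q)" using pow_q[OF that(2), of i] pow_q[OF that(3), of j] that(1) by simp
    then have "[i * q = j * q] (mod n)" using nat_pow_eq_cong[OF gc] by (simp add: n_def)
    then show ?thesis using cop by (simp add: cong_mult_rcancel_nat coprime_commute)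
  qed
  define H where "H = {g [^] (j :: nat) \<otimes> u | j u. u \<in> P}"
  have HI: "g [^] (j :: nat) \<otimes> u \<in> H" if "u \<in> P" for j u using that by (auto simp: H_def)
  have mult: "(g [^] i \<otimes> u) \<otimes> (g [^] j \<otimes> v) = g [^] (i + j) \<otimes> (u \<otimes> v)"
    if uv: "u \<in> P" "v \<in> P" for i j :: nat and u v
  proof -
    have "(g [^] i \<otimes> u) \<otimes> (g [^] j \<otimes> v) = g [^] i \<otimes> (u \<otimes> g [^] j) \<otimes> v"
      using gc Pc(1) uv by (simp add: m_assoc)
    also have "\<dots> = g [^] i \<otimes> (g [^] j \<otimes> u) \<otimes> v" using comm[OF uv(1), of j] by simp
    also have "\<dots> = g [^] i \<otimes> g [^] j \<otimes> (u \<otimes> v)" using gc Pc(1) uv by (simp add: m_assoc)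
    finally show ?thesis using gc by (simp add: nat_pow_mult)
  qed
  have one_P: "\<one> \<in> P" using subgroup.one_closed[OF P] .
  have H: "subgroup H G"
  proof (rule subgroupI)
    show "H \<subseteq> carrier G" using gc Pc by (auto simp: H_def)
    show "H \<noteq> {}" using HI[OF one_P] by auto
    fix x assume "x \<in> H"
    then obtain i u where x: "x = g [^] (i :: nat) \<otimes> u" "u \<in> P" by (auto simp: H_def)
    have iu: "inv u \<in> P" using subgroup.m_inv_closed[OF P x(2)] .
    \<comment> \<open>The factor \<open>n - 1\<close> stands for \<open>-1\<close> modulo
      \<open>n\<close>, so that all exponents remain natural numbers.\<close>
    have "(g [^] ((n - 1) * i) \<otimes> inv u) \<otimes> x = g [^] ((n - 1) * i + i) \<otimes> (inv u \<otimes> u)"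
      unfolding x(1) by (rule mult[OF iu x(2)])
    also have "(n - 1) * i + i = n * i" using n0 by (cases n) auto
    also have "g [^] (n * i) = \<one>" using gc by (simp add: pow_eq_id n_def)
    finally have "inv x = g [^] ((n - 1) * i) \<otimes> inv u"
      using x gc Pc(1) by (intro inv_equality) auto
    then show "inv x \<in> H" using HI[OF iu] by simp
    fix y assume "y \<in> H"
    then obtain j v where "y = g [^] (j :: nat) \<otimes> v" "v \<in> P" by (auto simp: H_def)
    then show "x \<otimes> y \<in> H" using x mult HI subgroup.m_closed[OF P] by simp
  qed
  have finH: "finite H" using subgroup.subset[OF H] finite_carrier by (rule finite_subset)
  have HC: "H \<subseteq> C"
  proof
    fix x assume "x \<in> H"
    then obtain i u where x: "x = g [^] (i :: nat) \<otimes> u" "u \<in> P" by (auto simp: H_def)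
    have "g [^] i \<in> C"
      using gc by (auto simp: C_def group_commutes_pow)
    then show "x \<in> C" using x PC subgroup.m_closed[OF C] by auto
  qed
  \<comment> \<open>The chosen exponent \<open>e x\<close> is determined only modulo
    \<open>n\<close>, which suffices when it is applied to an \<open>n\<close>-th root of
    unity.\<close>
  define e where "e x = (SOME j :: nat. \<exists>u\<in>P. x = g [^] j \<otimes> u)" for x
  have e: "\<exists>u\<in>P. x = g [^] e x \<otimes> u" if "x \<in> H" for x
  proof -
    have "\<exists>j :: nat. \<exists>u\<in>P. x = g [^] j \<otimes> u" using that by (auto simp: H_def)
    then show ?thesis unfolding e_def by (rule someI_ex)
  qed
  have e_cong: "[e (g [^] j \<otimes> u) = j] (mod n)" if "u \<in> P" for j :: nat and u
    using e[OF HI[OF that]] uniq that by metis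
  define l where "l z x = z ^ e x" for z :: 'k and x
  have root_cong: "z ^ i = z ^ j" if "z ^ n = 1" "[i = j] (mod n)" for z :: 'k and i j
    using unity_root_power_mod[OF that(1)] that(2) by (metis cong_def)
  have l_mult: "l z (x \<otimes> y) = l z x * l z y" if z: "z ^ n = 1" and xy: "x \<in> H" "y \<in> H" for z x y
  proof -
    obtain u v where u: "u \<in> P" "x = g [^] e x \<otimes> u" and v: "v \<in> P" "y = g [^] e y \<otimes> v"
      using e xy by metis
    have "x \<otimes> y = g [^] (e x + e y) \<otimes> (u \<otimes> v)" using mult[OF u(1) v(1), of "e x" "e y"] u v by simp
    then have "[e (x \<otimes> y) = e x + e y] (mod n)"
      using e_cong[OF subgroup.m_closed[OF P u(1) v(1)]] by simp
    then show ?thesis using root_cong[OF z] by (simp add: l_def power_add)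
  qed
  have l_one: "l z \<one> = 1" if z: "z ^ n = 1" for z
    using root_cong[OF z e_cong[OF one_P, of 0]] by (simp add: l_def)
  obtain m :: nat and t where t: "\<And>i. i < m \<Longrightarrow> t i \<in> carrier G"
    "\<And>x. x \<in> carrier G \<Longrightarrow> \<exists>!i. i < m \<and> inv (t i) \<otimes> x \<in> H"
    using left_transversal[OF H finite_carrier] by blast
  define Z where "Z = {z :: 'k. z ^ n = 1}"
  define \<rho> where "\<rho> z = induced_rep H (l z) m t" for z
  have rep: "matrix_rep G m (\<rho> z)" if "z \<in> Z" for z
    unfolding \<rho>_def using that by (intro matrix_rep_induced H l_mult l_one t) (auto simp: Z_def)
  have finZ: "finite Z"
    using red_image_roots(2)[OF pn] n0 unfolding Z_def by (metis card.infinite less_numeral_extra(3))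
  define N where "N x = card {i. i < m \<and> inv (t i) \<otimes> x \<otimes> t i = g}" for x
  \<comment> \<open>The weight \<open>z ^ (n - 1)\<close> is the inverse of \<open>z\<close>, so
    Fourier inversion selects the elements of \<open>H\<close> with exponent \<open>1\<close>, which
    are the \<open>g \<otimes> u\<close>. If such an element is p-regular, the order of
    \<open>u\<close> divides both \<open>n * r\<close> and \<open>q\<close>, and \<open>u\<close> is
    trivial.\<close>
  have key: "x \<in> H \<and> n dvd n - 1 + e x \<longleftrightarrow> x = g" if xc: "x \<in> carrier G" and xr: "x [^] r = \<one>" "\<not> p dvd r" for x and r :: nat
  proof
    assume x: "x \<in> H \<and> n dvd n - 1 + e x"
    then obtain u where u: "u \<in> P" "x = g [^] e x \<otimes> u" using e by blast
    have "n dvd n - 1 + e x" using x by simp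
    then have "[n - 1 + e x = n - 1 + 1] (mod n)" using n0 by (simp add: cong_def dvd_eq_mod_eq_0)
    then have "[e x = 1] (mod n)" by (simp only: cong_add_lcancel_nat)
    then have "g [^] e x = g [^] (1 :: nat)" unfolding nat_pow_eq_cong[OF gc] n_def .
    then have xg: "x = g \<otimes> u" using u gc by simp
    have "x [^] (n * r) = g [^] (n * r) \<otimes> u [^] (n * r)"
      unfolding xg using Pc[OF u(1)] gc by (intro pow_mult_distrib) auto
    moreover have "x [^] (n * r) = \<one>"
      using xr xc by (metis mult.commute nat_pow_one nat_pow_pow)
    moreover have "g [^] (n * r) = \<one>" using gc by (simp add: pow_eq_id n_def)
    ultimately have "u [^] (n * r) = \<one>" using Pc[OF u(1)] by simp
    then have "ord u dvd n * r" "ord u dvd q" using Pq[OF u(1)] Pc[OF u(1)] by (simp_all add: pow_eq_id)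
    moreover have "coprime (n * r) q"
      using cop prime_imp_coprime[OF prime_p xr(2)] by (simp add: q_def coprime_commute)
    ultimately have "ord u = 1" using coprime_common_divisor_nat by blast
    then have "u = \<one>" using ord_eq_1[OF Pc(1)[OF u(1)]] by blast
    then show "x = g" using xg gc by simp
  next
    assume "x = g"
    then have x: "x = g [^] (1 :: nat) \<otimes> \<one>" using gc by simp
    have "[e x = 1] (mod n)" using e_cong[OF one_P, of 1] x by simp
    then have "[n - 1 + e x = n - 1 + 1] (mod n)" by (simp only: cong_add_lcancel_nat)
    then have "n dvd n - 1 + e x" using n0 by (simp add: cong_def dvd_eq_mod_eq_0)
    then show "x \<in> H \<and> n dvd n - 1 + e x" using HI[OF one_P, of 1] x by simp
  qed
  have sum: "(\<Sum>z\<in>Z. z ^ (n - 1) * mtrace (\<rho> z x)) = of_nat (n * N x)" if x: "x \<in> Greg" for x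
  proof -
    have xc: "x \<in> carrier G" using x Greg_carrier by simp
    let ?w = "\<lambda>i. inv (t i) \<otimes> x \<otimes> t i"
    have w: "?w i \<in> H \<and> n dvd n - 1 + e (?w i) \<longleftrightarrow> ?w i = g" if i: "i < m" for i
    proof (rule key)
      show "?w i \<in> carrier G" using xc t(1)[OF i] by simp
      show "?w i [^] ord x = \<one>" using conj_nat_pow[OF xc t(1)[OF i]] xc t(1)[OF i] by simp
      show "\<not> p dvd ord x" using x by (simp add: p_regular_elements_def)
    qed
    have "(\<Sum>z\<in>Z. z ^ (n - 1) * mtrace (\<rho> z x)) =
        (\<Sum>z\<in>Z. \<Sum>i<m. if ?w i \<in> H then z ^ (n - 1 + e (?w i)) else 0)"
      unfolding \<rho>_def mtrace_induced l_def sum_distrib_left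
      by (intro sum.cong) (auto simp: power_add)
    also have "\<dots> = (\<Sum>i<m. \<Sum>z\<in>Z. if ?w i \<in> H then z ^ (n - 1 + e (?w i)) else 0)"
      by (rule sum.swap)
    also have "\<dots> = (\<Sum>i<m. if ?w i = g then of_nat n else 0)"
    proof (rule sum.cong[OF refl])
      fix i assume "i \<in> {..<m}"
      then have i: "i < m" by simp
      show "(\<Sum>z\<in>Z. if ?w i \<in> H then z ^ (n - 1 + e (?w i)) else 0) = (if ?w i = g then of_nat n else 0)"
        using sum_roots_of_unity_powi[OF pn, of "n - 1 + e (?w i)"] w[OF i]
        by (cases "?w i \<in> H") (auto simp: Z_def)
    qed
    also have "\<dots> = (\<Sum>i\<in>{i. i < m \<and> ?w i = g}. of_nat n)"
      by (subst sum.inter_filter[symmetric]) (auto intro!: sum.cong)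
    also have "\<dots> = of_nat (n * N x)" by (simp add: N_def mult.commute)
    finally show ?thesis .
  qed
  \<comment> \<open>The representatives counted by \<open>N g\<close> are those that centralize
    \<open>g\<close>, so \<open>N g\<close> is the index of \<open>H\<close> in
    \<open>C\<close>.\<close>
  have Ng: "card C = N g * card H"
  proof -
    have "card C = card {i. i < m \<and> t i \<in> C} * card H"
    proof (rule card_transversal[OF H finH t])
      show "C \<subseteq> carrier G" by (auto simp: C_def)
      fix x h assume x: "x \<in> carrier G" and h: "h \<in> H"
      then have hC: "h \<in> C" using HC by auto
      then have hc: "h \<in> carrier G" by (auto simp: C_def)
      show "x \<otimes> h \<in> C \<longleftrightarrow> x \<in> C"
      proof
        assume "x \<otimes> h \<in> C"
        then have "x \<otimes> h \<otimes> inv h \<in> C" by (rule subgroup.m_closed[OF C _ subgroup.m_inv_closed[OF C hC]])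
        then show "x \<in> C" using x hc by (simp add: m_assoc)
      qed (use hC C in \<open>auto intro: subgroup.m_closed\<close>)
    qed auto
    moreover have "{i. i < m \<and> t i \<in> C} = {i. i < m \<and> inv (t i) \<otimes> g \<otimes> t i = g}"
    proof (rule Collect_cong, rule conj_cong[OF refl])
      fix i assume "i < m"
      then have "t i \<in> carrier G" by (rule t(1))
      then show "t i \<in> C \<longleftrightarrow> inv (t i) \<otimes> g \<otimes> t i = g"
        using gc by (auto simp: C_def m_assoc) (metis inv_solve_left m_closed)+
    qed
    ultimately show ?thesis by (simp add: N_def)
  qed
  \<comment> \<open>As \<open>H\<close> contains \<open>P\<close>, it absorbs the full power of
    \<open>p\<close> in \<open>card C\<close>. What is left for the index \<open>N g\<close> is a
    divisor of \<open>m'\<close>.\<close>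
  have "p ^ a dvd card H"
  proof -
    obtain m'' :: nat and s where s: "\<And>i. i < m'' \<Longrightarrow> s i \<in> carrier G"
      "\<And>x. x \<in> carrier G \<Longrightarrow> \<exists>!i. i < m'' \<and> inv (s i) \<otimes> x \<in> P"
      using left_transversal[OF P finite_carrier] by blast
    have PH: "P \<subseteq> H"
    proof
      fix u assume u: "u \<in> P"
      show "u \<in> H" using HI[OF u, of 0] Pc[OF u] by simp
    qed
    have "card H = card {i. i < m'' \<and> s i \<in> H} * card P"
    proof (rule card_transversal[OF P _ s])
      show "finite P" using PH finH finite_subset by blast
      show "H \<subseteq> carrier G" using subgroup.subset[OF H] .
      fix x h assume x: "x \<in> carrier G" and h: "h \<in> P"
      have hH: "h \<in> H" using h PH by auto
      show "x \<otimes> h \<in> H \<longleftrightarrow> x \<in> H"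
      proof
        assume "x \<otimes> h \<in> H"
        then have "x \<otimes> h \<otimes> inv h \<in> H" by (rule subgroup.m_closed[OF H _ subgroup.m_inv_closed[OF H hH]])
        then show "x \<in> H" using x Pc[OF h] by (simp add: m_assoc)
      qed (use hH H in \<open>auto intro: subgroup.m_closed\<close>)
    qed auto
    then show ?thesis using cardP by simp
  qed
  then obtain k where k: "card H = p ^ a * k" by auto
  have "q * m' = N g * (q * k)" using Ng unfolding am(1) k q_def .
  then have "m' = N g * k" using q0 by (simp add: mult.left_commute)
  then have "\<not> p dvd N g" using am(2) by auto
  then have nz: "of_nat (n * N g) \<noteq> (0 :: 'k)"
    unfolding of_nat_eq_0_iff_dvd using pn prime_p by (simp add: prime_dvd_mult_iff)
  show ?thesis
  proof (rule that[OF finZ rep nz])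
    fix x assume x: "x \<in> Greg"
    then have xc: "x \<in> carrier G" by (rule Greg_carrier)
    show "(\<Sum>z\<in>Z. z ^ (n - 1) * mtrace (\<rho> z x)) =
      (if \<exists>y\<in>carrier G. x = y \<otimes> g \<otimes> inv y then of_nat (n * N g) else 0)"
    proof (cases "\<exists>y\<in>carrier G. x = y \<otimes> g \<otimes> inv y")
      case True
      then obtain y where y: "y \<in> carrier G" "x = y \<otimes> g \<otimes> inv y" by blast
      have "mtrace (\<rho> z x) = mtrace (\<rho> z g)" if "z \<in> Z" for z
        unfolding y(2) by (rule matrix_rep_conjugate(2)[OF rep[OF that] y(1) gc])
      then have "(\<Sum>z\<in>Z. z ^ (n - 1) * mtrace (\<rho> z x)) = (\<Sum>z\<in>Z. z ^ (n - 1) * mtrace (\<rho> z g))"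
        by (intro sum.cong) auto
      then show ?thesis using sum[OF g] True by simp
    next
      case False
      have "inv (t i) \<otimes> x \<otimes> t i \<noteq> g" if "i < m" for i
        using False conj_eq_iff[OF xc t(1)[OF that] gc] t(1)[OF that] by blast
      then have "N x = 0" by (auto simp: N_def)
      then show ?thesis using sum[OF x] False by simp
    qed
  qed
qed

end

subsection \<open>The number of irreducible Brauer characters\<close>

context modular_group
begin

section \<open>p-regular classes, and Brauer characters as class functions\<close>

lemma conj_class_Greg: "g \<in> Greg \<Longrightarrow> conj_class g \<subseteq> Greg"
proof
  fix x assume g: "g \<in> Greg" and "x \<in> conj_class g"
  then obtain y where y: "y \<in> carrier G" "x = y \<otimes> g \<otimes> inv y" by (auto simp: conj_class_def)
  have gc: "g \<in> carrier G" using g Greg_carrier by simp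
  have "x [^] ord g = \<one>"
    using conj_nat_pow[OF gc inv_closed[OF y(1)], of "ord g"] y gc by simp
  then have "ord x dvd ord g" using y gc by (simp add: pow_eq_id)
  then show "x \<in> Greg" using y gc g by (auto simp: p_regular_elements_def dest: dvd_trans)
qed

lemma p_regular_classes_eq: "p_regular_classes G p = conj_class ` Greg"
proof
  show "p_regular_classes G p \<subseteq> conj_class ` Greg"
    using conj_class_self unfolding p_regular_classes_def conjugacy_classes_eq by blast
  show "conj_class ` Greg \<subseteq> p_regular_classes G p"
    using conj_class_Greg Greg_carrier unfolding p_regular_classes_def conjugacy_classes_eq by blast
qed

lemma partition_on_p_regular_classes: "partition_on Greg (p_regular_classes G p)"
proof (rule partition_onI)
  show "\<Union>(p_regular_classes G p) = Greg"
    unfolding p_regular_classes_eq using conj_class_Greg conj_class_self Greg_carrier by blast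
  show "{} \<notin> p_regular_classes G p"
  proof
    assume "{} \<in> p_regular_classes G p"
    then obtain g where "g \<in> Greg" "conj_class g = {}" unfolding p_regular_classes_eq by force
    then show False using conj_class_self[of g] Greg_carrier[of g] by simp
  qed
  fix A B assume AB: "A \<in> p_regular_classes G p" "B \<in> p_regular_classes G p" "A \<noteq> B"
  then obtain g h where gh: "g \<in> carrier G" "h \<in> carrier G" "A = conj_class g" "B = conj_class h"
    unfolding p_regular_classes_eq using Greg_carrier by blast
  show "disjnt A B"
    unfolding disjnt_iff using conj_class_eq[OF gh(1)] conj_class_eq[OF gh(2)] gh(3,4) AB(3) by blast
qed

lemma one_class: "{\<one>} \<in> p_regular_classes G p"
  unfolding p_regular_classes_eq using one_Greg conj_class_one by (metis image_eqI)

lemma finite_classes: "finite (p_regular_classes G p)"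
  unfolding p_regular_classes_eq using finite_Greg by simp

lemma IBr_E:
  assumes "\<phi> \<in> IBr G p red"
  obtains n \<sigma> where "irreducible_rep G n \<sigma>" "matrix_rep G n \<sigma>" "\<phi> = brauer_character_of G p red \<sigma>"
  using assms by (auto simp: IBr_def irreducible_rep_def)

lemma IBr_algebraic_int: "\<phi> \<in> IBr G p red \<Longrightarrow> g \<in> Greg \<Longrightarrow> algebraic_int (\<phi> g)"
  by (erule IBr_E) (simp add: red_brauer_character(1))

lemma IBr_class_function:
  assumes "\<phi> \<in> IBr G p red" "g \<in> Greg" "x \<in> conj_class g"
  shows "\<phi> x = \<phi> g"
proof -
  obtain n \<sigma> where \<sigma>: "matrix_rep G n \<sigma>" "\<phi> = brauer_character_of G p red \<sigma>"
    using assms(1) IBr_E by blast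
  obtain y where y: "y \<in> carrier G" "x = y \<otimes> g \<otimes> inv y" using assms(3) by (auto simp: conj_class_def)
  have "x \<in> Greg" using conj_class_Greg assms by blast
  then show ?thesis
    using matrix_rep_conjugate(1)[OF \<sigma>(1) y(1) Greg_carrier[OF assms(2)]] assms(2) y
    by (simp add: \<sigma>(2) brauer_character_root_sum[OF \<sigma>(1)])
qed

lemma brauer_character_decomposition:
  assumes \<rho>: "matrix_rep G n \<rho>"
  obtains L where "set L \<subseteq> IBr G p red"
    "\<And>g. g \<in> Greg \<Longrightarrow> brauer_character_of G p red \<rho> g = (\<Sum>\<phi>\<leftarrow>L. \<phi> g)"
proof -
  obtain L where L: "\<And>m \<sigma>. (m, \<sigma>) \<in> set L \<Longrightarrow> irreducible_rep G m \<sigma>"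
    "\<And>g. g \<in> carrier G \<Longrightarrow> char_poly (\<rho> g) = (\<Prod>(m, \<sigma>)\<leftarrow>L. char_poly (\<sigma> g))"
    using matrix_rep_irreducible_factors[OF \<rho>] by fast
  let ?L = "map (\<lambda>(m, \<sigma>). brauer_character_of G p red \<sigma>) L"
  show ?thesis
  proof (rule that[of ?L])
    show "set ?L \<subseteq> IBr G p red" using L(1) by (auto simp: IBr_def)
    fix g assume g: "g \<in> Greg"
    have rep: "matrix_rep G m \<sigma>" if "(m, \<sigma>) \<in> set L" for m \<sigma>
      using L(1)[OF that] by (simp add: irreducible_rep_def)
    have nz: "char_poly (\<sigma> g) \<noteq> 0" if "(m, \<sigma>) \<in> set L" for m \<sigma>
      using rep[OF that] Greg_carrier[OF g] char_poly_nonzero[of "\<sigma> g" m] by (auto simp: matrix_rep_def)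
    have "brauer_character_of G p red \<rho> g = root_sum (lift_root p red) (\<Prod>(m, \<sigma>)\<leftarrow>L. char_poly (\<sigma> g))"
      using brauer_character_root_sum[OF \<rho> g] L(2) Greg_carrier[OF g] by simp
    also have "\<dots> = (\<Sum>f\<leftarrow>map (\<lambda>(m, \<sigma>). char_poly (\<sigma> g)) L. root_sum (lift_root p red) f)"
      using nz by (intro root_sum_prod_list) auto
    also have "\<dots> = (\<Sum>\<phi>\<leftarrow>?L. \<phi> g)"
      unfolding map_map
      by (intro arg_cong[of _ _ sum_list] map_cong) (auto simp: brauer_character_root_sum[OF rep g])
    finally show "brauer_character_of G p red \<rho> g = (\<Sum>\<phi>\<leftarrow>?L. \<phi> g)" .
  qed
qed

lemma mtrace_decomposition:
  assumes \<rho>: "matrix_rep G n \<rho>"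
  obtains L where "set L \<subseteq> IBr G p red"
    "\<And>g. g \<in> Greg \<Longrightarrow> mtrace (\<rho> g) = (\<Sum>\<phi>\<leftarrow>L. red (\<phi> g))"
proof -
  obtain L where L: "set L \<subseteq> IBr G p red"
    "\<And>g. g \<in> Greg \<Longrightarrow> brauer_character_of G p red \<rho> g = (\<Sum>\<phi>\<leftarrow>L. \<phi> g)"
    using brauer_character_decomposition[OF \<rho>] by blast
  have "mtrace (\<rho> g) = (\<Sum>\<phi>\<leftarrow>L. red (\<phi> g))" if g: "g \<in> Greg" for g
  proof -
    have "algebraic_int (\<Sum>\<phi>\<leftarrow>L. \<phi> g) \<and> red (\<Sum>\<phi>\<leftarrow>L. \<phi> g) = (\<Sum>\<phi>\<leftarrow>L. red (\<phi> g))"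
      using L(1) by (induction L) (auto simp: algebraic_int_add red_add IBr_algebraic_int[OF _ g])
    then show ?thesis using red_brauer_character(2)[OF \<rho> g] L(2)[OF g] by simp
  qed
  then show ?thesis using that L(1) by blast
qed

text \<open>The reduced irreducible Brauer characters and the class indicators are both independent
  over the residue field, and each family lies in the span of the other. As there are finitely many
  indicators, the same comparison yields finiteness of \<open>IBr\<close>.\<close>

lemma finite_IBr_card: "finite (IBr G p red)" "card (IBr G p red) = card (p_regular_classes G p)"
proof -
  interpret V: vector_space "\<lambda>(c :: 'k) (f :: 'a \<Rightarrow> 'k) x. c * f x"
    by unfold_locales (auto simp: fun_eq_iff algebra_simps)
  have sum_eval: "(\<Sum>v\<in>S. (\<lambda>x. u v * f v x)) x = (\<Sum>v\<in>S. u v * f v x)"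
    for S :: "'i set" and u and f :: "'i \<Rightarrow> 'a \<Rightarrow> 'k" and x
    by (induction S rule: infinite_finite_induct) auto
  \<comment> \<open>Extension by \<open>0\<close> outside the p-regular elements makes agreement
    there the same as equality in the space of all functions.\<close>
  define rd where "rd \<phi> = (\<lambda>g. if g \<in> Greg then red (\<phi> g) else 0)" for \<phi> :: "'a \<Rightarrow> complex"
  define ind where "ind K = (\<lambda>x. if x \<in> K then 1 else (0 :: 'k))" for K :: "'a set"
  let ?I = "IBr G p red" and ?K = "p_regular_classes G p"
  have inj: "inj_on rd ?I"
  proof (rule inj_onI, rule ccontr)
    fix \<phi> \<psi> assume *: "\<phi> \<in> ?I" "\<psi> \<in> ?I" "rd \<phi> = rd \<psi>" "\<phi> \<noteq> \<psi>"
    have "(\<Sum>\<chi>\<in>{\<phi>, \<psi>}. (if \<chi> = \<phi> then 1 else - 1) * red (\<chi> g)) = 0" if "g \<in> Greg" for g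
      using fun_cong[OF *(3), of g] that *(4) by (simp add: rd_def)
    from IBr_reduction_independent[OF _ _ this, of \<phi>] * show False by auto
  qed
  have indep_T: "V.independent (rd ` ?I)"
    unfolding V.independent_explicit_finite_subsets
  proof (intro allI impI ballI)
    fix S u v assume S: "S \<subseteq> rd ` ?I" "finite S" and 0: "(\<Sum>v\<in>S. (\<lambda>x. u v * v x)) = 0" and v: "v \<in> S"
    obtain \<Phi> where \<Phi>: "\<Phi> \<subseteq> ?I" "S = rd ` \<Phi>" using S(1) by (meson subset_imageE)
    have inj\<Phi>: "inj_on rd \<Phi>" using inj \<Phi>(1) by (rule inj_on_subset)
    have fin: "finite \<Phi>" using S(2) \<Phi>(2) inj\<Phi> by (simp add: finite_image_iff)
    have "(\<Sum>\<phi>\<in>\<Phi>. u (rd \<phi>) * red (\<phi> g)) = 0" if "g \<in> Greg" for g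
    proof -
      have "0 = (\<Sum>v\<in>S. u v * v g)" using fun_cong[OF 0, of g] sum_eval[of u "\<lambda>v. v" S g] by simp
      also have "\<dots> = (\<Sum>\<phi>\<in>\<Phi>. u (rd \<phi>) * rd \<phi> g)" unfolding \<Phi>(2) using inj\<Phi> by (simp add: sum.reindex)
      finally show ?thesis using that by (simp add: rd_def)
    qed
    from IBr_reduction_independent[OF fin \<Phi>(1) this] v \<Phi>(2) show "u v = 0" by auto
  qed
  have ind_cl: "ind (conj_class g) h = (if conj_class h = conj_class g then 1 else 0)" if "h \<in> Greg" "g \<in> Greg" for g h
    using that conj_class_eq[of g h] conj_class_self[of h] Greg_carrier by (auto simp: ind_def)
  have inj_ind: "inj ind"
    by (rule injI) (auto simp: ind_def fun_eq_iff split: if_splits)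
  have indep_D: "V.independent (ind ` ?K)"
    unfolding V.independent_explicit_finite_subsets
  proof (intro allI impI ballI)
    fix S u v assume S: "S \<subseteq> ind ` ?K" "finite S" and 0: "(\<Sum>v\<in>S. (\<lambda>x. u v * v x)) = 0" and v: "v \<in> S"
    obtain h where h: "h \<in> Greg" "v = ind (conj_class h)" using S(1) v unfolding p_regular_classes_eq by blast
    have "0 = (\<Sum>w\<in>S. u w * w h)" using fun_cong[OF 0, of h] sum_eval[of u "\<lambda>v. v" S h] by simp
    also have "\<dots> = (\<Sum>w\<in>S. if w = v then u v else 0)"
    proof (rule sum.cong[OF refl])
      fix w assume "w \<in> S"
      then obtain g where g: "g \<in> Greg" "w = ind (conj_class g)" using S(1) unfolding p_regular_classes_eq by blast
      show "u w * w h = (if w = v then u v else 0)"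
        using ind_cl[OF h(1) g(1)] g(2) h(2) inj_ind by (auto dest: injD)
    qed
    also have "\<dots> = u v" using S(2) v by simp
    finally show "u v = 0" ..
  qed
  have finD: "finite (ind ` ?K)" using finite_classes by simp
  have T_span: "rd ` ?I \<subseteq> V.span (ind ` ?K)"
  proof
    fix f assume "f \<in> rd ` ?I"
    then obtain \<phi> where \<phi>: "\<phi> \<in> ?I" "f = rd \<phi>" by blast
    define r where "r K = red (\<phi> (SOME g. g \<in> K))" for K
    have r: "r (conj_class h) = red (\<phi> h)" if h: "h \<in> Greg" for h
    proof -
      have "(SOME g. g \<in> conj_class h) \<in> conj_class h" using conj_class_self[OF Greg_carrier[OF h]] by (rule someI)
      then show ?thesis unfolding r_def using IBr_class_function[OF \<phi>(1) h] by simp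
    qed
    have "f = (\<Sum>K\<in>?K. (\<lambda>x. r K * ind K x))"
    proof (rule ext)
      fix h
      show "f h = (\<Sum>K\<in>?K. (\<lambda>x. r K * ind K x)) h"
      proof (cases "h \<in> Greg")
        case True
        have "(\<Sum>K\<in>?K. r K * ind K h) = (\<Sum>K\<in>?K. if K = conj_class h then r (conj_class h) else 0)"
        proof (rule sum.cong[OF refl])
          fix K assume "K \<in> ?K"
          then obtain g where g: "g \<in> Greg" "K = conj_class g" unfolding p_regular_classes_eq by blast
          show "r K * ind K h = (if K = conj_class h then r (conj_class h) else 0)"
            unfolding g(2) ind_cl[OF True g(1)] by (cases "conj_class h = conj_class g") simp_all
        qed
        also have "\<dots> = r (conj_class h)" using finite_classes True by (simp add: p_regular_classes_eq)
        finally show ?thesis using \<phi>(2) r[OF True] True by (simp add: sum_eval rd_def)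
      next
        case False
        have "ind K h = 0" if "K \<in> ?K" for K
          using that False conj_class_Greg unfolding p_regular_classes_eq by (auto simp: ind_def)
        then show ?thesis using False \<phi>(2) by (simp add: sum_eval rd_def)
      qed
    qed
    also have "\<dots> \<in> V.span (ind ` ?K)"
      by (rule V.span_sum, rule V.span_scale, rule V.span_base) simp
    finally show "f \<in> V.span (ind ` ?K)" .
  qed
  have fin_card: "finite (rd ` ?I)" "card (rd ` ?I) \<le> card (ind ` ?K)"
    using V.independent_span_bound[OF finD indep_T T_span] by auto
  have trace_span: "(\<lambda>x. if x \<in> Greg then mtrace (\<rho> x) else 0) \<in> V.span (rd ` ?I)"
    if \<rho>: "matrix_rep G n \<rho>" for n \<rho>
  proof -
    obtain L where L: "set L \<subseteq> ?I" "\<And>g. g \<in> Greg \<Longrightarrow> mtrace (\<rho> g) = (\<Sum>\<phi>\<leftarrow>L. red (\<phi> g))"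
      using mtrace_decomposition[OF \<rho>] by blast
    have "(\<lambda>x. if x \<in> Greg then mtrace (\<rho> x) else 0) = (\<lambda>x. if x \<in> Greg then (\<Sum>\<phi>\<leftarrow>L. red (\<phi> x)) else 0)"
      using L(2) by auto
    also have "\<dots> \<in> V.span (rd ` ?I)"
      using L(1)
    proof (induction L)
      case Nil
      have "(\<lambda>x. if x \<in> Greg then (\<Sum>\<phi>\<leftarrow>[]. red (\<phi> x)) else 0) = (0 :: 'a \<Rightarrow> 'k)"
        by (simp add: fun_eq_iff)
      then show ?case by (simp only: V.span_zero)
    next
      case (Cons \<phi> L)
      have "(\<lambda>x. if x \<in> Greg then (\<Sum>\<phi>\<leftarrow>\<phi> # L. red (\<phi> x)) else 0) =
          rd \<phi> + (\<lambda>x. if x \<in> Greg then (\<Sum>\<phi>\<leftarrow>L. red (\<phi> x)) else 0)"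
        by (auto simp: rd_def fun_eq_iff)
      moreover have "rd \<phi> \<in> V.span (rd ` ?I)" using Cons.prems by (intro V.span_base) auto
      ultimately show ?case using Cons by (simp add: V.span_add)
    qed
    finally show ?thesis .
  qed
  have D_span: "ind ` ?K \<subseteq> V.span (rd ` ?I)"
  proof
    fix f assume "f \<in> ind ` ?K"
    then obtain g where g: "g \<in> Greg" "f = ind (conj_class g)" unfolding p_regular_classes_eq by blast
    obtain Z :: "'k set" and c \<rho> m \<kappa> where Z: "finite Z" "\<And>z. z \<in> Z \<Longrightarrow> matrix_rep G m (\<rho> z :: 'a \<Rightarrow> 'k mat)"
      "\<kappa> \<noteq> 0" and eq: "\<And>x. x \<in> Greg \<Longrightarrow> (\<Sum>z\<in>Z. c z * mtrace (\<rho> z x)) =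
       (if \<exists>y\<in>carrier G. x = y \<otimes> g \<otimes> inv y then \<kappa> else 0)"
      by (rule class_indicator_in_trace_span[OF g(1)]) blast
    have "f = (\<lambda>x. inverse \<kappa> * (\<Sum>z\<in>Z. (\<lambda>x. c z * (if x \<in> Greg then mtrace (\<rho> z x) else 0))) x)"
    proof
      fix x
      show "f x = inverse \<kappa> * (\<Sum>z\<in>Z. (\<lambda>x. c z * (if x \<in> Greg then mtrace (\<rho> z x) else 0))) x"
        using eq[of x] Z(3) conj_class_Greg[OF g(1)] unfolding sum_eval g(2) ind_def conj_class_def
        by (cases "x \<in> Greg") auto
    qed
    also have "\<dots> \<in> V.span (rd ` ?I)"
      using Z(2) by (intro V.span_scale V.span_sum trace_span) auto
    finally show "f \<in> V.span (rd ` ?I)" .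
  qed
  have "card (ind ` ?K) \<le> card (rd ` ?I)"
    using V.independent_span_bound[OF fin_card(1) indep_D D_span] by auto
  then have "card (rd ` ?I) = card (ind ` ?K)" using fin_card by simp
  then show "card ?I = card ?K"
    using card_image[OF inj] card_image[OF inj_on_subset[OF inj_ind, of ?K]] by simp
  show "finite ?I" using fin_card(1) inj by (simp add: finite_image_iff)
qed

end

subsection \<open>Constituents and the regular character\<close>

text \<open>Substituting \<open>c X\<close> for \<open>X\<close> turns the characteristic matrix of
  \<open>c \<cdot>\<^sub>m A\<close> into \<open>c\<close> times that of \<open>A\<close>, and the
  linear factors change in the same way. For \<open>c \<noteq> 0\<close> the substitution is
  injective and can be cancelled.\<close>

lemma char_poly_smult_split:
  fixes A :: "'k :: field mat"
  assumes A: "A \<in> carrier_mat n n" and c: "c \<noteq> 0" and as: "char_poly A = (\<Prod>a\<leftarrow>as. [:- a, 1:])"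
  shows "char_poly (c \<cdot>\<^sub>m A) = (\<Prod>a\<leftarrow>as. [:- (c * a), 1:])"
proof -
  let ?h = "\<lambda>q :: 'k poly. pcompose q [:0, c:]"
  have h: "comm_ring_hom ?h"
    by unfold_locales (simp_all add: pcompose_add pcompose_mult pcompose_1)
  have cpm: "char_poly_matrix A \<in> carrier_mat n n" using A by simp
  have "map_mat ?h (char_poly_matrix (c \<cdot>\<^sub>m A)) = [:c:] \<cdot>\<^sub>m char_poly_matrix A"
    using A by (intro eq_matI) (auto simp: char_poly_matrix_def pcompose_pCons pcompose_add)
  then have "?h (char_poly (c \<cdot>\<^sub>m A)) = det ([:c:] \<cdot>\<^sub>m char_poly_matrix A)"
    unfolding char_poly_def by (simp flip: comm_ring_hom.hom_det[OF h])
  also have "\<dots> = [:c:] ^ n * char_poly A"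
    using cpm by (simp add: det_smult char_poly_def)
  also have "n = length as"
    using degree_monic_char_poly[OF A] degree_linear_factors[of uminus as, folded as] by simp
  also have "[:c:] ^ length as * char_poly A = (\<Prod>a\<leftarrow>as. [:c:] * [:- a, 1:])"
  proof -
    have "d ^ length xs * (\<Prod>a\<leftarrow>xs. f a) = (\<Prod>a\<leftarrow>xs. d * f a)" for d :: "'k poly" and f and xs :: "'k list"
      by (induction xs) (simp_all add: mult_ac)
    then show ?thesis unfolding as .
  qed
  also have "\<dots> = ?h (\<Prod>a\<leftarrow>as. [:- (c * a), 1:])"
  proof -
    have "[:c:] * [:- a, 1:] = ?h [:- (c * a), 1:]" for a by (simp add: pcompose_pCons)
    then show ?thesis by (induction as) (simp_all only: list.map prod_list.Nil prod_list.Cons pcompose_mult pcompose_1)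
  qed
  finally have "?h (char_poly (c \<cdot>\<^sub>m A) - (\<Prod>a\<leftarrow>as. [:- (c * a), 1:])) = 0"
    by (simp add: pcompose_diff)
  from pcompose_eq_0[OF this] c show ?thesis by simp
qed

text \<open>Passes from lists of irreducible Brauer characters to the multiplicity functions used in
  \<open>irreducible_constituents\<close>.\<close>

lemma count_list_sum:
  fixes f :: "'i \<Rightarrow> 'c :: comm_semiring_1"
  assumes "finite A" "set L \<subseteq> A"
  shows "(\<Sum>x\<in>A. of_nat (count_list L x) * f x) = (\<Sum>x\<leftarrow>L. f x)"
  using assms(2)
proof (induction L)
  case (Cons y L)
  have "(\<Sum>x\<in>A. of_nat (count_list (y # L) x) * f x) =
      (\<Sum>x\<in>A. (if x = y then f y else 0) + of_nat (count_list L x) * f x)"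
    by (intro sum.cong) (auto simp: algebra_simps)
  then show ?case using Cons assms(1) by (simp add: sum.distrib)
qed simp

context modular_group
begin

lemma IBr_int_independent:
  fixes a :: "('a \<Rightarrow> complex) \<Rightarrow> int"
  assumes rel: "\<And>g. g \<in> Greg \<Longrightarrow> (\<Sum>\<psi>\<in>IBr G p red. of_int (a \<psi>) * \<psi> g) = 0"
    and \<psi>: "\<psi> \<in> IBr G p red"
  shows "a \<psi> = 0"
proof -
  have div: "int p dvd b \<phi>"
    if rel: "\<And>g. g \<in> Greg \<Longrightarrow> (\<Sum>\<psi>\<in>IBr G p red. of_int (b \<psi>) * \<psi> g) = 0" and \<phi>: "\<phi> \<in> IBr G p red"
    for b :: "('a \<Rightarrow> complex) \<Rightarrow> int" and \<phi>
  proof -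
    have "(\<Sum>\<psi>\<in>IBr G p red. of_int (b \<psi>) * red (\<psi> g)) = 0" if g: "g \<in> Greg" for g
    proof -
      have "0 = red (\<Sum>\<psi>\<in>IBr G p red. of_int (b \<psi>) * \<psi> g)" using rel[OF g] by simp
      also have "\<dots> = (\<Sum>\<psi>\<in>IBr G p red. red (of_int (b \<psi>) * \<psi> g))"
        using IBr_algebraic_int[OF _ g] by (intro red_sum algebraic_int_mult) (auto simp: int_imp_algebraic_int)
      also have "\<dots> = (\<Sum>\<psi>\<in>IBr G p red. of_int (b \<psi>) * red (\<psi> g))"
        using IBr_algebraic_int[OF _ g]
        by (intro sum.cong refl) (simp add: red_mult int_imp_algebraic_int red_of_int)
      finally show ?thesis by simp
    qed
    from IBr_reduction_independent[OF finite_IBr_card(1) order_refl this \<phi>]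
    have "of_int (b \<phi>) = (0 :: 'k)" .
    then show ?thesis by (simp add: of_int_eq_0_iff_char_dvd CHAR_eq)
  qed
  have "int p ^ k dvd b \<psi>"
    if "\<And>g. g \<in> Greg \<Longrightarrow> (\<Sum>\<psi>\<in>IBr G p red. of_int (b \<psi>) * \<psi> g) = 0" for k b
    using that
  proof (induction k arbitrary: b)
    case (Suc k)
    define b' where "b' \<phi> = b \<phi> div int p" for \<phi>
    have b: "b \<phi> = int p * b' \<phi>" if "\<phi> \<in> IBr G p red" for \<phi>
      using div[OF Suc.prems that] by (simp add: b'_def)
    have "(\<Sum>\<psi>\<in>IBr G p red. of_int (b' \<psi>) * \<psi> g) = 0" if g: "g \<in> Greg" for g
    proof -
      have "0 = (\<Sum>\<psi>\<in>IBr G p red. of_int (b \<psi>) * \<psi> g)" using Suc.prems[OF g] by simp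
      also have "\<dots> = (\<Sum>\<psi>\<in>IBr G p red. of_nat p * (of_int (b' \<psi>) * \<psi> g))"
        using b by (intro sum.cong) (simp_all add: mult.assoc)
      also have "\<dots> = of_nat p * (\<Sum>\<psi>\<in>IBr G p red. of_int (b' \<psi>) * \<psi> g)"
        by (simp add: sum_distrib_left)
      finally show ?thesis using prime_p by (simp add: prime_gt_0_nat)
    qed
    from Suc.IH[OF this] show ?case using b[OF \<psi>] by simp
  qed simp
  \<comment> \<open>Every power of \<open>p\<close> divides \<open>a \<psi>\<close>. The exponent
    \<open>\<bar>a \<psi>\<bar>\<close> is already too large for a nonzero value, since
    \<open>k < 2 ^ k \<le> p ^ k\<close>.\<close>
  from this[OF rel, of "nat \<bar>a \<psi>\<bar>"] have "int p ^ nat \<bar>a \<psi>\<bar> dvd a \<psi>" by simp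
  moreover have "\<bar>a \<psi>\<bar> < int p ^ nat \<bar>a \<psi>\<bar>"
  proof -
    have "nat \<bar>a \<psi>\<bar> < 2 ^ nat \<bar>a \<psi>\<bar>" by (rule less_exp)
    also have "\<dots> \<le> p ^ nat \<bar>a \<psi>\<bar>" using prime_ge_2_nat[OF prime_p] by (intro power_mono) auto
    finally have "int (nat \<bar>a \<psi>\<bar>) < int (p ^ nat \<bar>a \<psi>\<bar>)" by (simp only: of_nat_less_iff)
    then show ?thesis by simp
  qed
  ultimately have "\<not> a \<psi> \<noteq> 0" using dvd_imp_le_int[of "a \<psi>" "int p ^ nat \<bar>a \<psi>\<bar>"] by auto
  then show ?thesis by simp
qed

text \<open>The definition asks only for some multiplicity function. Two of them differ by an
  integer relation on \<open>IBr\<close>, so every such function agrees there with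
  \<open>count_list L\<close>.\<close>

lemma irreducible_constituents_eq:
  assumes L: "set L \<subseteq> IBr G p red" and \<theta>: "\<And>g. g \<in> Greg \<Longrightarrow> \<theta> g = (\<Sum>\<phi>\<leftarrow>L. \<phi> g)"
  shows "irreducible_constituents G p red \<theta> = set L"
proof -
  have \<theta>': "\<theta> g = (\<Sum>\<psi>\<in>IBr G p red. of_nat (count_list L \<psi>) * \<psi> g)" if "g \<in> Greg" for g
    using \<theta>[OF that] count_list_sum[OF finite_IBr_card(1) L, of "\<lambda>\<psi>. \<psi> g"] by simp
  have uniq: "m \<phi> = count_list L \<phi>"
    if m: "\<forall>g\<in>Greg. \<theta> g = (\<Sum>\<psi>\<in>IBr G p red. of_nat (m \<psi>) * \<psi> g)" and \<phi>: "\<phi> \<in> IBr G p red" for m \<phi>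
  proof -
    have "(\<Sum>\<psi>\<in>IBr G p red. of_int (int (m \<psi>) - int (count_list L \<psi>)) * \<psi> g) = 0" if g: "g \<in> Greg" for g
      using m[rule_format, OF g] \<theta>'[OF g] by (simp add: left_diff_distrib sum_subtractf)
    from IBr_int_independent[OF this \<phi>] show ?thesis by simp
  qed
  show ?thesis
  proof (intro equalityI subsetI)
    fix \<phi> assume "\<phi> \<in> irreducible_constituents G p red \<theta>"
    then obtain m where m: "\<phi> \<in> IBr G p red"
      "\<forall>g\<in>Greg. \<theta> g = (\<Sum>\<psi>\<in>IBr G p red. of_nat (m \<psi>) * \<psi> g)" "0 < m \<phi>"
      unfolding irreducible_constituents_def by blast
    have "count_list L \<phi> \<noteq> 0" using uniq[OF m(2,1)] m(3) by simp
    then show "\<phi> \<in> set L" by (simp add: count_list_0_iff)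
  next
    fix \<phi> assume \<phi>: "\<phi> \<in> set L"
    then have "0 < count_list L \<phi>" by (metis count_list_0_iff gr0I)
    then show "\<phi> \<in> irreducible_constituents G p red \<theta>"
      unfolding irreducible_constituents_def using \<phi> L \<theta>' by blast
  qed
qed

text \<open>The degree is obtained as a complex number, so it certifies a nonzero character even
  when \<open>p\<close> divides \<open>n\<close> and the trace at the identity vanishes.\<close>

lemma brauer_character_one:
  assumes \<rho>: "matrix_rep G n \<rho>"
  shows "brauer_character_of G p red \<rho> \<one> = of_nat n"
proof -
  have "\<rho> \<one> = 1\<^sub>m n" using \<rho> by (simp add: matrix_rep_def)
  moreover have "char_poly (1\<^sub>m n :: 'k mat) = (\<Prod>a\<leftarrow>diag_mat (1\<^sub>m n). [:- a, 1:])"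
    by (rule char_poly_upper_triangular[of _ n]) auto
  ultimately have "brauer_character_of G p red \<rho> \<one> = (\<Sum>a\<leftarrow>diag_mat (1\<^sub>m n :: 'k mat). lift_root p red a)"
    unfolding brauer_character_root_sum[OF \<rho> one_Greg] by (simp only: root_sum_split)
  also have "\<dots> = (\<Sum>i\<leftarrow>[0..<n]. 1)"
    unfolding diag_mat_def map_map by (intro arg_cong[of _ _ sum_list] map_cong) auto
  also have "\<dots> = of_nat n" by (simp add: sum_list_triv)
  finally show ?thesis .
qed

lemma brauer_character_undefined: "g \<notin> Greg \<Longrightarrow> brauer_character_of G p red \<rho> g = undefined"
  by (simp add: brauer_character_of_def)

lemma brauer_characters_add:
  assumes "\<theta> \<in> brauer_characters G p red" "\<eta> \<in> brauer_characters G p red"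
  shows "(\<lambda>g\<in>Greg. \<theta> g + \<eta> g) \<in> brauer_characters G p red"
proof -
  obtain n \<rho> where \<rho>: "matrix_rep G n \<rho>" "\<theta> = brauer_character_of G p red \<rho>"
    using assms(1) by (auto simp: brauer_characters_def)
  obtain m \<sigma> where \<sigma>: "matrix_rep G m \<sigma>" "\<eta> = brauer_character_of G p red \<sigma>"
    using assms(2) by (auto simp: brauer_characters_def)
  obtain \<tau> where \<tau>: "matrix_rep G (n + m) \<tau>" "\<And>g. g \<in> carrier G \<Longrightarrow> char_poly (\<tau> g) = char_poly (\<rho> g) * char_poly (\<sigma> g)"
    using matrix_rep_direct_sum[OF \<rho>(1) \<sigma>(1)] by blast
  have "brauer_character_of G p red \<tau> g = \<theta> g + \<eta> g" if g: "g \<in> Greg" for g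
  proof -
    have gc: "g \<in> carrier G" using g Greg_carrier by simp
    have "char_poly (\<rho> g) \<noteq> 0" "char_poly (\<sigma> g) \<noteq> 0"
      using \<rho>(1) \<sigma>(1) gc char_poly_nonzero[of "\<rho> g" n] char_poly_nonzero[of "\<sigma> g" m] by (auto simp: matrix_rep_def)
    then show ?thesis
      using g gc by (simp add: \<rho>(2) \<sigma>(2) \<tau>(2) brauer_character_root_sum[OF \<rho>(1)]
          brauer_character_root_sum[OF \<sigma>(1)] brauer_character_root_sum[OF \<tau>(1)] root_sum_mult)
  qed
  then have "(\<lambda>g\<in>Greg. \<theta> g + \<eta> g) = brauer_character_of G p red \<tau>"
    by (auto simp: fun_eq_iff restrict_def brauer_character_of_def)
  then show ?thesis using \<tau>(1) by (auto simp: brauer_characters_def)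
qed

lemma IBr_subset_brauer_characters: "IBr G p red \<subseteq> brauer_characters G p red"
  by (auto simp: IBr_def brauer_characters_def irreducible_rep_def)

text \<open>After constituents are removed from a Brauer character only a sum of irreducible ones
  remains. It has to be realized by a representation again, of degree \<open>0\<close> if the list
  is empty.\<close>

lemma brauer_characters_sum:
  assumes "set L \<subseteq> IBr G p red"
  shows "(\<lambda>g\<in>Greg. \<Sum>\<phi>\<leftarrow>L. \<phi> g) \<in> brauer_characters G p red"
  using assms
proof (induction L)
  case Nil
  have rep: "matrix_rep G 0 (\<lambda>_. 1\<^sub>m 0 :: 'k mat)" by (auto simp: matrix_rep_def)
  have "(\<lambda>g\<in>Greg. \<Sum>\<phi>\<leftarrow>[]. \<phi> g) = brauer_character_of G p red (\<lambda>_. 1\<^sub>m 0)"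
    using brauer_character_root_sum[OF rep]
    by (auto simp: fun_eq_iff char_poly_0_dim brauer_character_undefined restrict_def)
  then show ?case using rep by (auto simp: brauer_characters_def)
next
  case (Cons \<phi> L)
  have eq: "(\<lambda>g\<in>Greg. \<Sum>\<phi>\<leftarrow>\<phi> # L. \<phi> g) = (\<lambda>g\<in>Greg. \<phi> g + (\<lambda>g\<in>Greg. \<Sum>\<phi>\<leftarrow>L. \<phi> g) g)"
    by (auto simp: restrict_def)
  show ?case
    unfolding eq using Cons IBr_subset_brauer_characters by (intro brauer_characters_add) auto
qed

lemma trivial_IBr: "(\<lambda>g\<in>Greg. 1) \<in> IBr G p red"
proof -
  have rep: "matrix_rep G 1 (\<lambda>_. 1\<^sub>m 1 :: 'k mat)" by (auto simp: matrix_rep_def)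
  have "irreducible_rep G 1 (\<lambda>_. 1\<^sub>m 1 :: 'k mat)"
    unfolding irreducible_rep_iff
  proof (intro conjI rep allI impI)
    fix W :: "'k vec set"
    assume W: "vec_subspace 1 W"
    show "W = {0\<^sub>v 1} \<or> W = carrier_vec 1"
    proof (rule disjCI)
      assume "W \<noteq> carrier_vec 1"
      have "w = 0\<^sub>v 1" if w: "w \<in> W" for w
      proof (rule ccontr)
        assume "w \<noteq> 0\<^sub>v 1"
        have wc: "w \<in> carrier_vec 1" using w W by (auto simp: vec_subspace_def)
        then have w0: "w $ 0 \<noteq> 0" using \<open>w \<noteq> 0\<^sub>v 1\<close> by (metis eq_vecI carrier_vecD index_zero_vec less_one)
        have "v \<in> W" if v: "v \<in> carrier_vec 1" for v
        proof -
          have "v = (v $ 0 / w $ 0) \<cdot>\<^sub>v w" using v wc w0 by (intro eq_vecI) auto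
          moreover have "(v $ 0 / w $ 0) \<cdot>\<^sub>v w \<in> W" using W w by (auto simp: vec_subspace_def)
          ultimately show ?thesis by metis
        qed
        then show False using \<open>W \<noteq> carrier_vec 1\<close> W by (auto simp: vec_subspace_def)
      qed
      then show "W = {0\<^sub>v 1}" using W by (auto simp: vec_subspace_def)
    qed
  qed simp
  moreover have "brauer_character_of G p red (\<lambda>_. 1\<^sub>m 1) = (\<lambda>g\<in>Greg. 1)"
    using brauer_character_one[OF rep] brauer_character_root_sum[OF rep] one_Greg
    by (auto simp: fun_eq_iff brauer_character_undefined restrict_def)
  ultimately show ?thesis unfolding IBr_def by force
qed

text \<open>Weighting a basis vector \<open>g\<^sup>j x\<close> by \<open>\<zeta>\<^sup>j\<close>, where \<open>\<zeta>\<close> is a root of unity of order dividing that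
  of \<open>g\<close>, conjugates the regular representation of \<open>g\<close> to \<open>\<zeta>\<close> times itself; so the Brauer
  character value at \<open>g\<close> is invariant under multiplication by the lift of \<open>\<zeta>\<close>.\<close>

lemma regular_brauer_character:
  obtains n \<rho> where "n > 0" "matrix_rep G n (\<rho> :: 'a \<Rightarrow> 'k mat)"
    "\<And>g. g \<in> Greg \<Longrightarrow> g \<noteq> \<one> \<Longrightarrow> brauer_character_of G p red \<rho> g = 0"
proof -
  \<comment> \<open>For the trivial subgroup \<open>t\<close> enumerates the group, and the induced
    representation is the regular one.\<close>
  obtain m :: nat and t where t: "\<And>i. i < m \<Longrightarrow> t i \<in> carrier G"
    "\<And>x. x \<in> carrier G \<Longrightarrow> \<exists>!i. i < m \<and> inv (t i) \<otimes> x \<in> {\<one>}"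
    using left_transversal[OF triv_subgroup finite_carrier] by blast
  define \<rho> where "\<rho> = induced_rep {\<one>} (\<lambda>_. 1 :: 'k) m t"
  have rep: "matrix_rep G m \<rho>"
    unfolding \<rho>_def by (rule matrix_rep_induced[OF triv_subgroup _ _ t]) auto
  have "m > 0" using t(2)[of \<one>] by auto
  moreover have "brauer_character_of G p red \<rho> g = 0" if g: "g \<in> Greg" "g \<noteq> \<one>" for g
  proof -
    have gc: "g \<in> carrier G" using g Greg_carrier by simp
    define n where "n = ord g"
    have pn: "\<not> p dvd n" using g by (simp add: n_def p_regular_elements_def)
    have n1: "n > 1" using ord_ge_1[OF finite_carrier gc] ord_eq_1[OF gc] g(2) by (simp add: n_def)
    obtain z :: 'k where z: "z ^ n = 1" "z \<noteq> 1"
      using ex_nontrivial_root[of n 1] pn n1 by auto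
    have z0: "z \<noteq> 0" using z(1) n1 by (auto simp: power_0_left)
    define R where "R x = {g [^] (j :: nat) \<otimes> x | j. True}" for x
    \<comment> \<open>The representative \<open>s x\<close> depends only on the orbit
      \<open>R x\<close> under left multiplication by powers of \<open>g\<close>. Hence
      \<open>e (g \<otimes> x)\<close> and \<open>Suc (e x)\<close> agree modulo
      \<open>n\<close>.\<close>
    define s where "s x = (SOME y. y \<in> R x)" for x
    define e where "e x = (SOME j :: nat. x = g [^] j \<otimes> s x)" for x
    have gn: "g [^] (n * j) = \<one>" for j :: nat using gc by (simp add: pow_eq_id n_def)
    have s: "s x \<in> R x" for x unfolding s_def by (rule someI_ex) (auto simp: R_def)
    have sc: "s x \<in> carrier G" if "x \<in> carrier G" for x using s[of x] gc that by (auto simp: R_def)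
    have e: "x = g [^] e x \<otimes> s x" if x: "x \<in> carrier G" for x
      unfolding e_def
    proof (rule someI_ex)
      obtain j :: nat where j: "s x = g [^] j \<otimes> x" using s[of x] by (auto simp: R_def)
      have "g [^] ((n - 1) * j) \<otimes> s x = g [^] ((n - 1) * j + j) \<otimes> x"
        unfolding j using gc x by (simp add: m_assoc[symmetric] nat_pow_mult)
      also have "(n - 1) * j + j = n * j" using n1 by (cases n) auto
      finally have "x = g [^] ((n - 1) * j) \<otimes> s x" using gn[of j] x by simp
      then show "\<exists>j :: nat. x = g [^] j \<otimes> s x" ..
    qed
    have Rg: "R (g \<otimes> x) = R x" if x: "x \<in> carrier G" for x
    proof (intro equalityI subsetI)
      fix y assume "y \<in> R (g \<otimes> x)"
      then obtain j :: nat where "y = g [^] j \<otimes> (g \<otimes> x)" by (auto simp: R_def)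
      then have "y = g [^] Suc j \<otimes> x" using gc x by (simp add: m_assoc)
      then show "y \<in> R x" unfolding R_def by blast
    next
      fix y assume "y \<in> R x"
      then obtain j :: nat where j: "y = g [^] j \<otimes> x" by (auto simp: R_def)
      have "g [^] (j + (n - 1)) \<otimes> (g \<otimes> x) = g [^] Suc (j + (n - 1)) \<otimes> x" using gc x by (simp add: m_assoc)
      also have "Suc (j + (n - 1)) = n * 1 + j" using n1 by simp
      also have "g [^] (n * 1 + j) = g [^] j" using gn[of 1] gc by (simp flip: nat_pow_mult)
      finally have "y = g [^] (j + (n - 1)) \<otimes> (g \<otimes> x)" unfolding j ..
      then show "y \<in> R (g \<otimes> x)" unfolding R_def by blast
    qed
    have sg: "s (g \<otimes> x) = s x" if "x \<in> carrier G" for x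
      unfolding s_def Rg[OF that] ..
    define f where "f x = z ^ e x" for x
    have f0: "f x \<noteq> 0" for x using z0 by (simp add: f_def)
    have fg: "f (g \<otimes> x) = z * f x" if x: "x \<in> carrier G" for x
    proof -
      have "g [^] e (g \<otimes> x) \<otimes> s x = g \<otimes> x" using e[of "g \<otimes> x"] sg[OF x] gc x by simp
      also have "\<dots> = g \<otimes> (g [^] e x \<otimes> s x)" using e[OF x] by simp
      also have "\<dots> = g [^] Suc (e x) \<otimes> s x"
        unfolding nat_pow_Suc2[OF gc] using gc sc[OF x] by (simp only: m_assoc nat_pow_closed)
      finally have "g [^] e (g \<otimes> x) = g [^] Suc (e x)" using gc sc[OF x] by (metis nat_pow_closed right_cancel)
      then have "[e (g \<otimes> x) = Suc (e x)] (mod n)" unfolding nat_pow_eq_cong[OF gc] n_def .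
      then have "z ^ e (g \<otimes> x) = z ^ Suc (e x)"
        using unity_root_power_mod[OF z(1)] by (metis cong_def)
      then show ?thesis by (simp add: f_def)
    qed
    define D where "D = mat m m (\<lambda>(i, j). if i = j then f (t i) else 0)"
    define D' where "D' = mat m m (\<lambda>(i, j). if i = j then inverse (f (t i)) else 0)"
    have D: "D \<in> carrier_mat m m" "D' \<in> carrier_mat m m" by (auto simp: D_def D'_def)
    have D_mult: "(D * A) $$ (i, j) = f (t i) * A $$ (i, j)" if "A \<in> carrier_mat m m" "i < m" "j < m" for A i j
    proof -
      have "(D * A) $$ (i, j) = (\<Sum>k = 0..<m. if k = i then f (t i) * A $$ (i, j) else 0)"
      proof -
        have "(D * A) $$ (i, j) = (\<Sum>k = 0..<m. D $$ (i, k) * A $$ (k, j))"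
          using that D by (simp add: scalar_prod_def)
        also have "\<dots> = (\<Sum>k = 0..<m. if k = i then f (t i) * A $$ (i, j) else 0)"
          using that by (intro sum.cong) (auto simp: D_def)
        finally show ?thesis .
      qed
      then show ?thesis using that by simp
    qed
    have mult_D': "(A * D') $$ (i, j) = A $$ (i, j) * inverse (f (t j))" if "A \<in> carrier_mat m m" "i < m" "j < m" for A i j
    proof -
      have "(A * D') $$ (i, j) = (\<Sum>k = 0..<m. if k = j then A $$ (i, j) * inverse (f (t j)) else 0)"
      proof -
        have "(A * D') $$ (i, j) = (\<Sum>k = 0..<m. A $$ (i, k) * D' $$ (k, j))"
          using that D by (simp add: scalar_prod_def)
        also have "\<dots> = (\<Sum>k = 0..<m. if k = j then A $$ (i, j) * inverse (f (t j)) else 0)"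
          using that by (intro sum.cong) (auto simp: D'_def)
        finally show ?thesis .
      qed
      then show ?thesis using that by simp
    qed
    have DD': "D * D' = 1\<^sub>m m"
      by (rule eq_matI) (use D D_mult[OF D(2)] f0 in \<open>auto simp: D'_def\<close>)
    have D'D: "D' * D = 1\<^sub>m m" by (rule mat_mult_left_right_inverse[OF D DD'])
    have \<rho>c: "\<rho> g \<in> carrier_mat m m" by (simp add: \<rho>_def induced_rep_def)
    \<comment> \<open>Entry \<open>(i, j)\<close> of \<open>\<rho> g\<close> is nonzero only if
      \<open>t i = g \<otimes> t j\<close>, and there the two weights have quotient
      \<open>z\<close>.\<close>
    have "D * \<rho> g * D' = z \<cdot>\<^sub>m \<rho> g"
    proof (rule eq_matI)
      fix i j assume "i < dim_row (z \<cdot>\<^sub>m \<rho> g)" "j < dim_col (z \<cdot>\<^sub>m \<rho> g)"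
      then have ij: "i < m" "j < m" using \<rho>c by auto
      have tc: "t i \<in> carrier G" "t j \<in> carrier G" using t(1) ij by auto
      have eq: "(D * \<rho> g * D') $$ (i, j) = f (t i) * \<rho> g $$ (i, j) * inverse (f (t j))"
        using mult_D'[of "D * \<rho> g" i j] D_mult[OF \<rho>c ij] D \<rho>c ij by simp
      show "(D * \<rho> g * D') $$ (i, j) = (z \<cdot>\<^sub>m \<rho> g) $$ (i, j)"
      proof (cases "inv (t i) \<otimes> g \<otimes> t j = \<one>")
        case True
        then have "inv (t i) \<otimes> (g \<otimes> t j) = \<one>" using tc gc by (simp add: m_assoc)
        then have "t i = g \<otimes> t j" using tc gc by (metis inv_equality inv_inv m_closed inv_closed)
        then have "f (t i) = z * f (t j)" using fg[OF tc(2)] by simp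
        then show ?thesis unfolding eq using True f0[of "t j"] ij \<rho>c by (simp add: \<rho>_def induced_rep_def)
      next
        case False
        then show ?thesis unfolding eq using ij by (simp add: \<rho>_def induced_rep_def)
      qed
    qed (use D \<rho>c in auto)
    then have cp: "char_poly (z \<cdot>\<^sub>m \<rho> g) = char_poly (\<rho> g)"
      using char_poly_conj[OF \<rho>c D(2,1) D'D DD'] by simp
    obtain as where as: "\<And>a. a \<in> set as \<Longrightarrow> a ^ ord g = 1" "char_poly (\<rho> g) = (\<Prod>a\<leftarrow>as. [:- a, 1:])"
      "brauer_character_of G p red \<rho> g = (\<Sum>a\<leftarrow>as. lift_root p red a)"
      using brauer_character_eigenvalues[OF rep g(1)] by metis
    let ?l = "lift_root p red"
    let ?b = "brauer_character_of G p red \<rho> g"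
    have "char_poly (z \<cdot>\<^sub>m \<rho> g) = (\<Prod>a\<leftarrow>map ((*) z) as. [:- a, 1:])"
      using char_poly_smult_split[OF \<rho>c z0 as(2)] by (simp add: o_def)
    then have "?b = (\<Sum>a\<leftarrow>map ((*) z) as. ?l a)"
      unfolding brauer_character_root_sum[OF rep g(1)] cp[symmetric] by (simp only: root_sum_split)
    also have "\<dots> = (\<Sum>a\<leftarrow>as. ?l z * ?l a)"
      unfolding map_map using as(1) z(1) pn
      by (intro arg_cong[of _ _ sum_list] map_cong) (auto simp: n_def intro!: lift_root_mult)
    also have "\<dots> = ?l z * ?b" unfolding as(3) by (rule sum_list_const_mult)
    finally have "(?l z - 1) * ?b = 0" by (simp add: algebra_simps)
    moreover have "?l z \<noteq> 1" using lift_root(2)[OF z(1) pn] z(2) red_one by auto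
    ultimately show ?thesis by simp
  qed
  ultimately show ?thesis using that rep by blast
qed

end

subsection \<open>Super-Brauer character theories\<close>

text \<open>Every block contributes at least one element to \<open>A\<close>; equality of the
  cardinalities excludes a block with two.\<close>

lemma card_partition_on_le:
  assumes P: "partition_on A P" and A: "finite A"
  shows "card P \<le> card A" "card P = card A \<Longrightarrow> P = (\<lambda>x. {x}) ` A"
proof -
  have fin: "finite P" using finite_elements[OF A P] .
  have finB: "finite B" "B \<noteq> {}" if "B \<in> P" for B
    using P A that by (auto simp: partition_on_def intro: finite_subset)
  have "card A = (\<Sum>B\<in>P. card B)"
    using P finB by (auto simp: partition_on_def disjoint_def pairwise_def disjnt_def intro!: card_Union_disjoint)
  moreover have ge: "1 \<le> card B" if "B \<in> P" for B
    using finB[OF that] by (simp add: Suc_le_eq card_gt_0_iff)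
  ultimately show "card P \<le> card A" using sum_mono[of P "\<lambda>_. 1" card] by simp
  assume eq: "card P = card A"
  have card1: "card B = 1" if B: "B \<in> P" for B
  proof (rule ccontr)
    assume "card B \<noteq> 1"
    then have "1 < card B" using ge[OF B] by simp
    then have "(\<Sum>B\<in>P. 1) < (\<Sum>B\<in>P. card B)"
      using ge B by (intro sum_strict_mono_ex1 fin) blast+
    then show False using eq \<open>card A = _\<close> by simp
  qed
  show "P = (\<lambda>x. {x}) ` A"
  proof (intro equalityI subsetI)
    fix B assume B: "B \<in> P"
    then obtain x where "B = {x}" using card1 by (auto simp: card_1_singleton_iff)
    then show "B \<in> (\<lambda>x. {x}) ` A" using P B by (auto simp: partition_on_def)
  next
    fix B assume "B \<in> (\<lambda>x. {x}) ` A"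
    then obtain x where x: "x \<in> A" "B = {x}" by auto
    then obtain B' where B': "B' \<in> P" "x \<in> B'" using P by (auto simp: partition_on_def)
    then obtain y where "B' = {y}" using card1 by (auto simp: card_1_singleton_iff)
    then show "B \<in> P" using x B' by auto
  qed
qed

context modular_group
begin

lemma singleton_theory:
  "super_brauer_character_theory G p red ((\<lambda>\<phi>. {\<phi>}) ` IBr G p red, p_regular_classes G p)"
  unfolding super_brauer_character_theory_def prod.case
proof (intro conjI ballI)
  show "partition_on (IBr G p red) ((\<lambda>\<phi>. {\<phi>}) ` IBr G p red)"
    by (auto simp: partition_on_def disjoint_def)
  show "partition_on Greg (p_regular_classes G p)" by (rule partition_on_p_regular_classes)
  show "card ((\<lambda>\<phi>. {\<phi>}) ` IBr G p red) = card (p_regular_classes G p)"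
    using finite_IBr_card(2) by (simp add: card_image)
  show "{\<one>} \<in> p_regular_classes G p" by (rule one_class)
  fix X assume "X \<in> (\<lambda>\<phi>. {\<phi>}) ` IBr G p red"
  then obtain \<phi> where \<phi>: "\<phi> \<in> IBr G p red" "X = {\<phi>}" by blast
  obtain n \<sigma> where \<sigma>: "irreducible_rep G n \<sigma>" "matrix_rep G n \<sigma>" "\<phi> = brauer_character_of G p red \<sigma>"
    using \<phi>(1) by (rule IBr_E)
  have "\<phi> \<one> = of_nat n" unfolding \<sigma>(3) by (rule brauer_character_one[OF \<sigma>(2)])
  then have "\<phi> \<one> \<noteq> 0" using \<sigma>(1) by (simp add: irreducible_rep_def)
  moreover have "irreducible_constituents G p red \<phi> = set [\<phi>]"
    using \<phi>(1) by (intro irreducible_constituents_eq) auto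
  moreover have "\<exists>c. \<forall>g\<in>K. \<phi> g = c" if K: "K \<in> p_regular_classes G p" for K
  proof -
    obtain g where g: "g \<in> Greg" "K = conj_class g" using K unfolding p_regular_classes_eq by blast
    then show ?thesis using IBr_class_function[OF \<phi>(1)] by blast
  qed
  ultimately show "\<exists>\<theta>\<in>brauer_characters G p red. (\<exists>g\<in>Greg. \<theta> g \<noteq> 0) \<and>
      irreducible_constituents G p red \<theta> \<subseteq> X \<and> (\<forall>K\<in>p_regular_classes G p. \<exists>c. \<forall>g\<in>K. \<theta> g = c)"
    using \<phi> one_Greg IBr_subset_brauer_characters by (intro bexI[of _ \<phi>]) auto
qed

text \<open>Removing the trivial constituents from the regular Brauer character leaves a character that is
  constant on the nonidentity p-regular elements.\<close>

lemma coarse_theory: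
  assumes nontrivial: "Greg \<noteq> {\<one>}" and two: "card (IBr G p red) \<ge> 2"
  shows "super_brauer_character_theory G p red
    ({{\<lambda>g\<in>Greg. 1}, IBr G p red - {\<lambda>g\<in>Greg. 1}}, {{\<one>}, Greg - {\<one>}})"
  unfolding super_brauer_character_theory_def prod.case
proof (intro conjI ballI)
  let ?I = "IBr G p red" and ?t = "\<lambda>g\<in>Greg. 1 :: complex"
  have rest: "?I - {?t} \<noteq> {}"
  proof
    assume "?I - {?t} = {}"
    then have "?I \<subseteq> {?t}" by blast
    then have "card ?I \<le> 1" using card_mono[of "{?t}" ?I] by simp
    then show False using two by simp
  qed
  have Grest: "Greg - {\<one>} \<noteq> {}" using nontrivial one_Greg by blast
  show "partition_on ?I {{?t}, ?I - {?t}}"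
    using trivial_IBr rest by (auto simp: partition_on_def disjoint_def)
  show "partition_on Greg {{\<one>}, Greg - {\<one>}}"
    using one_Greg Grest by (auto simp: partition_on_def disjoint_def)
  have "{?t} \<noteq> ?I - {?t}" "{\<one>} \<noteq> Greg - {\<one>}" by blast+
  then show "card {{?t}, ?I - {?t}} = card {{\<one>}, Greg - {\<one>}}" by simp
  show "{\<one>} \<in> {{\<one>}, Greg - {\<one>}}" by simp
  fix X assume X: "X \<in> {{?t}, ?I - {?t}}"
  show "\<exists>\<theta>\<in>brauer_characters G p red. (\<exists>g\<in>Greg. \<theta> g \<noteq> 0) \<and>
      irreducible_constituents G p red \<theta> \<subseteq> X \<and> (\<forall>K\<in>{{\<one>}, Greg - {\<one>}}. \<exists>c. \<forall>g\<in>K. \<theta> g = c)"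
  proof (cases "X = {?t}")
    case True
    have "irreducible_constituents G p red ?t = set [?t]"
      using trivial_IBr by (intro irreducible_constituents_eq) auto
    then show ?thesis
      using True trivial_IBr one_Greg IBr_subset_brauer_characters by (intro bexI[of _ ?t]) auto
  next
    case False
    then have X: "X = ?I - {?t}" using X by simp
    obtain n \<rho> where \<rho>: "n > 0" "matrix_rep G n (\<rho> :: 'a \<Rightarrow> 'k mat)"
      "\<And>g. g \<in> Greg \<Longrightarrow> g \<noteq> \<one> \<Longrightarrow> brauer_character_of G p red \<rho> g = 0"
      using regular_brauer_character by blast
    obtain L where L: "set L \<subseteq> ?I" "\<And>g. g \<in> Greg \<Longrightarrow> brauer_character_of G p red \<rho> g = (\<Sum>\<phi>\<leftarrow>L. \<phi> g)"
      using brauer_character_decomposition[OF \<rho>(2)] by blast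
    let ?L = "filter (\<lambda>\<phi>. \<phi> \<noteq> ?t) L"
    let ?\<theta> = "\<lambda>g\<in>Greg. \<Sum>\<phi>\<leftarrow>?L. \<phi> g"
    have split: "(\<Sum>\<phi>\<leftarrow>M. \<phi> g) = (\<Sum>\<phi>\<leftarrow>filter (\<lambda>\<phi>. \<phi> \<noteq> ?t) M. \<phi> g) + of_nat (count_list M ?t)"
      if "g \<in> Greg" for g and M :: "('a \<Rightarrow> complex) list"
      using that by (induction M) auto
    have val: "?\<theta> g = brauer_character_of G p red \<rho> g - of_nat (count_list L ?t)" if "g \<in> Greg" for g
      using split[OF that, of L] L(2)[OF that] that by simp
    obtain h where h: "h \<in> Greg" "h \<noteq> \<one>" using Grest by blast
    \<comment> \<open>If the trivial character does not occur in \<open>L\<close>, nothing was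
      removed and the value at the identity is \<open>n\<close>. If it occurs, the value at
      \<open>h\<close> is minus its multiplicity. Either way the function is nonzero.\<close>
    have "\<exists>g\<in>Greg. ?\<theta> g \<noteq> 0"
    proof (cases "count_list L ?t = 0")
      case True
      then have "?\<theta> \<one> = of_nat n" using val[OF one_Greg] brauer_character_one[OF \<rho>(2)] by simp
      then have "?\<theta> \<one> \<noteq> 0" using \<rho>(1) by simp
      then show ?thesis using one_Greg by blast
    next
      case False
      then have "?\<theta> h \<noteq> 0" using val[OF h(1)] \<rho>(3)[OF h] by simp
      then show ?thesis using h(1) by blast
    qed
    moreover have "irreducible_constituents G p red ?\<theta> = set ?L"
      using L(1) by (intro irreducible_constituents_eq) auto
    moreover have "set ?L \<subseteq> X" using L(1) X by auto
    moreover have "\<exists>c. \<forall>g\<in>K. ?\<theta> g = c" if "K \<in> {{\<one>}, Greg - {\<one>}}" for K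
    proof (cases "K = {\<one>}")
      case False
      then have "\<forall>g\<in>K. ?\<theta> g = - of_nat (count_list L ?t)" using that val \<rho>(3) by simp
      then show ?thesis by blast
    qed simp
    moreover have "?\<theta> \<in> brauer_characters G p red"
      using L(1) by (intro brauer_characters_sum) auto
    ultimately show ?thesis by (intro bexI[of _ ?\<theta>]) auto
  qed
qed

text \<open>Besides the block of the identity there is room for at most one block in
  \<open>K\<close>, so it contains all other p-regular elements. Subtracting \<open>{{}}\<close>
  covers the case where the identity is the only p-regular element.\<close>

lemma theory_unique_if_card_le_2:
  assumes card: "card (p_regular_classes G p) \<le> 2"
    and T: "super_brauer_character_theory G p red (X, K)"
  shows "(X, K) = ((\<lambda>\<phi>. {\<phi>}) ` IBr G p red, {{\<one>}} \<union> ({Greg - {\<one>}} - {{}}))"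
proof -
  have X: "partition_on (IBr G p red) X" and K: "partition_on Greg K" and XK: "card X = card K"
    and one: "{\<one>} \<in> K" using T by (auto simp: super_brauer_character_theory_def)
  note le = card_partition_on_le[OF X finite_IBr_card(1)]
  have finK: "finite K" using finite_elements[OF finite_Greg K] .
  have cardK: "card K \<le> card (p_regular_classes G p)" using le(1) XK finite_IBr_card(2) by simp
  have fin': "finite (K - {{\<one>}})" using finK by simp
  have "card (K - {{\<one>}}) \<le> 1" using cardK card one finK by (simp add: card_Diff_singleton)
  then have "\<forall>B\<in>K - {{\<one>}}. \<forall>C\<in>K - {{\<one>}}. B = C"
    unfolding One_nat_def card_le_Suc0_iff_eq[OF fin'] .
  then have sub: "B = C" if "B \<in> K - {{\<one>}}" "C \<in> K - {{\<one>}}" for B C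
    using that by blast
  have Un: "\<Union>(K - {{\<one>}}) = Greg - {\<one>}"
  proof -
    have "\<one> \<notin> B" if "B \<in> K - {{\<one>}}" for B
      using disjointD[OF partition_onD2[OF K] one, of B] that by auto
    moreover have "Greg = \<Union>(K - {{\<one>}}) \<union> {\<one>}" using partition_onD1[OF K] one by blast
    ultimately show ?thesis by blast
  qed
  have Keq: "K = {{\<one>}} \<union> ({Greg - {\<one>}} - {{}})"
  proof (cases "K - {{\<one>}} = {}")
    case True
    then show ?thesis using Un one by auto
  next
    case False
    then obtain B where B: "B \<in> K - {{\<one>}}" by blast
    then have "K - {{\<one>}} = {B}" using sub by blast
    moreover from this have "B = Greg - {\<one>}" using Un by simp
    moreover have "B \<noteq> {}" using B K by (auto simp: partition_on_def)
    ultimately show ?thesis using one by blast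
  qed
  \<comment> \<open>This equality lets the equality case of \<open>card_partition_on_le\<close>
    force singletons in \<open>X\<close>, whose size is that of \<open>K\<close>.\<close>
  have "card K = card (p_regular_classes G p)"
  proof (cases "Greg = {\<one>}")
    case True
    then have "p_regular_classes G p = {{\<one>}}" unfolding p_regular_classes_eq using conj_class_one by simp
    then show ?thesis using Keq True by simp
  next
    case False
    then have "Greg - {\<one>} \<noteq> {}" using one_Greg by blast
    then have "K = {{\<one>}, Greg - {\<one>}}" using Keq by blast
    moreover have "{\<one>} \<noteq> Greg - {\<one>}" by blast
    ultimately have "card K = 2" by simp
    then show ?thesis using cardK card by simp
  qed
  then have "X = (\<lambda>\<phi>. {\<phi>}) ` IBr G p red" using le(2) XK finite_IBr_card(2) by simp
  then show ?thesis using Keq by simp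
qed

lemma ex1_theory_iff:
  "(\<exists>!T. super_brauer_character_theory G p red T) \<longleftrightarrow>
     card (p_regular_classes G p) = 1 \<or> card (p_regular_classes G p) = 2"
proof
  assume ex1: "\<exists>!T. super_brauer_character_theory G p red T"
  have pos: "card (p_regular_classes G p) \<noteq> 0" using finite_classes one_class by auto
  show "card (p_regular_classes G p) = 1 \<or> card (p_regular_classes G p) = 2"
  proof (rule ccontr)
    assume "\<not> ?thesis"
    then have three: "card (p_regular_classes G p) \<ge> 3" using pos by linarith
    have "Greg \<noteq> {\<one>}"
    proof
      assume "Greg = {\<one>}"
      then have "p_regular_classes G p = {{\<one>}}" unfolding p_regular_classes_eq using conj_class_one by simp
      then show False using three by simp
    qed
    then have "super_brauer_character_theory G p red
      ({{\<lambda>g\<in>Greg. 1}, IBr G p red - {\<lambda>g\<in>Greg. 1}}, {{\<one>}, Greg - {\<one>}})"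
      using three finite_IBr_card(2) by (intro coarse_theory) auto
    \<comment> \<open>Uniqueness identifies the two extreme theories. Comparing only their second
      components is enough, since one has at least three members and the other at most two.\<close>
    then have "p_regular_classes G p = {{\<one>}, Greg - {\<one>}}" using ex1 singleton_theory by blast
    moreover have "card {{\<one>}, Greg - {\<one>}} \<le> 2" by (simp add: card_insert_if)
    ultimately show False using three by simp
  qed
next
  assume "card (p_regular_classes G p) = 1 \<or> card (p_regular_classes G p) = 2"
  then have "card (p_regular_classes G p) \<le> 2" by auto
  then have uniq: "T = ((\<lambda>\<phi>. {\<phi>}) ` IBr G p red, {{\<one>}} \<union> ({Greg - {\<one>}} - {{}}))"
    if "super_brauer_character_theory G p red T" for T
    using theory_unique_if_card_le_2[of "fst T" "snd T"] that by simp
  show "\<exists>!T. super_brauer_character_theory G p red T"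
    using singleton_theory uniq by metis
qed

end

theorem theorem1p1:
  fixes G :: "('a, 'b) monoid_scheme" and p :: nat and red :: "complex \<Rightarrow> 'k :: field"
  assumes "group G" and "finite (carrier G)" and "prime p"
    and "p_modular_reduction p red"
  shows "(\<exists>!T. super_brauer_character_theory G p red T) \<longleftrightarrow>
         card (p_regular_classes G p) = 1 \<or> card (p_regular_classes G p) = 2"
proof -
  interpret modular_group p red G
    using assms by (intro modular_group.intro modular.intro modular_group_axioms.intro modular_axioms.intro)
  show ?thesis by (rule ex1_theory_iff)
qed

end
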